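(* For every finite non-empty set $R\subseteq\mathbb{Z}$ there exist constants $C, C_R>0$, depending only on $R$, such that the following holds for every $n\in\mathbb{N}$. If $$f(\theta)=\sum_{r=0}^{n} C_r\cos(r\theta)$$ is a cosine polynomial with $C_r\in R$ for all $r\in\{0,1,\dots,n\}$, and if $|f(0)|\ge C(\log M(R))^2$ and $|f(0)|>2^{16}$ (so that the iterated logarithms below are defined and positive), then $f$ has at least $$C_R\left(\frac{\log_{(3)}|f(0)|}{\log_{(5)}|f(0)|}\right)^{1/2}$$ zeros in $[0,2\pi]$.
   Context: $\mathbb{N}=\{1,2,3,\dots\}$. For a finite set of real numbers $R$, $M(R)=\max\{|x|:x\in R\}$. All logarithms are to base $2$, and $\log_{(r)}$ denotes the $r$-fold iterated logarithm, e.g. $\log_{(3)}x=\log\log\log x$. *)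

theory Defs
  imports Complex_Main
begin

definition max_abs :: "real set \<Rightarrow> real" where
  "max_abs R = Max (abs ` R)"

definition iter_log2 :: "nat \<Rightarrow> real \<Rightarrow> real" where
  "iter_log2 r x = (log 2 ^^ r) x"

definition cosine_poly :: "nat \<Rightarrow> (nat \<Rightarrow> real) \<Rightarrow> real \<Rightarrow> real" where
  "cosine_poly n c \<theta> = (\<Sum>r=0..n. c r * cos (real r * \<theta>))"

text \<open>Zeros are counted without multiplicity. A cosine polynomial that is not identically zero
  has finitely many zeros in this interval, so taking the cardinality is harmless whenever
  \<open>f 0 \<noteq> 0\<close>.\<close>

definition zeros_in_period :: "(real \<Rightarrow> real) \<Rightarrow> real set" where
  "zeros_in_period f = {\<theta> \<in> {0..2 * pi}. f \<theta> = 0}"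

end

theory Submission
  imports Defs "HOL-Complex_Analysis.Complex_Analysis" "HOL-Number_Theory.Cong"
begin

text \<open>Let \<open>T\<close> be the product of \<open>2 cos x - 2 cos y\<close> over the sign changes \<open>y\<close> of \<open>f\<close> in \<open>(0, \<pi>)\<close>. Then
  \<open>f T\<close> has constant sign, so its \<open>L\<^sup>1\<close> norm is a combination of a few Fourier coefficients and is bounded
  in terms of the number \<open>k\<close> of zeros. Where the coefficients of \<open>f T\<close> are small, the coefficients of \<open>f\<close>
  satisfy an approximate linear recurrence; being bounded integers they satisfy an exact one, and modulo a
  large prime this gives one period \<open>Q\<close> for all such places. Hence \<open>f T sin (Q x)\<close> has either a large
  coefficient or a gap in every stretch of its spectrum, and an inequality of McGehee--Pigno--Smith type bounds
  the number of nonzero coefficients of \<open>f sin (Q x)\<close>. A sine sum with few terms, integer coefficients and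
  a huge slope at \<open>0\<close> has a scale at which it oscillates, which would give \<open>f\<close> more than \<open>k\<close> zeros; so
  \<open>f 0\<close> is at most triply exponential in \<open>k\<^sup>2\<close>. Bounded values of \<open>f 0\<close>, relevant only for coefficients
  in \<open>{-1, 0, 1}\<close>, need just one zero.\<close>

section \<open>An L1 lower bound\<close>

text \<open>Why the factor sin (Q x) is needed: a bounded integer sequence can satisfy a linear
  recurrence on a long stretch without vanishing there, for instance by being periodic, so a gap in
  the spectrum of \<open>f T\<close> need not be a gap in that of \<open>f\<close>. Multiplication
  by sin (Q x) replaces the coefficients by their differences at distance 2 Q. These satisfy the
  same recurrence, hence have period Q on the stretch, and a bounded sequence with periodic
  differences has zero differences. One Q must serve every stretch; therefore the recurrence is
  extracted from \<open>T\<close> and the coefficient bound alone, before any stretch is considered.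

  Origin of the three exponentials: the L1 inequality loses a factor sqrt J for J blocks, which
  forces J to be exponential in k^2; block j has 4^j frequencies, so the number N of sine terms is
  exponential in J; and a scale free of frequencies and of their differences is found only among
  about N^2 scales of fixed ratio, which makes the bound for \<open>f 0\<close> exponential in
  N^2.\<close>

lemma has_integral_circle_mean:
  fixes P :: "complex \<Rightarrow> complex"
  assumes "P holomorphic_on UNIV"
  shows "((\<lambda>x. P (cis x)) has_integral 2 * pi * P 0) {0..2*pi}"
proof -
  have "((\<lambda>z. P z / (z - 0)) has_contour_integral 2 * of_real pi * \<i> * P 0) (circlepath 0 1)"
    by (rule Cauchy_integral_circlepath_simple) (use assms holomorphic_on_subset in auto)
  then have "((\<lambda>t. P (cis t) / cis t * \<i> * cis t) has_integral 2 * of_real pi * \<i> * P 0) {0..2*pi}"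
    by (simp add: circlepath_def has_contour_integral_part_circlepath_iff)
  then have "((\<lambda>t. - \<i> * (P (cis t) / cis t * \<i> * cis t)) has_integral - \<i> * (2 * of_real pi * \<i> * P 0)) {0..2*pi}"
    by (rule has_integral_mult_right)
  then show ?thesis by (simp add: mult_ac)
qed

lemma cis_int_mult: "cis (of_int n * x) = cis x powi n"
  by (rule cis_power_int [symmetric])

text \<open>The integrand is z^n P(z) on the unit circle, an entire function vanishing at 0. With a
  damping factor as \<open>P\<close>, this is why a damped block has no coefficients below its
  lowest frequency.\<close>

lemma has_integral_positive_frequency:
  fixes P :: "complex \<Rightarrow> complex"
  assumes "P holomorphic_on UNIV" "n > 0"
  shows "((\<lambda>x. cis (of_int n * x) * P (cis x)) has_integral 0) {0..2*pi}"
proof -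
  have "((\<lambda>x. cis x ^ nat n * P (cis x)) has_integral 2 * pi * ((0::complex) ^ nat n * P 0)) {0..2*pi}"
    by (rule has_integral_circle_mean [where P = "\<lambda>z. z ^ nat n * P z"])
       (use assms in \<open>auto intro!: holomorphic_intros\<close>)
  then show ?thesis
    using assms(2) by (simp add: cis_int_mult power_int_def power_0_left)
qed

lemma integral_positive_frequency:
  fixes P :: "complex \<Rightarrow> complex"
  assumes "P holomorphic_on UNIV" "n > 0"
  shows "integral {0..2*pi} (\<lambda>x. cis (of_int n * x) * P (cis x)) = 0"
  using has_integral_positive_frequency[OF assms] by (rule integral_unique)

lemma integral_cis_int:
  "integral {0..2*pi} (\<lambda>x. cis (of_int n * x)) = (if n = 0 then 2 * pi else 0)"
proof -
  have pos: "integral {0..2*pi} (\<lambda>x. cis (of_int n * x)) = 0" if "n > 0" for n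
    using integral_positive_frequency[of "\<lambda>_. 1" n] that by simp
  consider "n = 0" | "n > 0" | "n < 0" by linarith
  then show ?thesis
  proof cases
    case 3
    have "integral {0..2*pi} (\<lambda>x. cis (of_int n * x)) = cnj (integral {0..2*pi} (\<lambda>x. cis (of_int (-n) * x)))"
      by (simp add: integral_cnj cis_cnj)
    then show ?thesis using 3 pos[of "-n"] by simp
  qed (use pos in \<open>auto simp: scaleR_conv_of_real\<close>)
qed

text \<open>The analytic completion of \<open>|f|\<^sup>2\<close>: keep the positive frequencies, doubled.\<close>

lemma analytic_completion:
  fixes u :: "int \<Rightarrow> complex" and w :: real
  assumes "finite B"
  defines "f \<equiv> \<lambda>x. of_real w * (\<Sum>n\<in>B. u n * cis (of_int n * x))"
  obtains H where "H holomorphic_on UNIV" "\<And>x. Re (H (cis x)) = (norm (f x))\<^sup>2"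
    "H 0 = of_real (w\<^sup>2 * (\<Sum>n\<in>B. (norm (u n))\<^sup>2))"
proof
  \<comment> \<open>A pair and its swap give conjugate products, so the square of the modulus is the
    diagonal plus twice the real part of the sum over \<open>D\<close>; there only positive powers
    of z occur.\<close>
  define D where "D = {(n, m) \<in> B \<times> B. m < n}"
  define H where "H = (\<lambda>z::complex. of_real (w\<^sup>2) * (of_real (\<Sum>n\<in>B. (norm (u n))\<^sup>2) +
     2 * (\<Sum>(n, m)\<in>D. u n * cnj (u m) * z ^ nat (n - m))))"
  have fin: "finite D"
    by (rule finite_subset[of _ "B \<times> B"]) (use assms in \<open>auto simp: D_def\<close>)
  show "H holomorphic_on UNIV"
    unfolding H_def case_prod_unfold by (auto intro!: holomorphic_intros)
  have "(\<Sum>(n, m)\<in>D. u n * cnj (u m) * 0 ^ nat (n - m)) = 0"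
    by (rule sum.neutral) (auto simp: D_def)
  then show "H 0 = of_real (w\<^sup>2 * (\<Sum>n\<in>B. (norm (u n))\<^sup>2))"
    by (simp add: H_def)
  fix x
  define v where "v = (\<lambda>n. u n * cis (of_int n * x))"
  have vv: "v n * cnj (v m) = u n * cnj (u m) * cis x ^ nat (n - m)" if "m < n" for n m
  proof -
    have "cis (of_int n * x) * cnj (cis (of_int m * x)) = cis (of_int (n - m) * x)"
      by (simp add: cis_cnj cis_mult algebra_simps)
    also have "\<dots> = cis x ^ nat (n - m)"
      using that unfolding cis_int_mult by (simp add: power_int_def)
    finally show ?thesis by (simp add: v_def mult_ac)
  qed
  have "(\<Sum>n\<in>B. v n) * cnj (\<Sum>n\<in>B. v n) = (\<Sum>(n, m)\<in>B\<times>B. v n * cnj (v m))"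
    by (simp add: sum_product sum.cartesian_product)
  also have "B \<times> B = (\<lambda>n. (n, n)) ` B \<union> (D \<union> prod.swap ` D)"
    by (auto simp: D_def image_iff)
  also have "(\<Sum>(n, m)\<in>(\<lambda>n. (n, n)) ` B \<union> (D \<union> prod.swap ` D). v n * cnj (v m)) =
      (\<Sum>(n, m)\<in>(\<lambda>n. (n, n)) ` B. v n * cnj (v m)) +
      ((\<Sum>(n, m)\<in>D. v n * cnj (v m)) + (\<Sum>(n, m)\<in>prod.swap ` D. v n * cnj (v m)))"
  proof -
    have "(\<Sum>p\<in>(\<lambda>n. (n, n)) ` B \<union> (D \<union> prod.swap ` D). g p) =
        (\<Sum>p\<in>(\<lambda>n. (n, n)) ` B. g p) + (\<Sum>p\<in>D \<union> prod.swap ` D. g p)" for g :: "int \<times> int \<Rightarrow> complex"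
      by (rule sum.union_disjoint) (use assms(1) fin in \<open>auto simp: D_def\<close>)
    moreover have "(\<Sum>p\<in>D \<union> prod.swap ` D. g p) = (\<Sum>p\<in>D. g p) + (\<Sum>p\<in>prod.swap ` D. g p)"
      for g :: "int \<times> int \<Rightarrow> complex"
      by (rule sum.union_disjoint) (use fin in \<open>auto simp: D_def\<close>)
    ultimately show ?thesis by simp
  qed
  also have "(\<Sum>(n, m)\<in>(\<lambda>n. (n, n)) ` B. v n * cnj (v m)) = of_real (\<Sum>n\<in>B. (norm (u n))\<^sup>2)"
  proof -
    have "v n * cnj (v n) = of_real ((norm (u n))\<^sup>2)" for n
      by (simp only: complex_norm_square[symmetric]) (simp add: v_def norm_mult)
    then show ?thesis by (subst sum.reindex) (auto simp: inj_on_def)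
  qed
  also have "(\<Sum>(n, m)\<in>prod.swap ` D. v n * cnj (v m)) = cnj (\<Sum>(n, m)\<in>D. v n * cnj (v m))"
    by (subst sum.reindex) (auto simp: case_prod_unfold mult_ac)
  finally have eq: "(\<Sum>n\<in>B. v n) * cnj (\<Sum>n\<in>B. v n) = of_real (\<Sum>n\<in>B. (norm (u n))\<^sup>2) +
      ((\<Sum>(n, m)\<in>D. v n * cnj (v m)) + cnj (\<Sum>(n, m)\<in>D. v n * cnj (v m)))" .
  have "(norm (\<Sum>n\<in>B. v n))\<^sup>2 = Re ((\<Sum>n\<in>B. v n) * cnj (\<Sum>n\<in>B. v n))"
    by (simp only: complex_norm_square[symmetric] Re_complex_of_real)
  also have "\<dots> = (\<Sum>n\<in>B. (norm (u n))\<^sup>2) + 2 * Re (\<Sum>(n, m)\<in>D. v n * cnj (v m))"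
    unfolding eq by simp
  also have "(\<Sum>(n, m)\<in>D. v n * cnj (v m)) = (\<Sum>(n, m)\<in>D. u n * cnj (u m) * cis x ^ nat (n - m))"
    by (rule sum.cong) (auto simp: D_def vv)
  finally show "Re (H (cis x)) = (norm (f x))\<^sup>2"
    unfolding f_def H_def v_def by (simp add: norm_mult power_mult_distrib algebra_simps)
qed

text \<open>The derivative of exp has modulus at most 1 on the closed left half-plane, which is
  convex, so the mean value inequality applies between 0 and -w.\<close>

lemma norm_exp_minus_one_le:
  fixes w :: complex
  assumes "Re w \<ge> 0"
  shows "norm (exp (-w) - 1) \<le> norm w"
proof -
  have "norm (exp (-w) - exp 0) \<le> 1 * norm (-w - 0)"
  proof (rule field_differentiable_bound)
    show "convex {z::complex. Re z \<le> 0}" by (rule convex_halfspace_Re_le)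
    show "(exp has_field_derivative exp z) (at z within {z. Re z \<le> 0})" for z :: complex
      by (auto intro!: derivative_eq_intros)
  qed (use assms in auto)
  then show ?thesis by simp
qed

text \<open>An L2 bound for the conjugate function from the mean value property alone: |H|^2 = 2 (Re
  H)^2 - Re (H^2). The integral of Re (H^2) is nonnegative because H(0) is real, and (Re H)^2 =
  |f|^4 is at most |f|^2.\<close>

lemma integral_completion_sq_le:
  fixes f :: "real \<Rightarrow> complex"
  assumes hol: "H holomorphic_on UNIV" and re: "\<And>x. Re (H (cis x)) = (norm (f x))\<^sup>2"
    and im: "Im (H 0) = 0" and cont: "continuous_on {0..2*pi} f" and f1: "\<And>x. norm (f x) \<le> 1"
  shows "integral {0..2*pi} (\<lambda>x. (norm (f x))\<^sup>2) = 2 * pi * Re (H 0)"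
    "integral {0..2*pi} (\<lambda>x. (norm (H (cis x)))\<^sup>2) \<le> 2 * (2 * pi * Re (H 0))"
proof -
  have contH: "continuous_on {0..2*pi} (\<lambda>x. H (cis x))"
    by (rule continuous_on_compose2[OF holomorphic_on_imp_continuous_on[OF hol]])
       (auto intro!: continuous_intros)
  note cont_intros = continuous_intros contH cont
  have "((\<lambda>x. Re (H (cis x))) has_integral Re (2 * pi * H 0)) {0..2*pi}"
    by (rule has_integral_Re) (rule has_integral_circle_mean[OF hol])
  then have i1: "((\<lambda>x. (norm (f x))\<^sup>2) has_integral 2 * pi * Re (H 0)) {0..2*pi}"
    by (simp add: re)
  then show e1: "integral {0..2*pi} (\<lambda>x. (norm (f x))\<^sup>2) = 2 * pi * Re (H 0)"
    by (rule integral_unique)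
  have "((\<lambda>x. Re ((H (cis x))\<^sup>2)) has_integral Re (2 * pi * (H 0)\<^sup>2)) {0..2*pi}"
    by (rule has_integral_Re) (rule has_integral_circle_mean, intro holomorphic_intros hol)
  moreover have "Re (2 * pi * (H 0)\<^sup>2) = 2 * pi * (Re (H 0))\<^sup>2"
    using im by (simp add: power2_eq_square)
  ultimately have i2: "integral {0..2*pi} (\<lambda>x. Re ((H (cis x))\<^sup>2)) = 2 * pi * (Re (H 0))\<^sup>2"
    by (metis integral_unique)
  have pw: "(norm (H (cis x)))\<^sup>2 = 2 * (norm (f x))^4 - Re ((H (cis x))\<^sup>2)" for x
  proof -
    have "(norm (f x))^4 = (Re (H (cis x)))\<^sup>2" by (simp add: re flip: power_mult)
    moreover have "(norm z)\<^sup>2 = 2 * (Re z)\<^sup>2 - Re (z\<^sup>2)" for z :: complex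
      unfolding cmod_power2 by (simp add: power2_eq_square)
    ultimately show ?thesis by simp
  qed
  have int: "(\<lambda>x. (norm (f x))^4) integrable_on {0..2*pi}" "(\<lambda>x. Re ((H (cis x))\<^sup>2)) integrable_on {0..2*pi}"
    by (rule integrable_continuous_interval; intro cont_intros)+
  have "integral {0..2*pi} (\<lambda>x. (norm (H (cis x)))\<^sup>2) =
     2 * integral {0..2*pi} (\<lambda>x. (norm (f x))^4) - integral {0..2*pi} (\<lambda>x. Re ((H (cis x))\<^sup>2))"
    unfolding pw by (subst integral_diff) (use int in auto)
  also have "\<dots> \<le> 2 * integral {0..2*pi} (\<lambda>x. (norm (f x))^4)"
    unfolding i2 by simp
  also have "integral {0..2*pi} (\<lambda>x. (norm (f x))^4) \<le> integral {0..2*pi} (\<lambda>x. (norm (f x))\<^sup>2)"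
    by (rule integral_le) (use int i1 f1 in \<open>auto intro!: power_decreasing\<close>)
  finally show "integral {0..2*pi} (\<lambda>x. (norm (H (cis x)))\<^sup>2) \<le> 2 * (2 * pi * Re (H 0))"
    by (simp add: e1)
qed

section \<open>Numerical estimates and the dual function for the L1 bound\<close>

lemma sum_inverse_power2_le: "(\<Sum>i\<in>{j<..<J}. 1 / 2 ^ i :: real) \<le> 1 / 2 ^ j"
proof -
  \<comment> \<open>The subtracted term is the tail of the geometric series; without it the
    induction would not close.\<close>
  have "(\<Sum>i\<in>{j<..<J}. 1 / 2 ^ i :: real) \<le> 1 / 2 ^ j - (if j < J then 1 / 2 ^ (J - 1) else 0)"
  proof (induction J)
    case (Suc J)
    consider "j < J" | "j = J" | "j > J" by linarith
    then show ?case
    proof cases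
      case 1
      then have "{j<..<Suc J} = insert J {j<..<J}" by auto
      moreover have "(1::real) / 2 ^ (J - 1) = 2 * (1 / 2 ^ J)"
        using 1 by (cases J) auto
      ultimately show ?thesis using 1 Suc by simp
    next
      case 2
      then have "{j<..<Suc J} = {}" by auto
      then show ?thesis using 2 by simp
    qed auto
  qed auto
  then show ?thesis by (smt (verit) zero_le_divide_1_iff zero_le_power)
qed

lemma sum_inverse_power4_le: "(\<Sum>i\<in>{l..<J}. 1 / 4 ^ i :: real) \<le> 4 / 3 / 4 ^ l"
proof -
  have "(\<Sum>i\<in>{l..<J}. 1 / 4 ^ i :: real) \<le> 4 / 3 / 4 ^ l - (if l \<le> J then 4 / 3 / 4 ^ J else 0)"
  proof (induction J)
    case (Suc J)
    consider "l \<le> J" | "l = Suc J" | "l > Suc J" by linarith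
    moreover have "4 / 3 / (4::real) ^ Suc J = 4 / 3 / 4 ^ J - 1 / 4 ^ J"
      by (simp add: field_simps)
    ultimately show ?case using Suc by cases (simp_all del: power_Suc)
  qed auto
  then show ?thesis by (smt (verit) divide_nonneg_nonneg zero_le_power)
qed

text \<open>One step in bounding the dual function: \<open>p\<close> is the old modulus,
  \<open>u\<close> that of the new block. If p >= 1, the damping removes at least u^2/8, and e u -
  u^2/8 <= 2 e^2 by completing the square. If p < 1, the left side is at most 2, whence the
  requirement b >= 2.\<close>

lemma exp_quarter_square_step:
  fixes p u e :: real
  assumes p: "0 \<le> p" "p \<le> b" and u: "0 \<le> u" "u \<le> 1" and e: "0 \<le> e" "e \<le> 1" and b: "2 \<le> b"
  shows "p * exp (- (u\<^sup>2 / 4)) + e * u \<le> b + 2 * e\<^sup>2"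
proof (cases "p \<ge> 1")
  case False
  have "p * exp (- (u\<^sup>2 / 4)) \<le> 1 * 1"
    by (rule mult_mono) (use False p in auto)
  moreover have "e * u \<le> 1 * 1" by (rule mult_mono) (use u e in auto)
  moreover have "e\<^sup>2 \<ge> 0" by simp
  ultimately show ?thesis using b by linarith
next
  case True
  define x where "x = u\<^sup>2 / 4"
  have u2: "u\<^sup>2 \<le> 1" using u by (simp add: power_le_one)
  have x: "0 \<le> x" "x \<le> 1 / 4" using u2 by (auto simp: x_def)
  have "exp (- x) \<le> 1 / (1 + x)"
    using exp_ge_add_one_self[of x] x by (simp add: exp_minus field_simps)
  also have "\<dots> \<le> 1 - x / 2"
    using x mult_left_mono[of x "1/4" x] by (simp add: field_simps)
  finally have "p * exp (- x) \<le> p * (1 - x / 2)" using p by (intro mult_left_mono) auto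
  also have "\<dots> \<le> p - x / 2" using mult_right_mono[OF True, of "x/2"] x by (simp add: algebra_simps)
  finally have "p * exp (- (u\<^sup>2 / 4)) \<le> p - u\<^sup>2 / 8" by (simp add: x_def)
  moreover have "e * u - u\<^sup>2 / 8 \<le> 2 * e\<^sup>2"
    using zero_le_power2[of "u - 4 * e"] by (simp add: power2_eq_square algebra_simps)
  ultimately show ?thesis using p by linarith
qed

text \<open>A weak form of the theorem of McGehee, Pigno and Smith. The test function \<open>F J\<close> is built block
  by block; the damping factors \<open>exp (- H / 4)\<close> keep it bounded and, having nonnegative spectrum only,
  cannot disturb the coefficients in later (lower) blocks.\<close>

lemma littlewood_blocks:
  fixes B :: "nat \<Rightarrow> int set" and c :: "int \<Rightarrow> complex" and S :: "int set"
  assumes S: "finite S" and BS: "\<And>j. j < J \<Longrightarrow> B j \<subseteq> S"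
    and card: "\<And>j. j < J \<Longrightarrow> card (B j) \<le> 4 ^ j"
    and desc: "\<And>i j m n. i < j \<Longrightarrow> j < J \<Longrightarrow> m \<in> B i \<Longrightarrow> n \<in> B j \<Longrightarrow> n < m"
    and rest: "\<And>n j m. n \<in> S - (\<Union>j<J. B j) \<Longrightarrow> j < J \<Longrightarrow> m \<in> B j \<Longrightarrow> n < m"
    and J: "J > 0"
  shows "2 * pi * (\<Sum>j<J. (\<Sum>n\<in>B j. norm (c n)) / 4 ^ j) \<le>
    8 * sqrt J * integral {0..2*pi} (\<lambda>x. norm (\<Sum>n\<in>S. c n * cis (of_int n * x)))"
proof -
  \<comment> \<open>Phases chosen so that pairing \<open>c n\<close> with \<open>u n\<close> gives
    the modulus of \<open>c n\<close>.\<close>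
  define u where "u = (\<lambda>n. sgn (c n))"
  define f where "f = (\<lambda>j x. of_real (1 / 4 ^ j) * (\<Sum>n\<in>B j. u n * cis (of_int n * x)))"
  have u1: "norm (u n) \<le> 1" for n by (simp add: u_def norm_sgn)
  have cu: "c n * cnj (u n) = of_real (norm (c n))" for n
  proof -
    have "c n * cnj (u n) = (c n * cnj (c n)) / of_real (norm (c n))"
      by (simp add: u_def sgn_div_norm scaleR_conv_of_real divide_inverse)
    also have "\<dots> = of_real (norm (c n))"
      by (simp only: complex_norm_square[symmetric]) (simp add: power2_eq_square)
    finally show ?thesis .
  qed
  have cardR: "real (card (B j)) \<le> 4 ^ j" if "j < J" for j
    using of_nat_mono[OF card[OF that], where 'a = real] by simp
  have finB: "finite (B j)" if "j < J" for j using BS[OF that] S finite_subset by blast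
  have "\<forall>j\<in>{..<J}. \<exists>H. H holomorphic_on UNIV \<and> (\<forall>x. Re (H (cis x)) = (norm (f j x))\<^sup>2) \<and>
     H 0 = of_real ((1 / 4 ^ j)\<^sup>2 * (\<Sum>n\<in>B j. (norm (u n))\<^sup>2))"
  proof
    fix j assume "j \<in> {..<J}"
    then have "finite (B j)" using finB by auto
    then obtain h where "h holomorphic_on UNIV"
      "\<And>x. Re (h (cis x)) = (norm (of_real (1 / 4 ^ j) * (\<Sum>n\<in>B j. u n * cis (of_int n * x))))\<^sup>2"
      "h 0 = of_real ((1 / 4 ^ j)\<^sup>2 * (\<Sum>n\<in>B j. (norm (u n))\<^sup>2))"
      by (rule analytic_completion[where u = u and w = "1 / 4 ^ j"]) blast
    then show "\<exists>H. H holomorphic_on UNIV \<and> (\<forall>x. Re (H (cis x)) = (norm (f j x))\<^sup>2) \<and>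
      H 0 = of_real ((1 / 4 ^ j)\<^sup>2 * (\<Sum>n\<in>B j. (norm (u n))\<^sup>2))"
      unfolding f_def by blast
  qed
  from bchoice[OF this] obtain H where H:
    "\<And>j. j < J \<Longrightarrow> H j holomorphic_on UNIV"
    "\<And>j x. j < J \<Longrightarrow> Re (H j (cis x)) = (norm (f j x))\<^sup>2"
    "\<And>j. j < J \<Longrightarrow> H j 0 = of_real ((1 / 4 ^ j)\<^sup>2 * (\<Sum>n\<in>B j. (norm (u n))\<^sup>2))"
    by auto
  have H0: "Re (H j 0) \<le> 1 / 4 ^ j" "Im (H j 0) = 0" if "j < J" for j
  proof -
    have "(\<Sum>n\<in>B j. (norm (u n))\<^sup>2) \<le> (\<Sum>n\<in>B j. 1)"
      by (rule sum_mono) (use u1 in \<open>auto simp: power_le_one\<close>)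
    also have "\<dots> \<le> 4 ^ j" using cardR[OF that] by simp
    finally have "(1 / 4 ^ j)\<^sup>2 * (\<Sum>n\<in>B j. (norm (u n))\<^sup>2) \<le> (1 / 4 ^ j)\<^sup>2 * (4::real) ^ j"
      by (intro mult_left_mono) auto
    also have "\<dots> = 1 / 4 ^ j" by (simp add: power2_eq_square)
    finally show "Re (H j 0) \<le> 1 / 4 ^ j" "Im (H j 0) = 0"
      using H(3)[OF that] by auto
  qed
  have f1: "norm (f j x) \<le> 1" if "j < J" for j x
  proof -
    have "norm (\<Sum>n\<in>B j. u n * cis (of_int n * x)) \<le> (\<Sum>n\<in>B j. 1)"
      by (rule sum_norm_le) (use u1 in \<open>auto simp: norm_mult\<close>)
    also have "\<dots> \<le> 4 ^ j" using cardR[OF that] by simp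
    finally have "(1 / 4 ^ j) * norm (\<Sum>n\<in>B j. u n * cis (of_int n * x)) \<le> (1 / 4 ^ j) * 4 ^ j"
      by (intro mult_left_mono) auto
    then show ?thesis unfolding f_def norm_mult by (simp add: norm_divide norm_power)
  qed
  have contf: "continuous_on {0..2*pi} (f j)" for j
    unfolding f_def by (intro continuous_intros)
  have contH: "continuous_on {0..2*pi} (\<lambda>x. H j (cis x))" if "j < J" for j
    by (rule continuous_on_compose2[OF holomorphic_on_imp_continuous_on[OF H(1)[OF that]]])
       (auto intro!: continuous_intros)
  have intf: "integral {0..2*pi} (\<lambda>x. (norm (f j x))\<^sup>2) \<le> 2 * pi / 4 ^ j"
    and intH: "integral {0..2*pi} (\<lambda>x. (norm (H j (cis x)))\<^sup>2) \<le> 2 * (2 * pi / 4 ^ j)" if "j < J" for j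
  proof -
    note * = integral_completion_sq_le[OF H(1)[OF that] H(2)[OF that] H0(2)[OF that] contf f1[OF that]]
    have "2 * pi * Re (H j 0) \<le> 2 * pi * (1 / 4 ^ j)" using H0(1)[OF that] by (intro mult_left_mono) auto
    with * show "integral {0..2*pi} (\<lambda>x. (norm (f j x))\<^sup>2) \<le> 2 * pi / 4 ^ j"
      "integral {0..2*pi} (\<lambda>x. (norm (H j (cis x)))\<^sup>2) \<le> 2 * (2 * pi / 4 ^ j)" by auto
  qed
  \<comment> \<open>Block \<open>j\<close> is damped by all later blocks below \<open>m\<close>;
    passing from \<open>m\<close> to \<open>Suc m\<close> thus multiplies the whole previous sum by
    the single factor exp (- H m / 4), and the new block enters undamped.\<close>
  define G where "G = (\<lambda>m j z. \<Sum>i\<in>{j<..<m}. H i z)"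
  define E where "E = (\<lambda>m j x. exp (- (G m j (cis x) / 4)))"
  \<comment> \<open>Each block raises the bound for the dual function by 2 e^2. With e^2 = 1/J all
    blocks together raise it from 2 to 4; this choice is the source of the factor sqrt J in the
    conclusion.\<close>
  define e where "e = 1 / sqrt J"
  have e: "0 \<le> e" "e \<le> 1" "e\<^sup>2 = 1 / J" "e > 0" using J by (auto simp: e_def power_divide)
  define F where "F = (\<lambda>m x. of_real e * (\<Sum>j<m. f j x * E m j x))"
  have contE: "continuous_on {0..2*pi} (E J j)" for j
    unfolding E_def G_def by (intro continuous_intros contH) auto
  have contF: "continuous_on {0..2*pi} (F J)"
    unfolding F_def by (intro continuous_intros contf contE)
  note cont = continuous_intros contf contE contF contH
  have Fbound: "norm (F m x) \<le> 2 + 2 * m * e\<^sup>2" if "m \<le> J" for m x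
    using that
  proof (induction m)
    case 0 then show ?case by (simp add: F_def)
  next
    case (Suc m)
    have "E (Suc m) j x = E m j x * exp (- (H m (cis x) / 4))" if "j < m" for j
    proof -
      have "{j<..<Suc m} = insert m {j<..<m}" using that by auto
      then show ?thesis by (simp add: E_def G_def exp_add[symmetric] add_divide_distrib algebra_simps)
    qed
    moreover have "{m<..<Suc m} = {}" by auto
    ultimately have "F (Suc m) x = F m x * exp (- (H m (cis x) / 4)) + of_real e * f m x"
      by (simp add: F_def E_def G_def sum_distrib_left sum_distrib_right algebra_simps)
    then have "norm (F (Suc m) x) \<le> norm (F m x) * exp (- ((norm (f m x))\<^sup>2 / 4)) + e * norm (f m x)"
      using e Suc.prems H(2)[of m x]
      by (auto simp: norm_mult intro!: norm_triangle_le)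
    also have "\<dots> \<le> (2 + 2 * m * e\<^sup>2) + 2 * e\<^sup>2"
      by (rule exp_quarter_square_step) (use Suc f1 e in auto)
    finally show ?case by (simp add: algebra_simps)
  qed
  have F4: "norm (F J x) \<le> 4" for x
    using Fbound[of J x] e(3) J by simp
  \<comment> \<open>\<open>T\<close> below is the Fourier integral of a damped block;
    \<open>D\<close> is the error made by ignoring its damping.\<close>
  define D where "D = (\<lambda>j n. integral {0..2*pi} (\<lambda>x. f j x * (E J j x - 1) * cis (of_int (- n) * x)))"
  define T where "T = (\<lambda>j n. integral {0..2*pi} (\<lambda>x. f j x * E J j x * cis (of_int (- n) * x)))"
  have Dbound: "norm (D j n) \<le> 2 * pi * (3 / 8) / 4 ^ j" if j: "j < J" for j n
  proof -
    have pair: "integral {0..2*pi} (\<lambda>x. norm (f j x) * norm (H i (cis x))) \<le> 2 * pi * (3 / 2) / 2 ^ j * (1 / 2 ^ i)"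
      if i: "i < J" for i
    proof -
      \<comment> \<open>The weight balances two squared L2 norms of orders 4^(-j) and 4^(-i), so
        that the inequality between the means gives 2^(-j) 2^(-i), which is summable over i >
        j.\<close>
      define y :: real where "y = 2 ^ j / 2 ^ i"
      have y: "y > 0" by (simp add: y_def)
      have "integral {0..2*pi} (\<lambda>x. norm (f j x) * norm (H i (cis x))) \<le>
         integral {0..2*pi} (\<lambda>x. y / 2 * (norm (f j x))\<^sup>2 + 1 / (2 * y) * (norm (H i (cis x)))\<^sup>2)"
      proof (rule integral_le)
        fix x
        show "norm (f j x) * norm (H i (cis x)) \<le> y / 2 * (norm (f j x))\<^sup>2 + 1 / (2 * y) * (norm (H i (cis x)))\<^sup>2"
          using zero_le_power2[of "y * norm (f j x) - norm (H i (cis x))"] y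
          by (simp add: field_simps power2_eq_square)
      qed (rule integrable_continuous_interval; intro cont i)+
      also have "\<dots> = y / 2 * integral {0..2*pi} (\<lambda>x. (norm (f j x))\<^sup>2) + 1 / (2 * y) * integral {0..2*pi} (\<lambda>x. (norm (H i (cis x)))\<^sup>2)"
        by (subst integral_add, (rule integrable_continuous_interval; intro cont i)+)
           (simp only: integral_mult_right)
      also have "\<dots> \<le> y / 2 * (2 * pi / 4 ^ j) + 1 / (2 * y) * (2 * (2 * pi / 4 ^ i))"
        by (intro add_mono mult_left_mono intf intH i j) (use y in auto)
      also have "\<dots> = 2 * pi * (3 / 2) / 2 ^ j * (1 / 2 ^ i)"
      proof -
        have "(4::real) ^ j = 2 ^ j * 2 ^ j" "(4::real) ^ i = 2 ^ i * 2 ^ i"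
          by (simp_all flip: power_mult_distrib)
        then show ?thesis by (simp add: y_def field_simps)
      qed
      finally show ?thesis .
    qed
    have "norm (D j n) \<le> integral {0..2*pi} (\<lambda>x. 1 / 4 * (\<Sum>i\<in>{j<..<J}. norm (f j x) * norm (H i (cis x))))"
      unfolding D_def
    proof (rule integral_norm_bound_integral)
      fix x
      have "Re (G J j (cis x) / 4) \<ge> 0"
        unfolding G_def by (auto intro!: sum_nonneg simp: H(2))
      then have "norm (E J j x - 1) \<le> norm (G J j (cis x) / 4)"
        unfolding E_def by (rule norm_exp_minus_one_le)
      also have "\<dots> \<le> 1 / 4 * (\<Sum>i\<in>{j<..<J}. norm (H i (cis x)))"
        unfolding G_def by (simp add: norm_divide sum_norm_le)
      finally have "norm (f j x) * norm (E J j x - 1) \<le> norm (f j x) * (1 / 4 * (\<Sum>i\<in>{j<..<J}. norm (H i (cis x))))"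
        by (rule mult_left_mono) simp
      then show "norm (f j x * (E J j x - 1) * cis (of_int (- n) * x)) \<le> 1 / 4 * (\<Sum>i\<in>{j<..<J}. norm (f j x) * norm (H i (cis x)))"
        by (simp add: norm_mult sum_distrib_left mult_ac)
    qed (rule integrable_continuous_interval; intro cont; auto)+
    also have "\<dots> = 1 / 4 * (\<Sum>i\<in>{j<..<J}. integral {0..2*pi} (\<lambda>x. norm (f j x) * norm (H i (cis x))))"
      by (subst integral_mult_right, subst integral_sum)
         (auto intro!: integrable_continuous_interval cont)
    also have "\<dots> \<le> 1 / 4 * (\<Sum>i\<in>{j<..<J}. 2 * pi * (3 / 2) / 2 ^ j * (1 / 2 ^ i))"
      by (intro mult_left_mono sum_mono pair) auto
    also have "\<dots> = 2 * pi * (3 / 8) / 2 ^ j * (\<Sum>i\<in>{j<..<J}. 1 / 2 ^ i)"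
      by (simp add: sum_distrib_left mult.assoc)
    also have "\<dots> \<le> 2 * pi * (3 / 8) / 2 ^ j * (1 / 2 ^ j)"
      by (intro mult_left_mono sum_inverse_power2_le) auto
    also have "\<dots> = 2 * pi * (3 / 8) / 4 ^ j" by (simp flip: power_mult_distrib)
    finally show ?thesis .
  qed
  \<comment> \<open>For n below block \<open>j\<close> all shifted frequencies m - n are positive,
    and the damping factor is an entire function of e^(ix): every integral vanishes.\<close>
  have T0: "T j n = 0" if j: "j < J" and n: "\<And>m. m \<in> B j \<Longrightarrow> n < m" for j n
  proof -
    have "T j n = integral {0..2*pi} (\<lambda>x. \<Sum>m\<in>B j. (1 / 4 ^ j) * u m * (cis (of_int (m - n) * x) * E J j x))"
      unfolding T_def f_def
      by (rule integral_cong) (simp add: sum_distrib_left sum_distrib_right cis_mult algebra_simps)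
    also have "\<dots> = (\<Sum>m\<in>B j. (1 / 4 ^ j) * u m * integral {0..2*pi} (\<lambda>x. cis (of_int (m - n) * x) * E J j x))"
      by (subst integral_sum) (auto intro!: finB j integrable_continuous_interval cont)
    also have "\<dots> = 0"
    proof (rule sum.neutral, rule ballI)
      fix m assume "m \<in> B j"
      then have "integral {0..2*pi} (\<lambda>x. cis (of_int (m - n) * x) * exp (- (G J j (cis x) / 4))) = 0"
        using n by (intro integral_positive_frequency[where P = "\<lambda>z. exp (- (G J j z / 4))"])
          (auto simp: G_def intro!: holomorphic_intros H)
      then show "1 / 4 ^ j * u m * integral {0..2*pi} (\<lambda>x. cis (of_int (m - n) * x) * E J j x) = 0"
        unfolding E_def by simp
    qed
    finally show ?thesis .
  qed
  have T1: "T j n = (if n \<in> B j then 2 * pi * (1 / 4 ^ j) * u n else 0) + D j n" if j: "j < J" for j n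
  proof -
    have "T j n = integral {0..2*pi} (\<lambda>x. f j x * cis (of_int (- n) * x) + f j x * (E J j x - 1) * cis (of_int (- n) * x))"
      unfolding T_def by (rule integral_cong) (simp add: algebra_simps)
    also have "\<dots> = integral {0..2*pi} (\<lambda>x. f j x * cis (of_int (- n) * x)) + D j n"
      unfolding D_def by (rule integral_add) (auto intro!: integrable_continuous_interval cont)
    also have "integral {0..2*pi} (\<lambda>x. f j x * cis (of_int (- n) * x)) =
       integral {0..2*pi} (\<lambda>x. \<Sum>m\<in>B j. (1 / 4 ^ j) * u m * cis (of_int (m - n) * x))"
      unfolding f_def
      by (rule integral_cong) (simp add: sum_distrib_left sum_distrib_right cis_mult algebra_simps)
    also have "\<dots> = (\<Sum>m\<in>B j. (1 / 4 ^ j) * u m * integral {0..2*pi} (\<lambda>x. cis (of_int (m - n) * x)))"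
      by (subst integral_sum) (auto intro!: finB j integrable_continuous_interval cont)
    also have "\<dots> = (\<Sum>m\<in>B j. if m = n then 2 * pi * (1 / 4 ^ j) * u n else 0)"
      unfolding integral_cis_int by (rule sum.cong) auto
    also have "\<dots> = (if n \<in> B j then 2 * pi * (1 / 4 ^ j) * u n else 0)"
      using finB[OF j] by simp
    finally show ?thesis .
  qed
  define Fh where "Fh = (\<lambda>n. integral {0..2*pi} (\<lambda>x. F J x * cis (of_int (- n) * x)))"
  have FhT: "Fh n = of_real e * (\<Sum>j<J. T j n)" for n
  proof -
    have "Fh n = integral {0..2*pi} (\<lambda>x. of_real e * (\<Sum>j<J. f j x * E J j x * cis (of_int (- n) * x)))"
      unfolding Fh_def F_def by (rule integral_cong) (simp add: sum_distrib_left sum_distrib_right mult_ac)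
    also have "\<dots> = of_real e * (\<Sum>j<J. T j n)"
      unfolding T_def
      by (subst integral_mult_right, subst integral_sum) (auto intro!: integrable_continuous_interval cont)
    finally show ?thesis .
  qed
  have Fh_rest: "Fh n = 0" if "n \<in> S - (\<Union>j<J. B j)" for n
    unfolding FhT using rest[OF that] T0 by simp
  have Fh_block: "Re (c n * cnj (Fh n)) \<ge> 2 * pi * e / 2 * (norm (c n) / 4 ^ l)" if l: "l < J" and n: "n \<in> B l" for l n
  proof -
    have early: "T j n = 0" if "j < l" for j
      by (rule T0) (use that l desc[OF that l _ n] in auto)
    have late: "n \<notin> B j" if "l < j" "j < J" for j
      using desc[OF that n] by blast
    have "(\<Sum>j<J. T j n) = (\<Sum>j\<in>{l..<J}. T j n)"
      by (rule sum.mono_neutral_right) (use early in auto)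
    also have "\<dots> = (\<Sum>j\<in>{l..<J}. (if j = l then 2 * pi * (1 / 4 ^ l) * u n else 0) + D j n)"
      by (rule sum.cong) (use late n in \<open>auto simp: T1\<close>)
    also have "\<dots> = 2 * pi * (1 / 4 ^ l) * u n + (\<Sum>j\<in>{l..<J}. D j n)"
      using l by (simp add: sum.distrib)
    finally have s: "(\<Sum>j<J. T j n) = 2 * pi * (1 / 4 ^ l) * u n + (\<Sum>j\<in>{l..<J}. D j n)" .
    \<comment> \<open>The errors of block \<open>l\<close> and all later ones add up to at most 3/8
      * 4/3 = 1/2 of the weight of the main term, so half of it survives.\<close>
    have "norm (\<Sum>j\<in>{l..<J}. D j n) \<le> (\<Sum>j\<in>{l..<J}. 2 * pi * (3 / 8) * (1 / 4 ^ j))"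
      by (rule sum_norm_le) (use Dbound in auto)
    also have "\<dots> = 2 * pi * (3 / 8) * (\<Sum>j\<in>{l..<J}. 1 / 4 ^ j)"
      by (simp add: sum_distrib_left)
    also have "\<dots> \<le> 2 * pi * (3 / 8) * (4 / 3 / 4 ^ l)"
      by (intro mult_left_mono sum_inverse_power4_le) auto
    finally have err: "norm (\<Sum>j\<in>{l..<J}. D j n) \<le> 2 * pi * (1 / 2) / 4 ^ l" by simp
    define d where "d = (\<Sum>j\<in>{l..<J}. D j n)"
    have "c n * cnj (Fh n) = of_real e * (2 * pi * (1 / 4 ^ l) * (c n * cnj (u n)) + c n * cnj d)"
      unfolding FhT s d_def[symmetric] by (simp add: algebra_simps)
    also have "Re \<dots> = e * (2 * pi * (1 / 4 ^ l) * norm (c n) + Re (c n * cnj d))"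
      unfolding cu by simp
    finally have r: "Re (c n * cnj (Fh n)) = e * (2 * pi * (1 / 4 ^ l) * norm (c n) + Re (c n * cnj d))" .
    have "\<bar>Re (c n * cnj d)\<bar> \<le> norm (c n) * norm d"
      using abs_Re_le_cmod[of "c n * cnj d"] by (simp add: norm_mult)
    also have "\<dots> \<le> norm (c n) * (2 * pi * (1 / 2) / 4 ^ l)"
      using err unfolding d_def by (intro mult_left_mono) auto
    also have "\<dots> = pi * (norm (c n) / 4 ^ l)" by simp
    finally have "pi * (norm (c n) / 4 ^ l) \<le> 2 * (pi * (norm (c n) / 4 ^ l)) + Re (c n * cnj d)"
      by linarith
    from mult_left_mono[OF this e(1)] show ?thesis
      unfolding r by (simp add: mult_ac)
  qed
  define g where "g = (\<lambda>x. \<Sum>n\<in>S. c n * cis (of_int n * x))"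
  have contg: "continuous_on {0..2*pi} g" unfolding g_def by (intro continuous_intros)
  \<comment> \<open>Duality: the pairing of \<open>g\<close> with \<open>F J\<close> is bounded
    above by 4 times the L1 norm, and its real part is bounded below block by block.\<close>
  have "integral {0..2*pi} (\<lambda>x. g x * cnj (F J x)) =
      integral {0..2*pi} (\<lambda>x. \<Sum>n\<in>S. c n * cnj (F J x * cis (of_int (-n) * x)))"
    unfolding g_def by (rule integral_cong) (simp add: sum_distrib_left sum_distrib_right cis_cnj mult_ac)
  also have "\<dots> = (\<Sum>n\<in>S. c n * cnj (Fh n))"
    unfolding Fh_def integral_cnj
    by (subst integral_sum) (auto intro!: S integrable_continuous_interval cont)
  finally have dual: "integral {0..2*pi} (\<lambda>x. g x * cnj (F J x)) = (\<Sum>n\<in>S. c n * cnj (Fh n))" .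
  have disj: "B i \<inter> B j = {}" if "i < J" "j < J" "i \<noteq> j" for i j
    using desc[of i j] desc[of j i] that by (metis disjoint_iff linorder_neqE_nat order_less_irrefl)
  have "(\<Sum>j<J. \<Sum>n\<in>B j. 2 * pi * e / 2 * (norm (c n) / 4 ^ j)) \<le> (\<Sum>j<J. \<Sum>n\<in>B j. Re (c n * cnj (Fh n)))"
    by (intro sum_mono Fh_block) auto
  also have "\<dots> = (\<Sum>n\<in>(\<Union>j<J. B j). Re (c n * cnj (Fh n)))"
    by (rule sum.UNION_disjoint[symmetric]) (use finB disj in auto)
  also have "\<dots> = (\<Sum>n\<in>S. Re (c n * cnj (Fh n)))"
    by (rule sum.mono_neutral_left) (use S BS Fh_rest in auto)
  also have "\<dots> = Re (integral {0..2*pi} (\<lambda>x. g x * cnj (F J x)))"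
    unfolding dual by simp
  also have "\<dots> \<le> norm (integral {0..2*pi} (\<lambda>x. g x * cnj (F J x)))" by (rule complex_Re_le_cmod)
  also have "\<dots> \<le> integral {0..2*pi} (\<lambda>x. 4 * norm (g x))"
  proof (rule integral_norm_bound_integral)
    show "norm (g x * cnj (F J x)) \<le> 4 * norm (g x)" for x
      using mult_left_mono[OF F4[of x], of "norm (g x)"] by (simp add: norm_mult mult_ac)
  qed (rule integrable_continuous_interval; intro cont contg)+
  also have "\<dots> = 4 * integral {0..2*pi} (\<lambda>x. norm (g x))" by simp
  also have "(\<Sum>j<J. \<Sum>n\<in>B j. 2 * pi * e / 2 * (norm (c n) / 4 ^ j)) =
     e / 2 * (2 * pi * (\<Sum>j<J. (\<Sum>n\<in>B j. norm (c n)) / 4 ^ j))"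
    by (simp add: sum_distrib_left sum_divide_distrib mult_ac)
  finally have "2 * pi * (\<Sum>j<J. (\<Sum>n\<in>B j. norm (c n)) / 4 ^ j) \<le> 8 * (1 / e) * integral {0..2*pi} (\<lambda>x. norm (g x))"
    using e(4) by (simp add: field_simps)
  then show ?thesis by (simp add: e_def g_def)
qed

section \<open>Integer sequences with small recurrence\<close>

text \<open>Dirichlet approximation of \<open>t\<close> makes the left-hand side of the recurrence an integer of absolute
  value below \<open>1\<close>.\<close>

lemma approximate_recurrence_exact:
  fixes t :: "nat \<Rightarrow> real" and d A :: nat
  assumes td: "t d = 1" and l: "l > (1::int)"
  defines "H \<equiv> 2 * d * A + 1"
  obtains s :: "nat \<Rightarrow> int" where "\<exists>i\<le>d. \<not> l dvd s i"
    "\<And>w :: nat \<Rightarrow> int. (\<And>i. i \<le> d \<Longrightarrow> \<bar>w i\<bar> \<le> int A) \<Longrightarrow>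
       \<bar>\<Sum>i\<le>d. t i * of_int (w i)\<bar> < 1 / (2 * real H ^ d) \<Longrightarrow> (\<Sum>i\<le>d. s i * w i) = 0"
proof -
  define good where "good = (\<lambda>s :: nat \<Rightarrow> int. \<forall>w :: nat \<Rightarrow> int. (\<forall>i\<le>d. \<bar>w i\<bar> \<le> int A) \<longrightarrow>
       \<bar>\<Sum>i\<le>d. t i * of_int (w i)\<bar> < 1 / (2 * real H ^ d) \<longrightarrow> (\<Sum>i\<le>d. s i * w i) = 0)"
  have Hpos: "H > 0" by (simp add: H_def)
  obtain q p where q: "0 < q" "q \<le> int (H ^ d)"
    and p: "\<And>i. i < d \<Longrightarrow> \<bar>of_int q * t i - of_int (p i)\<bar> < 1 / H"
    using Dirichlet_approx_simult[OF Hpos, of d t] by blast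
  \<comment> \<open>The common denominator \<open>q\<close> is placed at index \<open>d\<close>:
    since t d = 1, the approximation is exact there.\<close>
  define s where "s = (\<lambda>i. if i < d then p i else q)"
  have good_s: "good s"
    unfolding good_def
  proof (intro allI impI)
    fix w :: "nat \<Rightarrow> int"
    assume w: "\<forall>i\<le>d. \<bar>w i\<bar> \<le> int A" and b: "\<bar>\<Sum>i\<le>d. t i * of_int (w i)\<bar> < 1 / (2 * real H ^ d)"
    have "\<bar>\<Sum>i<d. (of_int (p i) - of_int q * t i) * of_int (w i)\<bar> \<le> (\<Sum>i<d. 1 / H * A)"
    proof (rule order_trans[OF sum_abs], rule sum_mono)
      fix i assume i: "i \<in> {..<d}"
      then have "\<bar>of_int (w i)\<bar> \<le> real A" using w by (metis lessThan_iff less_imp_le of_int_abs of_int_le_iff of_int_of_nat_eq)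
      moreover have "\<bar>of_int (p i) - of_int q * t i\<bar> \<le> 1 / H" using p[of i] i by (simp add: abs_minus_commute)
      ultimately show "\<bar>(of_int (p i) - of_int q * t i) * of_int (w i)\<bar> \<le> 1 / H * A"
        unfolding abs_mult by (intro mult_mono) auto
    qed
    also have "\<dots> = d * A / H" by simp
    \<comment> \<open>This is why \<open>H\<close> exceeds 2 d A. The remaining error is below 1/2
      as well, by q <= H^d and the threshold 1 / (2 H^d).\<close>
    also have "\<dots> < 1 / 2"
    proof -
      have "2 * (real d * real A) < real H" by (simp add: H_def)
      then show ?thesis using Hpos by (simp add: divide_less_eq)
    qed
    finally have e1: "\<bar>\<Sum>i<d. (of_int (p i) - of_int q * t i) * of_int (w i)\<bar> < 1 / 2" .
    have "\<bar>of_int q * (\<Sum>i\<le>d. t i * of_int (w i))\<bar> = of_int q * \<bar>\<Sum>i\<le>d. t i * of_int (w i)\<bar>"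
      using q by (simp add: abs_mult)
    also have "\<dots> < of_int q * (1 / (2 * real H ^ d))"
      using b q by (intro mult_strict_left_mono) auto
    also have "\<dots> \<le> real H ^ d * (1 / (2 * real H ^ d))"
    proof (rule mult_right_mono)
      have "real_of_int q \<le> of_int (int (H ^ d))" using q(2) by (simp only: of_int_le_iff)
      then show "real_of_int q \<le> real H ^ d" by simp
    qed simp
    also have "\<dots> = 1 / 2" using Hpos by simp
    finally have e2: "\<bar>of_int q * (\<Sum>i\<le>d. t i * of_int (w i))\<bar> < 1 / 2" .
    have "of_int (\<Sum>i\<le>d. s i * w i) = (\<Sum>i<d. (of_int (p i) - of_int q * t i) * of_int (w i)) +
       of_int q * (\<Sum>i\<le>d. t i * of_int (w i))"
      by (simp add: lessThan_Suc_atMost[symmetric] s_def td sum.distrib sum_distrib_left algebra_simps sum_subtractf)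
    with e1 e2 have "\<bar>real_of_int (\<Sum>i\<le>d. s i * w i)\<bar> < 1" by linarith
    then show "(\<Sum>i\<le>d. s i * w i) = 0" by linarith
  qed
  \<comment> \<open>Dividing a good relation by a common factor \<open>l\<close> leaves it good and
    shrinks its entry at \<open>d\<close>; a relation with the least positive entry there therefore
    has some entry not divisible by \<open>l\<close>.\<close>
  define m where "m = (LEAST m::nat. m > 0 \<and> (\<exists>s. good s \<and> s d = int m))"
  have ex: "\<exists>m::nat. m > 0 \<and> (\<exists>s. good s \<and> s d = int m)"
    using good_s q by (intro exI[of _ "nat q"]) (auto simp: s_def intro!: exI[of _ s])
  then obtain r where r: "good r" "r d = int m" "m > 0"
    unfolding m_def using LeastI_ex[OF ex] by blast
  have "\<exists>i\<le>d. \<not> l dvd r i"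
  proof (rule ccontr)
    assume "\<not> ?thesis"
    then have dv: "l dvd r i" if "i \<le> d" for i using that by auto
    define r' where "r' = (\<lambda>i. r i div l)"
    have rr': "r i = l * r' i" if "i \<le> d" for i using dv[OF that] by (simp add: r'_def)
    have "good r'"
      unfolding good_def
    proof (intro allI impI)
      fix w :: "nat \<Rightarrow> int"
      assume "\<forall>i\<le>d. \<bar>w i\<bar> \<le> int A" "\<bar>\<Sum>i\<le>d. t i * of_int (w i)\<bar> < 1 / (2 * real H ^ d)"
      then have "(\<Sum>i\<le>d. r i * w i) = 0" using r(1) unfolding good_def by blast
      also have "(\<Sum>i\<le>d. r i * w i) = l * (\<Sum>i\<le>d. r' i * w i)"
        by (simp add: sum_distrib_left rr' mult_ac)
      finally show "(\<Sum>i\<le>d. r' i * w i) = 0" using l by simp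
    qed
    have "int m = l * r' d" using rr'[of d] r by simp
    moreover from this have pos: "r' d > 0"
      using l r(3) zero_less_mult_pos[of l "r' d"] by simp
    ultimately have "r' d > 0" "r' d < int m"
      using l mult_strict_right_mono[OF l pos] by auto
    with \<open>good r'\<close>
    have "nat (r' d) > 0 \<and> (\<exists>s. good s \<and> s d = int (nat (r' d)))" by auto
    then have "m \<le> nat (r' d)" unfolding m_def by (rule Least_le)
    then show False using \<open>r' d < int m\<close> \<open>r' d > 0\<close> by linarith
  qed
  then show ?thesis using that r(1) unfolding good_def by blast
qed

text \<open>Pigeonhole modulo a prime so large that residues determine the values.\<close>

lemma recurrence_common_period:
  fixes s :: "nat \<Rightarrow> int" and l :: nat
  assumes l: "prime l" "l > 2 * A" and nd: "\<exists>i\<le>d. \<not> int l dvd s i"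
  obtains p q where "p < q" "q \<le> l ^ d"
    "\<And>a r. (\<And>u. \<bar>a u\<bar> \<le> int A) \<Longrightarrow> (\<And>u. r - int q \<le> u \<Longrightarrow> u \<le> r \<Longrightarrow> (\<Sum>i\<le>d. s i * a (u - int i)) = 0) \<Longrightarrow>
        a (r - int p) = a (r - int q)"
proof -
  \<comment> \<open>Modulo \<open>l\<close> the coefficients after index \<open>e\<close> vanish and
    \<open>s e\<close> is invertible, so the recurrence determines a (u - e) from a u, ..., a (u - e
    + 1).\<close>
  define e where "e = Max {i. i \<le> d \<and> \<not> int l dvd s i}"
  have fin: "finite {i. i \<le> d \<and> \<not> int l dvd s i}" by auto
  have ed: "e \<le> d" "\<not> int l dvd s e"
    using Max_in[OF fin] nd unfolding e_def by auto
  have hi: "int l dvd s i" if "i \<le> d" "i > e" for i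
  proof (rule ccontr)
    assume "\<not> int l dvd s i"
    then have "i \<le> e" unfolding e_def using that by (intro Max_ge) auto
    then show False using that by simp
  qed
  have "coprime (s e) (int l)"
    using prime_imp_coprime[of "int l" "s e"] ed(2) l(1) by (simp add: coprime_commute)
  then obtain v where v: "[s e * v = 1] (mod int l)"
    using coprime_iff_invertible_int by blast
  define rec where "rec = (\<lambda>(a :: int \<Rightarrow> int) r p. \<forall>u. r - int p \<le> u \<longrightarrow> u \<le> r \<longrightarrow> (\<Sum>i\<le>d. s i * a (u - int i)) = 0)"
  \<comment> \<open>The weights \<rho> depend neither on the sequence \<open>a\<close> nor on the
    position \<open>r\<close>. This uniformity is what makes the resulting period common to all
    stretches and all sequences.\<close>
  define comb where "comb = (\<lambda>p (\<rho> :: nat \<Rightarrow> int). \<forall>a r. rec a r p \<longrightarrow> [a (r - int p) = (\<Sum>i<e. \<rho> i * a (r - int i))] (mod int l))"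
  have step: "[a (u - int e) = (\<Sum>i<e. (- v * s i) * a (u - int i))] (mod int l)"
    if "(\<Sum>i\<le>d. s i * a (u - int i)) = 0" for a u
  proof -
    have "{..d} = insert e ({..<e} \<union> {e<..d})" using ed by auto
    then have "(\<Sum>i\<le>d. s i * a (u - int i)) = s e * a (u - int e) + ((\<Sum>i<e. s i * a (u - int i)) + (\<Sum>i\<in>{e<..d}. s i * a (u - int i)))"
      by (simp, subst sum.union_disjoint) auto
    moreover have "int l dvd (\<Sum>i\<in>{e<..d}. s i * a (u - int i))"
      by (rule dvd_sum) (use hi in auto)
    ultimately have "int l dvd s e * a (u - int e) + (\<Sum>i<e. s i * a (u - int i))"
      using that dvd_add_left_iff[of "int l" "\<Sum>i\<in>{e<..d}. s i * a (u - int i)" "s e * a (u - int e) + (\<Sum>i<e. s i * a (u - int i))"]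
      by (simp add: add.assoc)
    then have "int l dvd v * (s e * a (u - int e) + (\<Sum>i<e. s i * a (u - int i)))" by simp
    moreover have "int l dvd (s e * v - 1) * a (u - int e)"
      using v by (simp add: cong_iff_dvd_diff)
    ultimately have "int l dvd v * (s e * a (u - int e) + (\<Sum>i<e. s i * a (u - int i))) - (s e * v - 1) * a (u - int e)"
      by (rule dvd_diff)
    moreover have "v * (s e * a (u - int e) + (\<Sum>i<e. s i * a (u - int i))) - (s e * v - 1) * a (u - int e) =
      a (u - int e) - (\<Sum>i<e. (- v * s i) * a (u - int i))"
      by (simp add: algebra_simps sum_distrib_left sum_negf)
    ultimately show ?thesis by (simp add: cong_iff_dvd_diff)
  qed
  have "\<exists>\<rho>. comb p \<rho>" for p
  proof (induction p rule: less_induct)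
    case (less p)
    show ?case
    proof (cases "p < e")
      case True
      have "comb p (\<lambda>i. if i = p then 1 else 0)"
        unfolding comb_def
      proof (intro allI impI)
        fix a :: "int \<Rightarrow> int" and r
        have "(\<Sum>i<e. (if i = p then 1 else 0) * a (r - int i)) = (\<Sum>i<e. if i = p then a (r - int i) else 0)"
          by (rule sum.cong) auto
        also have "\<dots> = a (r - int p)" using True by simp
        finally show "[a (r - int p) = (\<Sum>i<e. (if i = p then 1 else 0) * a (r - int i))] (mod int l)"
          by simp
      qed
      then show ?thesis by blast
    next
      case False
      from less.IH have "\<forall>k\<in>{..<p}. \<exists>\<rho>. comb k \<rho>" by auto
      then obtain \<rho> where \<rho>: "\<And>k. k < p \<Longrightarrow> comb k (\<rho> k)" by (metis lessThan_iff)
      have "comb p (\<lambda>j. \<Sum>i<e. (- v * s i) * \<rho> (p - e + i) j)"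
        unfolding comb_def
      proof (intro allI impI)
        fix a r assume rec: "rec a r p"
        have "(\<Sum>i\<le>d. s i * a ((r - int (p - e)) - int i)) = 0"
          using rec unfolding rec_def by auto
        from step[OF this] have "[a (r - int p) = (\<Sum>i<e. (- v * s i) * a (r - int (p - e) - int i))] (mod int l)"
          using False by (simp add: of_nat_diff)
        also have "[(\<Sum>i<e. (- v * s i) * a (r - int (p - e) - int i)) =
           (\<Sum>i<e. (- v * s i) * (\<Sum>j<e. \<rho> (p - e + i) j * a (r - int j)))] (mod int l)"
        proof (intro cong_sum cong_mult cong_refl)
          fix i assume "i \<in> {..<e}"
          then have k: "p - e + i < p" using False by auto
          have "rec a r (p - e + i)" using rec k unfolding rec_def by auto
          with \<rho>[OF k] show "[a (r - int (p - e) - int i) = (\<Sum>j<e. \<rho> (p - e + i) j * a (r - int j))] (mod int l)"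
            unfolding comb_def by (auto simp: algebra_simps)
        qed
        also have "(\<Sum>i<e. (- v * s i) * (\<Sum>j<e. \<rho> (p - e + i) j * a (r - int j))) =
          (\<Sum>j<e. (\<Sum>i<e. (- v * s i) * \<rho> (p - e + i) j) * a (r - int j))"
          unfolding sum_distrib_left sum_distrib_right by (subst sum.swap) (simp add: mult_ac)
        finally show "[a (r - int p) = (\<Sum>j<e. (\<Sum>i<e. (- v * s i) * \<rho> (p - e + i) j) * a (r - int j))] (mod int l)" .
      qed
      then show ?thesis by blast
    qed
  qed
  then obtain \<rho> where \<rho>: "\<And>p. comb p (\<rho> p)" by metis
  define \<sigma> where "\<sigma> = (\<lambda>p. restrict (\<lambda>i. \<rho> p i mod int l) {..<e})"
  have lpos: "l > 0" using l(1) prime_gt_0_nat by blast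
  have "\<not> inj_on \<sigma> {..l ^ e}"
  proof
    assume inj: "inj_on \<sigma> {..l ^ e}"
    have "\<sigma> ` {..l ^ e} \<subseteq> (\<Pi>\<^sub>E i\<in>{..<e}. {0..<int l})"
      using lpos by (intro image_subsetI) (simp add: \<sigma>_def restrict_PiE_iff)
    then have "card (\<sigma> ` {..l ^ e}) \<le> card (\<Pi>\<^sub>E i\<in>{..<e}. {0..<int l})"
      by (intro card_mono finite_PiE) auto
    also have "\<dots> = l ^ e" by (simp add: card_PiE)
    finally show False using card_image[OF inj] by simp
  qed
  then obtain p q where pq: "p < q" "q \<le> l ^ e" "\<sigma> p = \<sigma> q"
  proof -
    obtain x y where "x \<le> l ^ e" "y \<le> l ^ e" "x \<noteq> y" "\<sigma> x = \<sigma> y"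
      using \<open>\<not> inj_on \<sigma> {..l ^ e}\<close> by (auto simp: inj_on_def)
    then show ?thesis using that[of x y] that[of y x] by (cases "x < y") auto
  qed
  show ?thesis
  proof (rule that[OF pq(1)])
    show "q \<le> l ^ d" using pq(2) power_increasing[OF ed(1), of l] lpos by linarith
    fix a r
    assume ab: "\<And>u. \<bar>a u\<bar> \<le> int A"
      and rq: "\<And>u. r - int q \<le> u \<Longrightarrow> u \<le> r \<Longrightarrow> (\<Sum>i\<le>d. s i * a (u - int i)) = 0"
    have "rec a r q" "rec a r p" unfolding rec_def using rq pq(1) by auto
    then have cp: "[a (r - int p) = (\<Sum>i<e. \<rho> p i * a (r - int i))] (mod int l)"
      and cq: "[a (r - int q) = (\<Sum>i<e. \<rho> q i * a (r - int i))] (mod int l)"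
      using \<rho> unfolding comb_def by blast+
    have "[(\<Sum>i<e. \<rho> p i * a (r - int i)) = (\<Sum>i<e. \<rho> q i * a (r - int i))] (mod int l)"
    proof (intro cong_sum cong_mult cong_refl)
      fix i assume "i \<in> {..<e}"
      then show "[\<rho> p i = \<rho> q i] (mod int l)"
        using fun_cong[OF pq(3), of i] by (simp add: \<sigma>_def cong_def)
    qed
    then have "[a (r - int p) = a (r - int q)] (mod int l)"
      using cp cq by (meson cong_sym cong_trans)
    then have "int l dvd a (r - int p) - a (r - int q)" by (simp add: cong_iff_dvd_diff)
    moreover have "\<bar>a (r - int p) - a (r - int q)\<bar> < int l"
      using ab[of "r - int p"] ab[of "r - int q"] l(2) by linarith
    ultimately have "a (r - int p) - a (r - int q) = 0"
      using dvd_imp_le_int[of "a (r - int p) - a (r - int q)" "int l"] by linarith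
    then show "a (r - int p) = a (r - int q)" by simp
  qed
qed

text \<open>The recurrence and the indices p < q depend only on \<open>t\<close>, \<open>m\<close>
  and \<open>l\<close>, so Q = q - p can serve both as the period and as the differencing distance
  without circularity. On the stretch the differences D have period Q. Summing them at 4 m + 1
  points spaced 2 Q apart telescopes to one difference of two values of \<open>a\<close>, of modulus
  at most 4 m, but also equals (4 m + 1) D u; the integer D u must be 0.\<close>

lemma difference_vanishes_on_gaps:
  fixes t :: "nat \<Rightarrow> real" and d m l :: nat
  assumes td: "t d = 1" and l: "prime l" "l > 8 * m"
  defines "W \<equiv> l ^ d + 8 * m * l ^ d"
  obtains Q :: nat where "0 < Q" "Q \<le> l ^ d"
    "\<And>(a :: int \<Rightarrow> int) x y u. (\<And>r. \<bar>a r\<bar> \<le> 2 * int m) \<Longrightarrow>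
      (\<And>r. x \<le> r \<Longrightarrow> r \<le> y \<Longrightarrow>
        \<bar>\<Sum>i\<le>d. t i * of_int (a (r - int i - int Q) - a (r - int i + int Q))\<bar> < 1 / (2 * real (8 * d * m + 1) ^ d)) \<Longrightarrow>
      x \<le> u \<Longrightarrow> u + int W \<le> y \<Longrightarrow> a (u - int Q) - a (u + int Q) = 0"
proof -
  have "int l > 1" using l(1) prime_gt_1_nat by simp
  obtain s :: "nat \<Rightarrow> int" where s: "\<exists>i\<le>d. \<not> int l dvd s i"
    and ex: "\<And>w :: nat \<Rightarrow> int. (\<And>i. i \<le> d \<Longrightarrow> \<bar>w i\<bar> \<le> int (4 * m)) \<Longrightarrow>
       \<bar>\<Sum>i\<le>d. t i * of_int (w i)\<bar> < 1 / (2 * real (2 * d * (4 * m) + 1) ^ d) \<Longrightarrow> (\<Sum>i\<le>d. s i * w i) = 0"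
  proof (rule approximate_recurrence_exact[of t d "int l" "4 * m", OF td \<open>int l > 1\<close>])
    fix s :: "nat \<Rightarrow> int"
    assume "\<exists>i\<le>d. \<not> int l dvd s i" "\<And>w :: nat \<Rightarrow> int. (\<And>i. i \<le> d \<Longrightarrow> \<bar>w i\<bar> \<le> int (4 * m)) \<Longrightarrow>
       \<bar>\<Sum>i\<le>d. t i * of_int (w i)\<bar> < 1 / (2 * real (2 * d * (4 * m) + 1) ^ d) \<Longrightarrow> (\<Sum>i\<le>d. s i * w i) = 0"
    then show thesis by (rule that)
  qed
  have "l > 2 * (4 * m)" using l by simp
  from recurrence_common_period[OF l(1) this s] obtain p q where pq: "p < q" "q \<le> l ^ d"
    and per: "\<And>a r. (\<And>u. \<bar>a u\<bar> \<le> int (4 * m)) \<Longrightarrow>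
       (\<And>u. r - int q \<le> u \<Longrightarrow> u \<le> r \<Longrightarrow> (\<Sum>i\<le>d. s i * a (u - int i)) = 0) \<Longrightarrow> a (r - int p) = a (r - int q)"
    by blast
  show ?thesis
  proof (rule that[of "q - p"])
    show "0 < q - p" "q - p \<le> l ^ d" using pq by auto
    fix a :: "int \<Rightarrow> int" and x y u
    define Q where "Q = int (q - p)"
    have "int q \<le> int (l ^ d)" using pq(2) by (simp only: of_nat_le_iff)
    moreover have Qqp: "Q = int q - int p" using pq(1) by (simp add: Q_def of_nat_diff)
    ultimately have Q: "Q > 0" "Q \<le> int (l ^ d)" "Q = int q - int p" using pq(1) by linarith+
    assume a: "\<And>r. \<bar>a r\<bar> \<le> 2 * int m"
      and small: "\<And>r. x \<le> r \<Longrightarrow> r \<le> y \<Longrightarrow>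
        \<bar>\<Sum>i\<le>d. t i * of_int (a (r - int i - int (q - p)) - a (r - int i + int (q - p)))\<bar> < 1 / (2 * real (8 * d * m + 1) ^ d)"
      and u: "x \<le> u" "u + int W \<le> y"
    define D where "D = (\<lambda>r. a (r - Q) - a (r + Q))"
    have D: "\<bar>D r\<bar> \<le> int (4 * m)" for r using a[of "r - Q"] a[of "r + Q"] unfolding D_def by auto
    have rec: "(\<Sum>i\<le>d. s i * D (r - int i)) = 0" if "x \<le> r" "r \<le> y" for r
      using small[OF that] by (intro ex D) (simp add: D_def Q_def mult_ac)
    have shift: "D (v + Q) = D v" if "x \<le> v" "v + int q \<le> y" for v
    proof -
      have "D (v + int q - int p) = D (v + int q - int q)"
        by (rule per[OF D]) (use that rec in auto)
      moreover have "v + int q - int p = v + Q" "v + int q - int q = v" using Q(3) by auto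
      ultimately show ?thesis by simp
    qed
    \<comment> \<open>4 m + 1 points spaced 2 Q apart need 8 m shifts by Q. Together with the room
      of length \<open>q\<close> needed by each shift, they account for the two summands of
      \<open>W\<close>.\<close>
    have iter: "D (u + int j * Q) = D u" if "j \<le> 8 * m" for j
      using that
    proof (induction j)
      case (Suc j)
      have "int j * Q \<le> int (8 * m) * int (l ^ d)"
        by (rule mult_mono) (use Suc.prems Q in auto)
      moreover have "int q \<le> int (l ^ d)" using pq by (simp only: of_nat_le_iff)
      ultimately have "u + int j * Q + int q \<le> y"
        using u(2) unfolding W_def by (simp only: of_nat_add of_nat_mult)
      moreover have "x \<le> u + int j * Q" using u Q by (simp add: add_increasing2)
      ultimately have "D (u + int j * Q + Q) = D (u + int j * Q)" by (intro shift) auto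
      then show ?case using Suc by (simp add: algebra_simps)
    qed simp
    have tele: "(\<Sum>j<k. D (u + int (2 * j) * Q)) = a (u - Q) - a (u + (2 * int k - 1) * Q)" for k
      by (induction k) (auto simp: D_def algebra_simps)
    have "(\<Sum>j<4 * m + 1. D (u + int (2 * j) * Q)) = (\<Sum>j<4 * m + 1. D u)"
      by (intro sum.cong refl iter) auto
    then have "int (4 * m + 1) * D u = a (u - Q) - a (u + (2 * int (4 * m + 1) - 1) * Q)"
      unfolding tele by simp
    then have le: "\<bar>int (4 * m + 1) * D u\<bar> \<le> 4 * int m"
      using a[of "u - Q"] a[of "u + (2 * int (4 * m + 1) - 1) * Q"] by linarith
    have "D u = 0"
    proof (rule ccontr)
      assume "D u \<noteq> 0"
      then have "int (4 * m + 1) * 1 \<le> int (4 * m + 1) * \<bar>D u\<bar>" by (intro mult_left_mono) auto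
      also have "\<dots> = \<bar>int (4 * m + 1) * D u\<bar>" by (simp only: abs_mult abs_of_nat)
      finally show False using le by simp
    qed
    then show "a (u - int (q - p)) - a (u + int (q - p)) = 0" by (simp add: D_def Q_def)
  qed
qed

section \<open>From gaps in the filtered spectrum to a bound on its size\<close>

lemma sum_blocks_ge:
  fixes g :: "nat \<Rightarrow> real"
  assumes "\<And>k. g k \<ge> 0" "0 \<le> \<delta>"
    and "\<And>i. off \<le> i \<Longrightarrow> i + X \<le> off + K * X \<Longrightarrow> \<exists>k\<in>{i..<i + X}. \<delta> \<le> g k"
  shows "K * \<delta> \<le> sum g {off..<off + K * X}"
  using assms(3)
proof (induction K)
  case (Suc K)
  from Suc.prems[of "off + K * X"] obtain k where k: "k \<in> {off + K * X..<off + K * X + X}" "\<delta> \<le> g k"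
    by (auto simp: algebra_simps)
  have "{off..<off + Suc K * X} = {off..<off + K * X} \<union> {off + K * X..<off + K * X + X}" by (auto simp: algebra_simps)
  then have "sum g {off..<off + Suc K * X} = sum g {off..<off + K * X} + sum g {off + K * X..<off + K * X + X}"
    by (simp add: sum.union_disjoint)
  moreover have "g k \<le> sum g {off + K * X..<off + K * X + X}"
    by (rule member_le_sum) (use k assms in auto)
  moreover have "K * \<delta> \<le> sum g {off..<off + K * X}"
    by (rule Suc.IH) (rule Suc.prems, auto)
  ultimately show ?case using k(2) by (simp add: algebra_simps)
qed simp

lemma finite_int_set_enum_descending:
  fixes S :: "int set"
  assumes "finite S"
  obtains e where "e ` {..<card S} = S" "\<And>i j. i < j \<Longrightarrow> j < card S \<Longrightarrow> e j < e i"
proof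
  define L where "L = rev (sorted_list_of_set S)"
  have len: "length L = card S" and set: "set L = S" using assms by (auto simp: L_def)
  show "(!) L ` {..<card S} = S" using set len by (auto simp: set_conv_nth)
  have "sorted_wrt (<) (sorted_list_of_set S)" by (rule strict_sorted_list_of_set)
  then have "sorted_wrt (>) L" by (simp add: L_def sorted_wrt_rev)
  then show "L ! j < L ! i" if "i < j" "j < card S" for i j
    using sorted_wrt_nth_less[of "(>)" L i j] that len by simp
qed

text \<open>Among any 4^X consecutive elements of the spectrum of \<open>b\<close> some coefficient
  is at least \<delta>: otherwise \<open>D\<close> would vanish on almost the whole stretch, and so
  would \<open>b\<close>, leaving too few places for 4^X nonzero values. With 4^J frequencies at
  least J/2 blocks would then contribute \<delta> / 4^X each to the L1 inequality, more than
  \<open>V\<close> allows.\<close>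

lemma sparse_spectrum:
  fixes D :: "int \<Rightarrow> int" and t :: "nat \<Rightarrow> real" and d :: nat
  defines "b \<equiv> \<lambda>r. \<Sum>i\<le>d. t i * of_int (D (r - int i))"
  assumes finD: "finite {r. D r \<noteq> 0}" and \<delta>: "\<delta> > 0"
    and gap: "\<And>x y u. (\<And>r. x \<le> r \<Longrightarrow> r \<le> y \<Longrightarrow> \<bar>b r\<bar> < \<delta>) \<Longrightarrow> x \<le> u \<Longrightarrow> u + int W \<le> y \<Longrightarrow> D u = 0"
    and L1: "integral {0..2*pi} (\<lambda>x. norm (\<Sum>r\<in>{r. b r \<noteq> 0}. of_real (b r) * cis (of_int r * x))) \<le> 2 * pi * V"
    and X: "d + W < 4 ^ X" and J: "2 * X \<le> J" "sqrt J > 16 * V * 4 ^ X / \<delta>" "V \<ge> 0"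
  shows "card {r. D r \<noteq> 0} \<le> 4 ^ (J + X)"
proof -
  define S where "S = {r. b r \<noteq> 0}"
  have "S \<subseteq> (\<Union>i\<le>d. (\<lambda>r. r + int i) ` {r. D r \<noteq> 0})"
  proof
    fix r assume "r \<in> S"
    then obtain i where "i \<le> d" "D (r - int i) \<noteq> 0"
      unfolding S_def b_def by (metis (mono_tags, lifting) atMost_iff mem_Collect_eq mult_zero_right of_int_0 sum.neutral)
    then show "r \<in> (\<Union>i\<le>d. (\<lambda>r. r + int i) ` {r. D r \<noteq> 0})"
      by (intro UN_I[of i] image_eqI[of _ _ "r - int i"]) auto
  qed
  then have finS: "finite S" by (rule finite_subset) (use finD in auto)
  have Jpos: "J > 0"
  proof (rule ccontr)
    assume "\<not> J > 0"
    then show False using J \<delta> by simp (meson divide_nonneg_pos mult_nonneg_nonneg not_less zero_le_numeral zero_le_power)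
  qed
  have cardS: "card S < 4 ^ J"
  proof (rule ccontr)
    assume "\<not> card S < 4 ^ J"
    then have big: "4 ^ J \<le> card S" by simp
    obtain e where e: "e ` {..<card S} = S" and desc: "\<And>i j. i < j \<Longrightarrow> j < card S \<Longrightarrow> e j < e i"
      using finite_int_set_enum_descending[OF finS] by metis
    have edesc: "e j \<le> e i" if "i \<le> j" "j < card S" for i j using desc[of i j] that by (cases "i = j") auto
    have inj: "inj_on e {..<card S}"
      by (rule linorder_inj_onI') (use desc in fastforce)
    have dense: "\<exists>k\<in>{i..<i + 4 ^ X}. \<delta> \<le> \<bar>b (e k)\<bar>" if i: "i + 4 ^ X \<le> card S" for i
    proof (rule ccontr)
      assume "\<not> ?thesis"
      then have sm: "\<bar>b (e k)\<bar> < \<delta>" if "k \<in> {i..<i + 4 ^ X}" for k using that by force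
      define hi where "hi = e i"
      define lo where "lo = e (i + 4 ^ X - 1)"
      have small: "\<bar>b r\<bar> < \<delta>" if r: "lo \<le> r" "r \<le> hi" for r
      proof (cases "b r = 0")
        case False
        then obtain k where k: "k < card S" "r = e k" using e by (auto simp: S_def)
        have pos: "(4::nat) ^ X > 0" by simp
        then have "i < card S" using i by linarith
        then have "k \<ge> i" using desc[of k i] r(2) k(2) by (force simp: hi_def)
        moreover have "k \<le> i + 4 ^ X - 1" using desc[of "i + 4 ^ X - 1" k] r(1) k by (force simp: lo_def)
        moreover note pos
        ultimately have "k \<in> {i..<i + 4 ^ X}" unfolding atLeastLessThan_iff by linarith
        from sm[OF this] show ?thesis using k by simp
      qed (use \<delta> in simp)
      have D0: "D u = 0" if "lo \<le> u" "u + int W \<le> hi" for u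
        using gap[of lo hi u] small that by blast
      have b0: "b r = 0" if "lo + int d \<le> r" "r + int W \<le> hi" for r
        unfolding b_def by (rule sum.neutral) (use that in \<open>auto intro!: D0\<close>)
      \<comment> \<open>\<open>b\<close> looks back over \<open>d\<close> places of
        \<open>D\<close>, so nonzero values are confined to the lowest \<open>d\<close> and the
        highest \<open>W\<close> positions, fewer than 4^X in all.\<close>
      have "e ` {i..<i + 4 ^ X} \<subseteq> {lo..<lo + int d} \<union> {hi - int W<..hi}"
      proof
        fix r assume "r \<in> e ` {i..<i + 4 ^ X}"
        then obtain k where k: "i \<le> k" "k < i + 4 ^ X" "r = e k" by auto
        have "lo \<le> r" "r \<le> hi" unfolding lo_def hi_def k(3) by (rule edesc; use k i in auto)+
        moreover have "b r \<noteq> 0" using e k i by (auto simp: S_def)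
        moreover have "\<not> (lo + int d \<le> r \<and> r + int W \<le> hi)" using b0[of r] \<open>b r \<noteq> 0\<close> by blast
        ultimately show "r \<in> {lo..<lo + int d} \<union> {hi - int W<..hi}" by auto
      qed
      then have "card (e ` {i..<i + 4 ^ X}) \<le> card ({lo..<lo + int d} \<union> {hi - int W<..hi})"
        by (intro card_mono) auto
      also have "\<dots> \<le> card {lo..<lo + int d} + card {hi - int W<..hi}" by (rule card_Un_le)
      also have "\<dots> = d + W" by simp
      also have "card (e ` {i..<i + 4 ^ X}) = 4 ^ X"
        by (subst card_image) (use i in \<open>auto intro!: inj_on_subset[OF inj]\<close>)
      finally show False using X by simp
    qed
    \<comment> \<open>Block \<open>j\<close> takes the next 4^j frequencies from the top; off J <=
      4^J <= card S leaves room for all \<open>J\<close> blocks.\<close>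
    define off where "off = (\<lambda>j. \<Sum>i<j. 4 ^ i :: nat)"
    have off_Suc: "off (Suc j) = off j + 4 ^ j" for j by (simp add: off_def)
    have off_mono: "off i \<le> off j" if "i \<le> j" for i j
      unfolding off_def by (rule sum_mono2) (use that in auto)
    have "off j \<le> 4 ^ j" for j by (induction j) (auto simp: off_def)
    then have offJ: "off j \<le> card S" if "j \<le> J" for j
      using off_mono[OF that] big by (meson le_trans)
    define B where "B = (\<lambda>j. e ` {off j..<off (Suc j)})"
    have sub: "{off j..<off (Suc j)} \<subseteq> {..<card S}" if "j < J" for j
      using offJ[of "Suc j"] that by auto
    have "2 * pi * (\<Sum>j<J. (\<Sum>n\<in>B j. norm (complex_of_real (b n))) / 4 ^ j) \<le>
        8 * sqrt J * integral {0..2*pi} (\<lambda>x. norm (\<Sum>n\<in>S. of_real (b n) * cis (of_int n * x)))"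
    proof (rule littlewood_blocks[OF finS _ _ _ _ Jpos])
      fix j assume j: "j < J"
      show "B j \<subseteq> S" unfolding B_def using e sub[OF j] by blast
      show "card (B j) \<le> 4 ^ j"
        unfolding B_def by (rule order_trans[OF card_image_le]) (auto simp: off_Suc)
    next
      fix i j m n assume ij: "i < j" "j < J" and "m \<in> B i" "n \<in> B j"
      then obtain k k' where k: "m = e k" "k < off (Suc i)" "n = e k'" "off j \<le> k'" "k' < off (Suc j)" 
        by (auto simp: B_def)
      moreover have "off (Suc i) \<le> off j" by (rule off_mono) (use ij in auto)
      moreover have "k' < card S" using k sub[OF ij(2)] by auto
      ultimately show "n < m" using desc[of k k'] by auto
    next
      fix n j m assume n: "n \<in> S - (\<Union>j<J. B j)" and j: "j < J" "m \<in> B j"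
      obtain k where k: "k < card S" "n = e k" using n e by auto
      have "off J \<le> k"
      proof (rule ccontr)
        assume "\<not> off J \<le> k"
        then have "\<exists>j<J. k \<in> {off j..<off (Suc j)}"
        proof (induction J)
          case (Suc J) then show ?case by (cases "k < off J") (auto intro: less_SucI)
        qed (simp add: off_def)
        then obtain j' where j': "j' < J" "k \<in> {off j'..<off (Suc j')}" by blast
        then have "n \<in> B j'" unfolding B_def k(2) by (intro imageI)
        then show False using n j'(1) by blast
      qed
      moreover obtain k' where "k' < off (Suc j)" "m = e k'" using j by (auto simp: B_def)
      moreover have "off (Suc j) \<le> off J" by (rule off_mono) (use j in auto)
      ultimately show "n < m" using desc[of k' k] k by auto
    qed
    also have "\<dots> \<le> 8 * sqrt J * (2 * pi * V)"
      using L1 unfolding S_def by (intro mult_left_mono) auto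
    finally have up: "(\<Sum>j<J. (\<Sum>n\<in>B j. \<bar>b n\<bar>) / 4 ^ j) \<le> 8 * sqrt J * V"
      by (simp add: mult_ac)
    \<comment> \<open>A block with j >= X splits into 4^(j - X) windows of length 4^X, each
      containing a coefficient of size \<delta>; after division by 4^j this gives \<delta> / 4^X,
      independently of \<open>j\<close>.\<close>
    have "real (J - X) * (\<delta> / 4 ^ X) = (\<Sum>j\<in>{X..<J}. \<delta> / 4 ^ X)" by simp
    also have "\<dots> \<le> (\<Sum>j\<in>{X..<J}. (\<Sum>n\<in>B j. \<bar>b n\<bar>) / 4 ^ j)"
    proof (rule sum_mono)
      fix j assume j: "j \<in> {X..<J}"
      have p: "(4::nat) ^ j = 4 ^ (j - X) * 4 ^ X" using j by (simp flip: power_add)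
      have "real (4 ^ (j - X)) * \<delta> \<le> (\<Sum>k\<in>{off j..<off j + 4 ^ (j - X) * 4 ^ X}. \<bar>b (e k)\<bar>)"
      proof (rule sum_blocks_ge)
        fix i assume "off j \<le> i" "i + 4 ^ X \<le> off j + 4 ^ (j - X) * 4 ^ X"
        then have "i + 4 ^ X \<le> off (Suc j)" unfolding off_Suc p by simp
        also have "\<dots> \<le> card S" using j by (intro offJ) auto
        finally show "\<exists>k\<in>{i..<i + 4 ^ X}. \<delta> \<le> \<bar>b (e k)\<bar>" by (rule dense)
      qed (use \<delta> in auto)
      also have "\<dots> = (\<Sum>n\<in>B j. \<bar>b n\<bar>)"
        unfolding B_def off_Suc p[symmetric] 
        by (subst sum.reindex) (use inj_on_subset[OF inj sub[of j]] j in \<open>auto simp: off_Suc\<close>)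
      finally have "real (4 ^ (j - X)) * \<delta> / 4 ^ j \<le> (\<Sum>n\<in>B j. \<bar>b n\<bar>) / 4 ^ j"
        by (rule divide_right_mono) auto
      moreover have "real (4 ^ (j - X)) * \<delta> / 4 ^ j = \<delta> / 4 ^ X"
        using arg_cong[OF p, of real] by (simp add: field_simps)
      ultimately show "\<delta> / 4 ^ X \<le> (\<Sum>n\<in>B j. \<bar>b n\<bar>) / 4 ^ j" by simp
    qed
    also have "\<dots> \<le> (\<Sum>j<J. (\<Sum>n\<in>B j. \<bar>b n\<bar>) / 4 ^ j)"
      by (rule sum_mono2) (auto intro!: divide_nonneg_nonneg sum_nonneg)
    finally have lo: "real (J - X) * (\<delta> / 4 ^ X) \<le> 8 * sqrt J * V" using up by linarith
    have "real J / 2 * (\<delta> / 4 ^ X) \<le> real (J - X) * (\<delta> / 4 ^ X)"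
      using J \<delta> by (intro mult_right_mono) auto
    also note lo
    finally have "sqrt J * (sqrt J * \<delta>) \<le> sqrt J * (16 * V * 4 ^ X)"
      using real_sqrt_mult_self[of J] by (simp add: field_simps)
    then have "sqrt J * \<delta> \<le> 16 * V * 4 ^ X" using Jpos by simp
    then show False using J(2) \<delta> by (simp add: field_simps)
  qed
  \<comment> \<open>By the gap hypothesis a nonzero \<open>D u\<close> has some \<bar>b r\<bar>
    \<ge> \<delta> within distance \<open>W\<close> above it, so intervals of W + 1 points attached
    to the spectrum of \<open>b\<close> cover the support of \<open>D\<close>.\<close>
  have "{u. D u \<noteq> 0} \<subseteq> (\<Union>r\<in>S. {r - int W..r})"
  proof
    fix u assume "u \<in> {u. D u \<noteq> 0}"
    then obtain r where r: "u \<le> r" "r \<le> u + int W" "\<not> \<bar>b r\<bar> < \<delta>"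
      using gap[of u "u + int W" u] by auto
    then have "r \<in> S" using \<delta> by (auto simp: S_def)
    then show "u \<in> (\<Union>r\<in>S. {r - int W..r})" using r by (intro UN_I[of r]) auto
  qed
  then have "card {u. D u \<noteq> 0} \<le> card (\<Union>r\<in>S. {r - int W..r})"
    by (intro card_mono) (use finS in auto)
  also have "\<dots> \<le> (\<Sum>r\<in>S. card {r - int W..r})" by (rule card_UN_le[OF finS])
  also have "\<dots> = card S * (W + 1)" by (simp add: nat_add_distrib)
  also have "\<dots> \<le> 4 ^ J * 4 ^ X" by (rule mult_mono) (use cardS X in auto)
  finally show ?thesis by (simp add: power_add)
qed

section \<open>Oscillation of sparse sine sums\<close>

lemma constant_sign_between_zeros:
  fixes g :: "real \<Rightarrow> real"
  assumes "continuous_on {p..q} g" "p < q" "\<And>x. p < x \<Longrightarrow> x < q \<Longrightarrow> g x \<noteq> 0"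
  shows "(\<forall>x\<in>{p..q}. g x \<ge> 0) \<or> (\<forall>x\<in>{p..q}. g x \<le> 0)"
proof -
  have cl: "closure {p<..<q} = {p..q}" using assms(2) by (rule closure_greaterThanLessThan)
  have conn: "connected (g ` {p<..<q})"
    by (rule connected_continuous_image)
       (use assms(1) in \<open>auto intro: continuous_on_subset\<close>)
  have "(\<forall>x\<in>{p<..<q}. g x \<ge> 0) \<or> (\<forall>x\<in>{p<..<q}. g x \<le> 0)"
  proof (rule ccontr)
    assume "\<not> ?thesis"
    then obtain x y where xy: "x \<in> {p<..<q}" "g x < 0" "y \<in> {p<..<q}" "g y > 0" by (auto simp: not_le)
    then have "0 \<in> g ` {p<..<q}"
      using connectedD_interval[OF conn, of "g x" "g y" 0] by auto
    then show False using assms(3) by auto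
  qed
  then show ?thesis
    using continuous_ge_on_closure[of "{p<..<q}" g _ 0] continuous_le_on_closure[of "{p<..<q}" g _ 0] assms(1)
    unfolding cl by metis
qed

lemma abs_integral_cos_le:
  fixes w p q :: real
  assumes "w \<noteq> 0" "p \<le> q"
  shows "\<bar>integral {p..q} (\<lambda>x. cos (w * x))\<bar> \<le> 2 / \<bar>w\<bar>"
proof -
  have "((\<lambda>x. cos (w * x)) has_integral (sin (w * q) / w - sin (w * p) / w)) {p..q}"
    by (rule fundamental_theorem_of_calculus[OF assms(2)])
       (use assms in \<open>auto intro!: derivative_eq_intros simp: has_real_derivative_iff_has_vector_derivative[symmetric]\<close>)
  then have "\<bar>integral {p..q} (\<lambda>x. cos (w * x))\<bar> = \<bar>sin (w * q) - sin (w * p)\<bar> / \<bar>w\<bar>"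
    by (simp add: integral_unique diff_divide_distrib[symmetric] abs_divide)
  also have "\<dots> \<le> 2 / \<bar>w\<bar>"
    by (rule divide_right_mono) (use abs_triangle_ineq4[of "sin (w * q)" "sin (w * p)"] abs_sin_le_one[of "w * q"] abs_sin_le_one[of "w * p"] in linarith, simp)
  finally show ?thesis .
qed

lemma abs_integral_sin_le:
  fixes w p q :: real
  assumes "w \<noteq> 0" "p \<le> q"
  shows "\<bar>integral {p..q} (\<lambda>x. sin (w * x))\<bar> \<le> 2 / \<bar>w\<bar>"
proof -
  have "((\<lambda>x. sin (w * x)) has_integral (- cos (w * q) / w - (- cos (w * p) / w))) {p..q}"
    by (rule fundamental_theorem_of_calculus[OF assms(2)])
       (use assms in \<open>auto intro!: derivative_eq_intros simp: has_real_derivative_iff_has_vector_derivative[symmetric]\<close>)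
  then have "\<bar>integral {p..q} (\<lambda>x. sin (w * x))\<bar> = \<bar>cos (w * p) - cos (w * q)\<bar> / \<bar>w\<bar>"
    by (simp add: integral_unique diff_divide_distrib[symmetric] abs_divide)
  also have "\<dots> \<le> 2 / \<bar>w\<bar>"
    by (rule divide_right_mono) (use abs_triangle_ineq4[of "cos (w * p)" "cos (w * q)"] abs_cos_le_one[of "w * q"] abs_cos_le_one[of "w * p"] in linarith, simp)
  finally show ?thesis .
qed

text \<open>The product-to-sum formula gives approximate orthogonality on an arbitrary interval,
  with error governed by the smallest frequency and separation \<open>g\<close> instead of by full
  periods.\<close>

lemma integral_sin_sin:
  fixes a b g p q :: real
  assumes "p \<le> q" "g > 0" "a \<ge> g" "b \<ge> g"
  shows "\<bar>a - b\<bar> \<ge> g \<Longrightarrow> \<bar>integral {p..q} (\<lambda>x. sin (a * x) * sin (b * x))\<bar> \<le> 2 / g"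
    and "a = b \<Longrightarrow> integral {p..q} (\<lambda>x. sin (a * x) * sin (b * x)) \<ge> (q - p) / 2 - 2 / g"
proof -
  have "integral {p..q} (\<lambda>x. sin (a * x) * sin (b * x)) =
      integral {p..q} (\<lambda>x. 1 / 2 * cos ((a - b) * x) - 1 / 2 * cos ((a + b) * x))"
    by (rule integral_cong) (simp add: sin_times_sin algebra_simps diff_divide_distrib)
  also have "\<dots> = 1 / 2 * integral {p..q} (\<lambda>x. cos ((a - b) * x)) - 1 / 2 * integral {p..q} (\<lambda>x. cos ((a + b) * x))"
    by (subst integral_diff) (auto intro!: integrable_continuous_interval continuous_intros)
  finally have eq: "integral {p..q} (\<lambda>x. sin (a * x) * sin (b * x)) =
     1 / 2 * integral {p..q} (\<lambda>x. cos ((a - b) * x)) - 1 / 2 * integral {p..q} (\<lambda>x. cos ((a + b) * x))" .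
  have "2 / \<bar>a + b\<bar> \<le> 2 / g" using assms by (intro divide_left_mono) auto
  then have plus: "\<bar>integral {p..q} (\<lambda>x. cos ((a + b) * x))\<bar> \<le> 2 / g"
    using abs_integral_cos_le[of "a + b", OF _ assms(1)] assms by auto
  {
    assume ab: "\<bar>a - b\<bar> \<ge> g"
    then have "2 / \<bar>a - b\<bar> \<le> 2 / g" using assms by (intro divide_left_mono) auto
    moreover have "a - b \<noteq> 0" using ab assms(2) by auto
    ultimately have "\<bar>integral {p..q} (\<lambda>x. cos ((a - b) * x))\<bar> \<le> 2 / g"
      using abs_integral_cos_le[of "a - b", OF _ assms(1)] by linarith
    then show "\<bar>integral {p..q} (\<lambda>x. sin (a * x) * sin (b * x))\<bar> \<le> 2 / g"
      unfolding eq using plus by linarith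
  }
  assume "a = b"
  then have "integral {p..q} (\<lambda>x. cos ((a - b) * x)) = q - p" using assms by simp
  moreover have "(q - p) / 2 - z \<le> 1 / 2 * X - 1 / 2 * Y" if "X = q - p" "0 \<le> z" "\<bar>Y\<bar> \<le> z" for X Y z :: real
  proof -
    have "Y \<le> 2 * z" using that(2,3) abs_ge_self[of Y] by linarith
    then show ?thesis using that(1) by (simp add: field_simps)
  qed
  ultimately show "integral {p..q} (\<lambda>x. sin (a * x) * sin (b * x)) \<ge> (q - p) / 2 - 2 / g"
    unfolding eq using plus assms(2) by simp
qed

text \<open>If the frequencies and their differences avoid the range from \<open>U\<close> to \<open>s\<^sup>2 U\<close>, then at the scale
  \<open>1 / (s U)\<close> the sum behaves like a sum of well separated frequencies with integer coefficients.\<close>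

lemma sine_sum_changes_sign:
  fixes P :: "nat set" and \<alpha> :: "nat \<Rightarrow> int" and K U s k p q \<sigma> :: real
  defines "h \<equiv> \<lambda>x. \<Sum>r\<in>P. of_int (\<alpha> r) * sin (real r * x)"
  assumes P: "finite P" and K: "(\<Sum>r\<in>P. \<bar>real_of_int (\<alpha> r)\<bar>) \<le> K" "K \<ge> 1" and U: "U > 0" and k: "k \<ge> 1"
    and s: "s > 12 * K * k"
    and freq: "\<And>r. r \<in> P \<Longrightarrow> real r \<le> U \<or> s\<^sup>2 * U \<le> real r"
    and diff: "\<And>r r'. r \<in> P \<Longrightarrow> r' \<in> P \<Longrightarrow> \<bar>real r - real r'\<bar> \<le> U \<or> s\<^sup>2 * U \<le> \<bar>real r - real r'\<bar>"
    and big: "\<bar>\<Sum>r\<in>P. of_int (\<alpha> r) * real r\<bar> > K * U"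
    and pq: "0 \<le> p" "q \<le> 1 / (s * U)" "1 / (s * U) / k \<le> q - p"
    and \<sigma>: "\<bar>\<sigma>\<bar> = 1" "\<And>x. x \<in> {p..q} \<Longrightarrow> \<sigma> * h x \<ge> 0"
  shows False
proof -
  have "12 * K * k \<ge> 12 * 1 * 1" using K k by (intro mult_mono) auto
  then have s12: "s > 12" using s by linarith
  have s2: "s\<^sup>2 > 2" using s12 power_strict_mono[of 12 s 2] by simp
  define G where "G = s\<^sup>2 * U"
  have "2 * U < s\<^sup>2 * U" by (rule mult_strict_right_mono[OF s2 U])
  then have G: "G > 2 * U" "G > 0" using U unfolding G_def by linarith+
  define \<tau> where "\<tau> = 1 / (s * U)"
  have \<tau>: "\<tau> > 0" using s12 U by (simp add: \<tau>_def)
  define l where "l = q - p"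
  have l: "l > 0" "\<tau> \<le> k * l" "p \<le> q"
  proof -
    have "\<tau> / k \<le> l" using pq(3) by (simp add: l_def \<tau>_def)
    moreover have "\<tau> / k > 0" using \<tau> k by simp
    ultimately show "l > 0" by linarith
    then show "p \<le> q" by (simp add: l_def)
    show "\<tau> \<le> k * l" using \<open>\<tau> / k \<le> l\<close> k by (simp add: field_simps)
  qed
  define Hi where "Hi = {r \<in> P. G \<le> real r}"
  have finHi: "finite Hi" using P by (simp add: Hi_def)
  define near where "near = (\<lambda>r. {r' \<in> Hi. \<bar>real r - real r'\<bar> \<le> U})"
  define \<mu> where "\<mu> = (\<lambda>r. Min (near r))"
  have near: "finite (near r)" "r \<in> Hi \<Longrightarrow> r \<in> near r" for r using finHi U by (auto simp: near_def)
  have \<mu>: "\<mu> r \<in> Hi" "\<bar>real r - real (\<mu> r)\<bar> \<le> U" if "r \<in> Hi" for r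
  proof -
    have "near r \<noteq> {}" using near(2)[OF that] by blast
    then have "\<mu> r \<in> near r" unfolding \<mu>_def by (rule Min_in[OF near(1)])
    then show "\<mu> r \<in> Hi" "\<bar>real r - real (\<mu> r)\<bar> \<le> U" by (auto simp: near_def)
  qed
  \<comment> \<open>Distances avoid the range between U and G, and G > 2 U; hence being within U is
    transitive on \<open>Hi\<close>, and its classes are clusters with a well defined least
    element.\<close>
  have \<mu>_eq: "\<mu> r = \<mu> r'" if "r \<in> Hi" "r' \<in> Hi" "\<bar>real r - real r'\<bar> \<le> U" for r r'
  proof -
    have "\<bar>real r - real x\<bar> \<le> U \<longleftrightarrow> \<bar>real r' - real x\<bar> \<le> U" if x: "x \<in> Hi" for x
      using diff[of r x] diff[of r' x] that \<open>r \<in> Hi\<close> \<open>r' \<in> Hi\<close> \<open>\<bar>real r - real r'\<bar> \<le> U\<close> G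
      unfolding Hi_def G_def[symmetric] by force
    then have "near r = near r'" by (auto simp: near_def)
    then show ?thesis by (simp add: \<mu>_def)
  qed
  define C where "C = \<mu> ` Hi"
  have finC: "finite C" using finHi by (simp add: C_def)
  have CHi: "C \<subseteq> Hi" using \<mu> by (auto simp: C_def)
  have \<mu>C: "\<mu> c = c" if "c \<in> C" for c
    using that \<mu> \<mu>_eq by (auto simp: C_def) (metis abs_minus_commute)
  have sep: "G \<le> \<bar>real c - real c'\<bar>" if "c \<in> C" "c' \<in> C" "c \<noteq> c'" for c c'
    using diff[of c c'] \<mu>_eq[of c c'] \<mu>C[of c] \<mu>C[of c'] that CHi unfolding G_def by (auto simp: Hi_def)
  have CG: "G \<le> real c" if "c \<in> C" for c using that CHi by (auto simp: Hi_def)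
  \<comment> \<open>The amplitude of a cluster merged into its representative. Being a sum of
    integers, it is an integer.\<close>
  define A where "A = (\<lambda>c. \<Sum>r\<in>{r\<in>Hi. \<mu> r = c}. \<alpha> r)"
  have group: "(\<Sum>r\<in>Hi. of_int (\<alpha> r) * g (\<mu> r)) = (\<Sum>c\<in>C. of_int (A c) * g c)" for g :: "nat \<Rightarrow> real"
  proof -
    have "(\<Sum>c\<in>C. of_int (A c) * g c) = (\<Sum>c\<in>C. \<Sum>r\<in>{r\<in>Hi. \<mu> r = c}. of_int (\<alpha> r) * g (\<mu> r))"
      by (rule sum.cong) (auto simp: A_def sum_distrib_right)
    also have "\<dots> = (\<Sum>r\<in>Hi. of_int (\<alpha> r) * g (\<mu> r))"
      by (rule sum.group) (use finHi finC in \<open>auto simp: C_def\<close>)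
    finally show ?thesis by simp
  qed
  have KHi: "(\<Sum>r\<in>Hi. \<bar>real_of_int (\<alpha> r)\<bar>) \<le> K"
    by (rule order_trans[OF sum_mono2 K(1)]) (use P in \<open>auto simp: Hi_def\<close>)
  have KA: "(\<Sum>c\<in>C. \<bar>real_of_int (A c)\<bar>) \<le> K"
  proof -
    have "(\<Sum>c\<in>C. \<bar>real_of_int (A c)\<bar>) \<le> (\<Sum>c\<in>C. \<Sum>r\<in>{r\<in>Hi. \<mu> r = c}. \<bar>real_of_int (\<alpha> r)\<bar>)"
      by (rule sum_mono) (simp add: A_def)
    also have "\<dots> = (\<Sum>r\<in>Hi. \<bar>real_of_int (\<alpha> r)\<bar>)"
      by (rule sum.group) (use finHi finC in \<open>auto simp: C_def\<close>)
    finally show ?thesis using KHi by simp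
  qed
  define ht where "ht = (\<lambda>x. \<Sum>c\<in>C. of_int (A c) * sin (real c * x))"
  have split: "(\<Sum>r\<in>P. g r) = (\<Sum>r\<in>P - Hi. g r) + (\<Sum>r\<in>Hi. g r)" for g :: "nat \<Rightarrow> real"
    by (rule sum.subset_diff) (use P in \<open>auto simp: Hi_def\<close>)
  have low: "real r \<le> U" if "r \<in> P - Hi" for r
    using freq[of r] that by (auto simp: Hi_def G_def)
  \<comment> \<open>If every cluster cancelled, the slope at 0 would not change when each high
    frequency is replaced by its offset from its representative. All frequencies would then count at
    most U, contrary to \<open>big\<close>.\<close>
  obtain c0 where c0: "c0 \<in> C" "A c0 \<noteq> 0"
  proof (rule ccontr)
    assume "\<not> thesis"
    then have A0: "A c = 0" if "c \<in> C" for c using that \<open>\<And>c0. c0 \<in> C \<Longrightarrow> A c0 \<noteq> 0 \<Longrightarrow> thesis\<close> by blast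
    have z: "(\<Sum>r\<in>Hi. of_int (\<alpha> r) * real (\<mu> r)) = 0"
      unfolding group by (simp add: A0)
    have "(\<Sum>r\<in>Hi. of_int (\<alpha> r) * real r) = (\<Sum>r\<in>Hi. of_int (\<alpha> r) * (real r - real (\<mu> r)))"
      using z by (simp add: right_diff_distrib sum_subtractf)
    then have "\<bar>\<Sum>r\<in>P. of_int (\<alpha> r) * real r\<bar> \<le>
        (\<Sum>r\<in>P - Hi. \<bar>real_of_int (\<alpha> r)\<bar> * U) + (\<Sum>r\<in>Hi. \<bar>real_of_int (\<alpha> r)\<bar> * U)"
      unfolding split
      by (intro order_trans[OF abs_triangle_ineq] add_mono)
         (auto intro!: order_trans[OF sum_abs] sum_mono mult_left_mono low \<mu> simp: abs_mult)
    also have "\<dots> = (\<Sum>r\<in>P. \<bar>real_of_int (\<alpha> r)\<bar>) * U"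
      unfolding split distrib_right sum_distrib_right by simp
    also have "\<dots> \<le> K * U" using K U by (intro mult_right_mono) auto
    finally show False using big by simp
  qed
  \<comment> \<open>Dropping a low frequency or merging a high one changes its sine by at most U x,
    and U \<tau> = 1/s.\<close>
  have close: "\<bar>h x - ht x\<bar> \<le> K / s" if x: "0 \<le> x" "x \<le> \<tau>" for x
  proof -
    have "ht x = (\<Sum>r\<in>Hi. of_int (\<alpha> r) * sin (real (\<mu> r) * x))"
      unfolding ht_def by (rule group[symmetric])
    then have "h x - ht x = (\<Sum>r\<in>P - Hi. of_int (\<alpha> r) * sin (real r * x)) +
       (\<Sum>r\<in>Hi. of_int (\<alpha> r) * (sin (real r * x) - sin (real (\<mu> r) * x)))"
      unfolding h_def split by (simp add: right_diff_distrib sum_subtractf)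
    moreover have "\<bar>sin (real r * x)\<bar> \<le> U * x" if "r \<in> P - Hi" for r
      using abs_sin_x_le_abs_x[of "real r * x"] x mult_right_mono[OF low[OF that] x(1)] by simp
    moreover have "\<bar>sin (real r * x) - sin (real (\<mu> r) * x)\<bar> \<le> U * x" if "r \<in> Hi" for r
    proof -
      have "\<bar>sin (real r * x) - sin (real (\<mu> r) * x)\<bar> = 2 * \<bar>sin ((real r * x - real (\<mu> r) * x) / 2)\<bar> * \<bar>cos ((real r * x + real (\<mu> r) * x) / 2)\<bar>"
        unfolding sin_diff_sin by (simp add: abs_mult)
      also have "\<dots> \<le> 2 * \<bar>(real r * x - real (\<mu> r) * x) / 2\<bar> * 1"
        by (intro mult_mono mult_left_mono abs_sin_x_le_abs_x) auto
      also have "\<dots> = \<bar>real r - real (\<mu> r)\<bar> * x" using x by (simp add: abs_mult left_diff_distrib[symmetric])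
      also have "\<dots> \<le> U * x" using \<mu>[OF that] x by (intro mult_right_mono) auto
      finally show ?thesis .
    qed
    ultimately have "\<bar>h x - ht x\<bar> \<le> (\<Sum>r\<in>P - Hi. \<bar>real_of_int (\<alpha> r)\<bar> * (U * x)) + (\<Sum>r\<in>Hi. \<bar>real_of_int (\<alpha> r)\<bar> * (U * x))"
      by (auto intro!: order_trans[OF abs_triangle_ineq] add_mono order_trans[OF sum_abs] sum_mono mult_left_mono simp: abs_mult)
    also have "\<dots> = (\<Sum>r\<in>P. \<bar>real_of_int (\<alpha> r)\<bar>) * (U * x)"
      unfolding split distrib_right sum_distrib_right by simp
    also have "\<dots> \<le> K * (U * \<tau>)"
      using K U x by (intro mult_mono mult_left_mono) (auto intro!: sum_nonneg)
    also have "\<dots> = K / s" using U s12 by (simp add: \<tau>_def)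
    finally show ?thesis .
  qed
  have inv: "1 / G \<le> k * l / s"
  proof -
    have "1 / G = \<tau> / s" by (simp add: G_def \<tau>_def power2_eq_square)
    also have "\<dots> \<le> k * l / s" using l s12 by (intro divide_right_mono) auto
    finally show ?thesis .
  qed
  have cont: "continuous_on {p..q} ht" unfolding ht_def by (intro continuous_intros)
  note ci = integrable_continuous_interval continuous_intros cont
  have "integral {p..q} ht = (\<Sum>c\<in>C. of_int (A c) * integral {p..q} (\<lambda>x. sin (real c * x)))"
    unfolding ht_def by (subst integral_sum) (auto intro!: ci finC)
  also have "\<bar>\<dots>\<bar> \<le> (\<Sum>c\<in>C. \<bar>real_of_int (A c)\<bar> * (2 / G))"
  proof (intro order_trans[OF sum_abs] sum_mono)
    fix c assume c: "c \<in> C"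
    have "\<bar>integral {p..q} (\<lambda>x. sin (real c * x))\<bar> \<le> 2 / \<bar>real c\<bar>"
      using CG[OF c] G l by (intro abs_integral_sin_le) auto
    also have "\<dots> \<le> 2 / G" using CG[OF c] G by (intro divide_left_mono) auto
    finally show "\<bar>of_int (A c) * integral {p..q} (\<lambda>x. sin (real c * x))\<bar> \<le> \<bar>real_of_int (A c)\<bar> * (2 / G)"
      unfolding abs_mult by (intro mult_left_mono) auto
  qed
  also have "\<dots> = (\<Sum>c\<in>C. \<bar>real_of_int (A c)\<bar>) * (2 / G)" by (rule sum_distrib_right[symmetric])
  also have "\<dots> \<le> K * (2 / G)" using KA G by (intro mult_right_mono) auto
  finally have mean: "\<bar>integral {p..q} ht\<bar> \<le> K * (2 / G)" .
  \<comment> \<open>\<open>h\<close> keeps its sign and \<open>ht\<close> is within K/s of it, so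
    the L1 norm of \<open>ht\<close> is nearly \<plusminus> its integral, which is tiny because all
    its frequencies are at least G.\<close>
  have "integral {p..q} (\<lambda>x. \<bar>ht x\<bar>) \<le> integral {p..q} (\<lambda>x. \<sigma> * ht x + 2 * (K / s))"
  proof (rule integral_le)
    fix x assume x: "x \<in> {p..q}"
    have "\<bar>h x - ht x\<bar> \<le> K / s" using x pq by (intro close) (auto simp: \<tau>_def)
    moreover have "\<sigma> * h x \<ge> 0" by (rule \<sigma>(2)[OF x])
    moreover have "\<sigma> = 1 \<or> \<sigma> = -1" using \<sigma>(1) by linarith
    ultimately show "\<bar>ht x\<bar> \<le> \<sigma> * ht x + 2 * (K / s)" by (elim disjE) (auto simp: abs_le_iff abs_if split: if_splits)
  qed (auto intro!: ci)
  also have "\<dots> = \<sigma> * integral {p..q} ht + 2 * (K / s) * l"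
    using l(3) by (subst integral_add) (auto intro!: ci simp: l_def)
  also have "\<sigma> * integral {p..q} ht \<le> K * (2 / G)"
    using mean \<sigma>(1) abs_ge_self[of "\<sigma> * integral {p..q} ht"] by (simp add: abs_mult)
  finally have up: "integral {p..q} (\<lambda>x. \<bar>ht x\<bar>) \<le> K * (2 / G) + 2 * (K / s) * l" by simp
  define I where "I = (\<lambda>c. integral {p..q} (\<lambda>x. sin (real c * x) * sin (real c0 * x)))"
  have "integral {p..q} (\<lambda>x. ht x * sin (real c0 * x)) = (\<Sum>c\<in>C. of_int (A c) * I c)"
    unfolding ht_def sum_distrib_right I_def mult.assoc by (subst integral_sum) (auto intro!: ci finC)
  also have "\<dots> = of_int (A c0) * I c0 + (\<Sum>c\<in>C - {c0}. of_int (A c) * I c)"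
    by (rule sum.remove[OF finC c0(1)])
  finally have dec: "integral {p..q} (\<lambda>x. ht x * sin (real c0 * x)) = of_int (A c0) * I c0 + (\<Sum>c\<in>C - {c0}. of_int (A c) * I c)" .
  have off: "\<bar>\<Sum>c\<in>C - {c0}. of_int (A c) * I c\<bar> \<le> (\<Sum>c\<in>C - {c0}. \<bar>real_of_int (A c)\<bar> * (2 / G))"
  proof (intro order_trans[OF sum_abs] sum_mono)
    fix c assume c: "c \<in> C - {c0}"
    have "\<bar>I c\<bar> \<le> 2 / G"
      unfolding I_def by (rule integral_sin_sin(1)) (use l G CG c c0 sep in auto)
    then show "\<bar>of_int (A c) * I c\<bar> \<le> \<bar>real_of_int (A c)\<bar> * (2 / G)"
      unfolding abs_mult by (intro mult_left_mono) auto
  qed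
  have I0: "I c0 \<ge> l / 2 - 2 / G"
    unfolding I_def l_def by (rule integral_sin_sin(2)) (use l G CG c0 in auto)
  \<comment> \<open>Integrality enters here: a nonzero amplitude is at least 1, so testing
    \<open>ht\<close> against sin (c0 x) forces an L1 norm of nearly l / 2.\<close>
  have "\<bar>real_of_int (A c0)\<bar> \<ge> 1" using c0(2) by linarith
  then have "l / 2 \<le> \<bar>real_of_int (A c0)\<bar> * (l / 2)"
    using l by (simp add: mult_le_cancel_right1)
  also have "\<dots> \<le> \<bar>real_of_int (A c0)\<bar> * (\<bar>I c0\<bar> + 2 / G)"
    using I0 by (intro mult_left_mono) auto
  finally have "l / 2 \<le> \<bar>of_int (A c0) * I c0\<bar> + \<bar>real_of_int (A c0)\<bar> * (2 / G)"
    by (simp add: abs_mult distrib_left)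
  also have "\<bar>of_int (A c0) * I c0\<bar> \<le> \<bar>integral {p..q} (\<lambda>x. ht x * sin (real c0 * x))\<bar> +
      (\<Sum>c\<in>C - {c0}. \<bar>real_of_int (A c)\<bar> * (2 / G))"
    using off dec by linarith
  also have "\<bar>integral {p..q} (\<lambda>x. ht x * sin (real c0 * x))\<bar> \<le> integral {p..q} (\<lambda>x. \<bar>ht x\<bar>)"
  proof -
    have "norm (integral {p..q} (\<lambda>x. ht x * sin (real c0 * x))) \<le> integral {p..q} (\<lambda>x. \<bar>ht x\<bar>)"
      by (rule integral_norm_bound_integral) (auto intro!: ci simp: abs_mult mult_left_le)
    then show ?thesis by simp
  qed
  finally have "l / 2 \<le> integral {p..q} (\<lambda>x. \<bar>ht x\<bar>) + (\<Sum>c\<in>C. \<bar>real_of_int (A c)\<bar> * (2 / G))"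
    using sum.remove[OF finC c0(1), of "\<lambda>c. \<bar>real_of_int (A c)\<bar> * (2 / G)"] by linarith
  also have "(\<Sum>c\<in>C. \<bar>real_of_int (A c)\<bar> * (2 / G)) \<le> K * (2 / G)"
    unfolding sum_distrib_right[symmetric] using KA G by (intro mult_right_mono) auto
  finally have "l / 2 \<le> 4 * K * (1 / G) + 2 * (K / s) * l" using up by simp
  also have "4 * K * (1 / G) \<le> 4 * K * (k * l / s)" using inv K by (intro mult_left_mono) auto
  also have "2 * (K / s) * l \<le> 2 * K * (k * l / s)"
    using k K l s12 by (simp add: field_simps mult_le_cancel_left1)
  \<comment> \<open>The errors total 6 K k l / s, which is below l / 2 precisely because s > 12 K
    k.\<close>
  finally have "l / 2 \<le> 6 * K * k * l / s" by simp
  then have "s * l \<le> 12 * K * k * l" using s12 by (simp add: field_simps)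
  then show False using s l(1) by simp
qed

text \<open>The open intervals from Q W^j to Q W^(j+1) with j = 0, ..., card S are disjoint and
  outnumber the elements of \<open>S\<close>.\<close>

lemma scale_gap_exists:
  fixes Q W :: real
  assumes "finite S" "Q > 0" "W > 1"
  obtains j where "j \<le> card S" "\<And>x. x \<in> S \<Longrightarrow> x \<le> Q * W ^ j \<or> W * (Q * W ^ j) \<le> x"
proof (rule ccontr)
  assume "\<not> thesis"
  with that have "\<forall>j\<in>{..card S}. \<exists>x. x \<in> S \<and> Q * W ^ j < x \<and> x < W * (Q * W ^ j)"
    by (metis atMost_iff not_le)
  from bchoice[OF this] obtain x where x: "\<And>j. j \<le> card S \<Longrightarrow> x j \<in> S"
    "\<And>j. j \<le> card S \<Longrightarrow> Q * W ^ j < x j" "\<And>j. j \<le> card S \<Longrightarrow> x j < Q * W ^ Suc j"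
    by (auto simp: mult_ac)
  have "inj_on x {..card S}"
  proof (rule linorder_inj_onI')
    fix i j assume ij: "i \<in> {..card S}" "j \<in> {..card S}" "i < j"
    have "Q * W ^ Suc i \<le> Q * W ^ j"
      using assms ij by (intro mult_left_mono power_increasing) auto
    then show "x i \<noteq> x j" using x(3)[of i] x(2)[of j] ij by auto
  qed
  then have "card {..card S} \<le> card S"
    by (rule card_inj_on_le) (use x assms in auto)
  then show False by simp
qed

text \<open>Multiplying by \<open>sin (Q x)\<close> does not change signs on \<open>(0, \<pi> / Q)\<close>.\<close>

lemma value_at_zero_bound:
  fixes f :: "real \<Rightarrow> real" and P :: "nat set" and \<alpha> :: "nat \<Rightarrow> int" and Q n k :: nat and F K :: real
  defines "s \<equiv> 12 * K * (k + 1) + 1"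
  assumes f: "continuous_on UNIV f" and Q: "Q > 0"
    and P: "finite P" "card P \<le> n" and K: "(\<Sum>r\<in>P. \<bar>real_of_int (\<alpha> r)\<bar>) \<le> K" "K \<ge> 1"
    and fh: "\<And>x. 2 * f x * sin (real Q * x) = (\<Sum>r\<in>P. of_int (\<alpha> r) * sin (real r * x))"
    and F: "\<bar>\<Sum>r\<in>P. of_int (\<alpha> r) * real r\<bar> = 2 * F * real Q"
    and Z: "finite {x\<in>{0..2*pi}. f x = 0}" "card {x\<in>{0..2*pi}. f x = 0} \<le> k"
  shows "2 * F \<le> K * (s\<^sup>2) ^ (n + n * n)"
proof (rule ccontr)
  assume "\<not> ?thesis"
  then have Fbig: "2 * F > K * (s\<^sup>2) ^ (n + n * n)" by simp
  have "12 * K * (k + 1) \<ge> 12 * 1 * 1" using K by (intro mult_mono) auto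
  then have s: "s > 12" by (simp add: s_def)
  have s2: "s\<^sup>2 > 1" using s power_strict_mono[of 1 s 2] by simp
  \<comment> \<open>At most n frequencies and n^2 differences have to be avoided; this is the
    exponent n + n * n of the bound.\<close>
  define S where "S = real ` P \<union> (\<lambda>(r, r'). \<bar>real r - real r'\<bar>) ` (P \<times> P)"
  have finS: "finite S" using P by (simp add: S_def)
  have "card S \<le> card (real ` P) + card ((\<lambda>(r, r'). \<bar>real r - real r'\<bar>) ` (P \<times> P))"
    unfolding S_def by (rule card_Un_le)
  also have "\<dots> \<le> card P + card (P \<times> P)" using P by (intro add_mono card_image_le) auto
  also have "\<dots> \<le> n + n * n" unfolding card_cartesian_product using P by (intro add_mono mult_mono) auto
  finally have cardS: "card S \<le> n + n * n" .
  obtain j where j: "j \<le> card S" "\<And>x. x \<in> S \<Longrightarrow> x \<le> real Q * (s\<^sup>2) ^ j \<or> s\<^sup>2 * (real Q * (s\<^sup>2) ^ j) \<le> x"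
    using scale_gap_exists[OF finS, of "real Q" "s\<^sup>2"] Q s2 by auto
  define U where "U = real Q * (s\<^sup>2) ^ j"
  have "real Q * 1 \<le> real Q * (s\<^sup>2) ^ j" using s2 s by (intro mult_left_mono one_le_power) auto
  then have U: "U \<ge> Q" "U > 0" using Q by (auto simp: U_def)
  have KU: "K * U < \<bar>\<Sum>r\<in>P. of_int (\<alpha> r) * real r\<bar>"
  proof -
    have "K * U \<le> K * (real Q * (s\<^sup>2) ^ (n + n * n))"
      unfolding U_def using j(1) cardS s2 K by (intro mult_left_mono power_increasing) auto
    also have "\<dots> < 2 * F * real Q" using Fbig Q by simp
    finally show ?thesis unfolding F .
  qed
  define \<tau> where "\<tau> = 1 / (s * U)"
  have \<tau>: "\<tau> > 0" "real Q * \<tau> \<le> 1"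
  proof -
    show "\<tau> > 0" using s U by (simp add: \<tau>_def)
    have "real Q * 1 \<le> U * s" using U s by (intro mult_mono) auto
    then show "real Q * \<tau> \<le> 1" using s U by (simp add: \<tau>_def field_simps)
  qed
  have "1 * \<tau> \<le> real Q * \<tau>" using Q \<tau> by (intro mult_right_mono) auto
  then have \<tau>1: "\<tau> \<le> 1" using \<tau>(2) by linarith
  \<comment> \<open>[0, \<tau>] is cut into k + 1 equal pieces. On a piece without interior zero
    \<open>f\<close> would keep its sign, and so would the sine sum; as this is impossible at the
    scale \<open>U\<close>, every piece contributes a zero, one more than allowed.\<close>
  define p where "p = (\<lambda>i::nat. i * (\<tau> / (k + 1)))"
  have pmono: "p i \<le> p j" if "i \<le> j" for i j
    unfolding p_def using that \<tau> by (intro mult_right_mono) auto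
  have pk: "p (k + 1) = \<tau>" "p 0 = 0" by (auto simp: p_def)
  have "\<exists>x. p i < x \<and> x < p (Suc i) \<and> f x = 0" if i: "i \<le> k" for i
  proof (rule ccontr)
    assume no: "\<not> ?thesis"
    have lt: "p i < p (Suc i)" using \<tau> by (simp add: p_def distrib_right add_divide_distrib)
    have bounds: "0 \<le> p i" "p (Suc i) \<le> \<tau>" using pmono[of 0 i] pmono[of "Suc i" "k + 1"] i pk by auto
    have "(\<forall>x\<in>{p i..p (Suc i)}. f x \<ge> 0) \<or> (\<forall>x\<in>{p i..p (Suc i)}. f x \<le> 0)"
      by (rule constant_sign_between_zeros)
         (use no lt f in \<open>auto intro: continuous_on_subset\<close>)
    then obtain \<sigma> :: real where \<sigma>: "\<bar>\<sigma>\<bar> = 1" "\<And>x. x \<in> {p i..p (Suc i)} \<Longrightarrow> \<sigma> * f x \<ge> 0"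
    proof (elim disjE)
      assume "\<forall>x\<in>{p i..p (Suc i)}. f x \<ge> 0" then show thesis using that[of 1] by auto
    next
      assume "\<forall>x\<in>{p i..p (Suc i)}. f x \<le> 0" then show thesis using that[of "-1"] by auto
    qed
    show False
    proof (rule sine_sum_changes_sign[OF P(1) K U(2), where k = "k + 1" and s = s and p = "p i" and q = "p (Suc i)" and \<sigma> = \<sigma>])
      show "1 / (s * U) / real (k + 1) \<le> p (Suc i) - p i" by (simp add: p_def \<tau>_def algebra_simps add_divide_distrib)
      fix x assume x: "x \<in> {p i..p (Suc i)}"
      have "real Q * x \<le> real Q * \<tau>" using x bounds by (intro mult_left_mono) auto
      then have "sin (real Q * x) \<ge> 0"
        using \<tau>(2) x bounds pi_gt3 by (intro sin_ge_zero) auto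
      then have "2 * (\<sigma> * f x) * sin (real Q * x) \<ge> 0" using \<sigma>(2)[OF x] by simp
      then show "\<sigma> * (\<Sum>r\<in>P. of_int (\<alpha> r) * sin (real r * x)) \<ge> 0"
        unfolding fh[symmetric] by (simp add: mult_ac)
    qed (use KU bounds j(2) \<sigma>(1) in \<open>auto simp: s_def \<tau>_def S_def U_def\<close>)
  qed
  then obtain x where x: "\<And>i. i \<le> k \<Longrightarrow> p i < x i" "\<And>i. i \<le> k \<Longrightarrow> x i < p (Suc i)" "\<And>i. i \<le> k \<Longrightarrow> f (x i) = 0"
    by metis
  have "inj_on x {..k}"
  proof (rule linorder_inj_onI')
    fix i j assume ij: "i \<in> {..k}" "j \<in> {..k}" "i < j"
    show "x i \<noteq> x j" using x(2)[of i] x(1)[of j] pmono[of "Suc i" j] ij by auto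
  qed
  moreover have "x ` {..k} \<subseteq> {x\<in>{0..2*pi}. f x = 0}"
  proof
    fix y assume "y \<in> x ` {..k}"
    then obtain i where i: "i \<le> k" "y = x i" by auto
    have "0 \<le> p i" "p (Suc i) \<le> \<tau>" using pmono[of 0 i] pmono[of "Suc i" "k + 1"] i pk by auto
    then show "y \<in> {x\<in>{0..2*pi}. f x = 0}" using x[OF i(1)] i \<tau>1 pi_gt3 by auto
  qed
  ultimately have "card {..k} \<le> card {x\<in>{0..2*pi}. f x = 0}"
    using Z(1) by (rule card_inj_on_le)
  then show False using Z(2) by simp
qed

section \<open>Cosine polynomials with few zeros\<close>

text \<open>Induction on the number of zeros by cutting at the largest one, z. If the product found
  on [0, z] has the wrong sign beyond z, z is added to \<open>Y\<close>: cos decreases on [0, pi],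
  so the factor 2 cos x - 2 cos z changes sign exactly at z. Zeros without a sign change stay out of
  \<open>Y\<close>.\<close>

lemma sign_changes_product:
  fixes f :: "real \<Rightarrow> real"
  assumes "continuous_on {0..pi} f" "0 \<le> u" "u \<le> pi" "finite {x. 0 < x \<and> x < u \<and> f x = 0}"
  shows "\<exists>Y \<sigma>. Y \<subseteq> {x. 0 < x \<and> x < u \<and> f x = 0} \<and> \<bar>\<sigma>\<bar> = (1::real) \<and>
    (\<forall>x\<in>{0..u}. 0 \<le> \<sigma> * (f x * (\<Prod>y\<in>Y. 2 * cos x - 2 * cos y)))"
  using assms(2-)
proof (induction "card {x. 0 < x \<and> x < u \<and> f x = 0}" arbitrary: u)
  case 0
  then have empty: "{x. 0 < x \<and> x < u \<and> f x = 0} = {}" by simp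
  have "(\<forall>x\<in>{0..u}. f x \<ge> 0) \<or> (\<forall>x\<in>{0..u}. f x \<le> 0)"
  proof (cases "u = 0")
    case False
    show ?thesis
      by (rule constant_sign_between_zeros)
         (use 0 False empty assms(1) in \<open>auto intro: continuous_on_subset\<close>)
  qed (auto simp: linorder_linear)
  then show ?case
  proof
    assume "\<forall>x\<in>{0..u}. f x \<ge> 0"
    then show ?thesis by (intro exI[of _ "{}"] exI[of _ 1]) auto
  next
    assume "\<forall>x\<in>{0..u}. f x \<le> 0"
    then show ?thesis by (intro exI[of _ "{}"] exI[of _ "-1"]) auto
  qed
next
  case (Suc n)
  define Z where "Z = {x. 0 < x \<and> x < u \<and> f x = 0}"
  have finZ: "finite Z" and "card Z = Suc n" using Suc.hyps(2) Suc.prems(3) by (simp_all add: Z_def)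
  then have neZ: "Z \<noteq> {}" by auto
  define z where "z = Max Z"
  have zZ: "z \<in> Z" unfolding z_def using finZ neZ by (rule Max_in)
  then have z: "0 < z" "z < u" "f z = 0" by (auto simp: Z_def)
  have zmax: "x \<le> z" if "x \<in> Z" for x using that finZ by (simp add: z_def)
  have Z': "{x. 0 < x \<and> x < z \<and> f x = 0} = Z - {z}"
    using z zmax by (fastforce simp: Z_def)
  have "\<exists>Y \<sigma>. Y \<subseteq> {x. 0 < x \<and> x < z \<and> f x = 0} \<and> \<bar>\<sigma>\<bar> = (1::real) \<and>
    (\<forall>x\<in>{0..z}. 0 \<le> \<sigma> * (f x * (\<Prod>y\<in>Y. 2 * cos x - 2 * cos y)))"
  proof (rule Suc.hyps(1))
    show "n = card {x. 0 < x \<and> x < z \<and> f x = 0}"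
      unfolding Z' using Suc.hyps(2) zZ finZ by (simp add: Z_def[symmetric])
  qed (use z Suc.prems finZ in \<open>auto simp: Z'\<close>)
  then obtain Y \<sigma> where Y: "Y \<subseteq> Z - {z}" and \<sigma>: "\<bar>\<sigma>\<bar> = (1::real)"
    and pos: "\<And>x. x \<in> {0..z} \<Longrightarrow> 0 \<le> \<sigma> * (f x * (\<Prod>y\<in>Y. 2 * cos x - 2 * cos y))"
    unfolding Z' by blast
  have Yz: "0 < y" "y < z" if "y \<in> Y" for y
    using Y that zmax by (force simp: Z_def)+
  have finY: "finite Y" using Y finZ finite_subset by blast
  define g where "g = (\<lambda>x. \<sigma> * (f x * (\<Prod>y\<in>Y. 2 * cos x - 2 * cos y)))"
  have "(\<forall>x\<in>{z..u}. g x \<ge> 0) \<or> (\<forall>x\<in>{z..u}. g x \<le> 0)"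
  proof (rule constant_sign_between_zeros)
    show "continuous_on {z..u} g"
      unfolding g_def using z Suc.prems by (intro continuous_intros continuous_on_subset[OF assms(1)]) auto
    fix x assume x: "z < x" "x < u"
    have "f x \<noteq> 0" using zmax[of x] x z by (auto simp: Z_def)
    moreover have "cos x \<noteq> cos y" if "y \<in> Y" for y
      using cos_monotone_0_pi[of y x] Yz[OF that] x Suc.prems by auto
    ultimately show "g x \<noteq> 0" using \<sigma> finY by (auto simp: g_def)
  qed (use z in auto)
  then show ?case
  proof
    assume "\<forall>x\<in>{z..u}. g x \<ge> 0"
    then have "\<forall>x\<in>{0..u}. 0 \<le> g x" using pos by (auto simp: g_def)
    then show ?thesis using Y \<sigma> unfolding g_def Z_def[symmetric] by blast
  next
    assume neg: "\<forall>x\<in>{z..u}. g x \<le> 0"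
    have "0 \<le> \<sigma> * (f x * (\<Prod>y\<in>insert z Y. 2 * cos x - 2 * cos y))" if x: "x \<in> {0..u}" for x
    proof -
      have "\<sigma> * (f x * (\<Prod>y\<in>insert z Y. 2 * cos x - 2 * cos y)) = g x * (2 * cos x - 2 * cos z)"
        using finY Yz by (subst prod.insert) (auto simp: g_def)
      also have "\<dots> \<ge> 0"
      proof (cases "x \<le> z")
        case True
        then have "cos z \<le> cos x" using x z Suc.prems by (intro cos_monotone_0_pi_le) auto
        moreover have "0 \<le> g x" using pos True x by (auto simp: g_def)
        ultimately show ?thesis by (intro mult_nonneg_nonneg) auto
      next
        case False
        then have "cos x \<le> cos z" using x z Suc.prems by (intro cos_monotone_0_pi_le) auto
        moreover have "g x \<le> 0" using neg False x by auto
        ultimately show ?thesis by (intro mult_nonpos_nonpos) auto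
      qed
      finally show ?thesis .
    qed
    then show ?thesis using Y \<sigma> zZ unfolding Z_def[symmetric] by (intro exI[of _ "insert z Y"] exI[of _ \<sigma>]) auto
  qed
qed

section \<open>Coefficients and L1 norm of the sign-corrected polynomial\<close>

lemma sum_shift_nat:
  fixes g :: "nat \<Rightarrow> 'b::comm_monoid_add" and h :: "nat \<Rightarrow> 'b \<Rightarrow> 'c::comm_monoid_add"
  assumes "\<And>i. i > d \<Longrightarrow> g i = 0" "\<And>i. h i 0 = 0" "d + k \<le> D"
  shows "(\<Sum>i\<le>D. if k \<le> i then h i (g (i - k)) else 0) = (\<Sum>i\<le>d. h (i + k) (g i))"
proof -
  have "(\<Sum>i\<le>D. if k \<le> i then h i (g (i - k)) else 0) = (\<Sum>i\<in>(\<lambda>i. i + k) ` {..d}. if k \<le> i then h i (g (i - k)) else 0)"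
  proof (rule sum.mono_neutral_right)
    show "\<forall>i\<in>{..D} - (\<lambda>i. i + k) ` {..d}. (if k \<le> i then h i (g (i - k)) else 0) = 0"
    proof
      fix i assume i: "i \<in> {..D} - (\<lambda>i. i + k) ` {..d}"
      show "(if k \<le> i then h i (g (i - k)) else 0) = 0"
      proof (cases "k \<le> i")
        case True
        then have "d < i - k"
          using i image_eqI[of i "\<lambda>i. i + k" "i - k" "{..d}"] by (auto simp: not_less[symmetric])
        then show ?thesis using assms(1,2) by simp
      qed simp
    qed
  qed (use assms in auto)
  also have "\<dots> = (\<Sum>i\<le>d. h (i + k) (g i))"
    by (subst sum.reindex) auto
  finally show ?thesis .
qed

text \<open>Each factor times e^(ix) is z^2 - 2 cos y z + 1 in z = e^(ix): monic, with absolute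
  coefficient sum at most 4. The product is therefore monic of degree 2 card Y, and the leading
  coefficient 1 is what the Dirichlet argument needs.\<close>

lemma cosine_product_coefficients:
  assumes "finite Y"
  shows "\<exists>t :: nat \<Rightarrow> real. t (2 * card Y) = 1 \<and> (\<Sum>i\<le>2 * card Y. \<bar>t i\<bar>) \<le> 4 ^ card Y \<and>
    (\<forall>i>2 * card Y. t i = 0) \<and>
    (\<forall>x. cis (real (card Y) * x) * of_real (\<Prod>y\<in>Y. 2 * cos x - 2 * cos y) =
      (\<Sum>i\<le>2 * card Y. of_real (t i) * cis (real i * x)))"
  using assms
proof induction
  case empty
  then show ?case by (intro exI[of _ "\<lambda>i. if i = 0 then 1 else 0"]) auto
next
  case (insert y Y)
  define d where "d = 2 * card Y"
  from insert.IH obtain t :: "nat \<Rightarrow> real" where t: "t d = 1" "(\<Sum>i\<le>d. \<bar>t i\<bar>) \<le> 4 ^ card Y" "\<And>i. i > d \<Longrightarrow> t i = 0"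
    "\<And>x. cis (real (card Y) * x) * of_real (\<Prod>y\<in>Y. 2 * cos x - 2 * cos y) = (\<Sum>i\<le>d. of_real (t i) * cis (real i * x))"
    unfolding d_def by blast
  define t' where "t' = (\<lambda>i. (if 0 \<le> i then t (i - 0) else 0) - 2 * cos y * (if 1 \<le> i then t (i - 1) else 0) + (if 2 \<le> i then t (i - 2) else 0))"
  have card: "card (insert y Y) = Suc (card Y)" "2 * card (insert y Y) = d + 2" using insert by (auto simp: d_def)
  note shift = sum_shift_nat[where d = d and g = t and D = "d + 2", OF t(3)]
  show ?case
  proof (intro exI[of _ t'] conjI allI impI)
    show "t' (2 * card (insert y Y)) = 1" unfolding card(2) using t(1) t(3)[of "d + 1"] t(3)[of "d + 2"] by (simp add: t'_def)
    show "t' i = 0" if "2 * card (insert y Y) < i" for i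
      using that t(3)[of i] t(3)[of "i - 1"] t(3)[of "i - 2"] unfolding card(2) by (simp add: t'_def)
    have absif: "(if b then \<bar>v\<bar> else 0) = \<bar>if b then v else 0\<bar>" for b and v :: real by simp
    have tri: "\<bar>a - b + e\<bar> \<le> \<bar>a\<bar> + 2 * B + \<bar>e\<bar>" if "\<bar>b\<bar> \<le> 2 * B" for a b e B :: real
      using that by linarith
    have "(\<Sum>i\<le>d + 2. \<bar>t' i\<bar>) \<le> (\<Sum>i\<le>d + 2. (if 0 \<le> i then \<bar>t (i - 0)\<bar> else 0) + 2 * (if 1 \<le> i then \<bar>t (i - 1)\<bar> else 0) + (if 2 \<le> i then \<bar>t (i - 2)\<bar> else 0))"
    proof (rule sum_mono)
      fix i
      have "\<bar>2 * cos y * x\<bar> \<le> 2 * \<bar>x\<bar>" for x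
        using mult_right_mono[OF abs_cos_le_one, of "\<bar>x\<bar>" y] by (simp add: abs_mult)
      from this[of "if 1 \<le> i then t (i - 1) else 0"]
      show "\<bar>t' i\<bar> \<le> (if 0 \<le> i then \<bar>t (i - 0)\<bar> else 0) + 2 * (if 1 \<le> i then \<bar>t (i - 1)\<bar> else 0) + (if 2 \<le> i then \<bar>t (i - 2)\<bar> else 0)"
        unfolding t'_def absif by (rule tri)
    qed
    also have "\<dots> = (\<Sum>i\<le>d. \<bar>t i\<bar>) + 2 * (\<Sum>i\<le>d. \<bar>t i\<bar>) + (\<Sum>i\<le>d. \<bar>t i\<bar>)"
      unfolding sum.distrib sum_distrib_left[symmetric]
      using shift[of "\<lambda>_ x. \<bar>x\<bar>" 0] shift[of "\<lambda>_ x. \<bar>x\<bar>" 1] shift[of "\<lambda>_ x. \<bar>x\<bar>" 2] by simp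
    also have "\<dots> \<le> 4 * 4 ^ card Y" using t(2) by simp
    finally show "(\<Sum>i\<le>2 * card (insert y Y). \<bar>t' i\<bar>) \<le> 4 ^ card (insert y Y)"
      unfolding card(2) unfolding card(1) by simp
    fix x
    define S where "S = (\<Sum>i\<le>d. complex_of_real (t i) * cis (real i * x))"
    have sh: "(\<Sum>i\<le>d + 2. if k \<le> i then of_real (t (i - k)) * cis (real i * x) else 0) = cis (real k * x) * S" if "k \<le> 2" for k
      using shift[of "\<lambda>i v. complex_of_real v * cis (real i * x)" k] that
      by (simp add: S_def sum_distrib_left cis_mult algebra_simps)
    have "(\<Sum>i\<le>d + 2. of_real (t' i) * cis (real i * x)) =
      (\<Sum>i\<le>d + 2. (if 0 \<le> i then of_real (t (i - 0)) * cis (real i * x) else 0) -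
        2 * cos y * (if 1 \<le> i then of_real (t (i - 1)) * cis (real i * x) else 0) +
        (if 2 \<le> i then of_real (t (i - 2)) * cis (real i * x) else 0))"
      by (rule sum.cong) (auto simp: t'_def algebra_simps)
    also have "\<dots> = cis (real 0 * x) * S - 2 * cos y * (cis (real 1 * x) * S) + cis (real 2 * x) * S"
      unfolding sum.distrib sum_subtractf sum_distrib_left[symmetric] 
      by (simp only: sh[OF le0] sh[of 1, OF one_le_numeral] sh[of 2, OF order_refl])
    also have "\<dots> = cis x * (2 * cos x - 2 * cos y) * S"
    proof -
      have "cis x * cis x + 1 = 2 * cos x * cis x"
      proof (rule complex_eqI)
        have "cos x * cos x - sin x * sin x + 1 = 2 * (cos x * cos x)"
          using sin_cos_squared_add3[of x] by linarith
        then show "Re (cis x * cis x + 1) = Re (2 * cos x * cis x)" by simp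
      qed simp
      then have "cis (2 * x) + 1 = 2 * cos x * cis x" by (simp add: cis_mult)
      moreover have "cis (real 0 * x) * S - 2 * cos y * (cis (real 1 * x) * S) + cis (real 2 * x) * S =
          (cis (2 * x) + 1) * S - 2 * cos y * (cis x * S)"
        by (simp add: distrib_right)
      ultimately show ?thesis by (simp add: left_diff_distrib right_diff_distrib mult_ac)
    qed
    also have "\<dots> = cis (real (card (insert y Y)) * x) * of_real (\<Prod>y\<in>insert y Y. 2 * cos x - 2 * cos y)"
    proof -
      have "cis (real (card (insert y Y)) * x) = cis x * cis (real (card Y) * x)"
        unfolding card(1) by (simp add: cis_mult algebra_simps)
      then show ?thesis
        unfolding S_def t(4)[symmetric] using insert by (simp add: mult_ac)
    qed
    finally show "cis (real (card (insert y Y)) * x) * of_real (\<Prod>y\<in>insert y Y. 2 * cos x - 2 * cos y) =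
       (\<Sum>i\<le>2 * card (insert y Y). of_real (t' i) * cis (real i * x))"
      unfolding card(2) by simp
  qed
qed

lemma integral_cos_cis_le:
  "norm (integral {0..2*pi} (\<lambda>x. of_real (cos (real r * x)) * cis (of_int j * x))) \<le>
    (if int r = \<bar>j\<bar> then 2 * pi else 0)"
proof -
  have "integral {0..2*pi} (\<lambda>x. of_real (cos (real r * x)) * cis (of_int j * x)) =
    integral {0..2*pi} (\<lambda>x. (1 / 2) * cis (of_int (j + int r) * x) + (1 / 2) * cis (of_int (j - int r) * x))"
    by (rule integral_cong) (simp add: complex_eq_iff cos_add sin_add cos_diff sin_diff field_simps)
  also have "\<dots> = (1 / 2) * integral {0..2*pi} (\<lambda>x. cis (of_int (j + int r) * x)) +
     (1 / 2) * integral {0..2*pi} (\<lambda>x. cis (of_int (j - int r) * x))"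
    by (subst integral_add) (auto intro!: integrable_continuous_interval continuous_intros)
  finally show ?thesis
    unfolding integral_cis_int by (auto simp: norm_mult split: if_splits)
qed

lemma cosine_poly_coefficient_le:
  assumes "\<And>r. r \<le> n \<Longrightarrow> \<bar>c r\<bar> \<le> M" "M \<ge> 0"
  shows "norm (integral {0..2*pi} (\<lambda>x. of_real (cosine_poly n c x) * cis (of_int j * x))) \<le> 2 * pi * M"
proof -
  have "integral {0..2*pi} (\<lambda>x. of_real (cosine_poly n c x) * cis (of_int j * x)) =
    integral {0..2*pi} (\<lambda>x. \<Sum>r=0..n. of_real (c r) * (of_real (cos (real r * x)) * cis (of_int j * x)))"
    by (rule integral_cong) (simp add: cosine_poly_def sum_distrib_left sum_distrib_right mult_ac)
  also have "\<dots> = (\<Sum>r=0..n. of_real (c r) * integral {0..2*pi} (\<lambda>x. of_real (cos (real r * x)) * cis (of_int j * x)))"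
    by (subst integral_sum) (auto intro!: integrable_continuous_interval continuous_intros)
  also have "norm \<dots> \<le> (\<Sum>r=0..n. M * (if int r = \<bar>j\<bar> then 2 * pi else 0))"
    by (rule sum_norm_le) (use assms integral_cos_cis_le in \<open>auto simp only: norm_mult norm_of_real atLeastAtMost_iff intro!: mult_mono norm_ge_zero\<close>)
  also have "\<dots> \<le> 2 * pi * M"
  proof -
    have "(\<Sum>r=0..n. M * (if int r = \<bar>j\<bar> then 2 * pi else 0)) = (\<Sum>r=0..n. if r = nat \<bar>j\<bar> then M * (2 * pi) else 0)"
      by (rule sum.cong) auto
    also have "\<dots> \<le> 2 * pi * M" using assms(2) by (simp add: sum.delta)
    finally show ?thesis .
  qed
  finally show ?thesis .
qed

lemma continuous_on_cosine_poly [continuous_intros]: "continuous_on A (cosine_poly n c)"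
  unfolding cosine_poly_def[abs_def] by (intro continuous_intros)

lemma cosine_poly_reflect: "cosine_poly n c (2 * pi - x) = cosine_poly n c x"
proof -
  have "cos (real r * (2 * pi - x)) = cos (real r * x)" for r
  proof -
    have "cos (real r * (2 * pi - x)) = cos (2 * real r * pi - r * x)" by (simp add: algebra_simps)
    also have "\<dots> = cos (real r * x)" unfolding cos_diff cos_2npi sin_2npi by simp
    finally show ?thesis .
  qed
  then show ?thesis by (simp add: cosine_poly_def)
qed

text \<open>Reflection at pi carries the constant sign from [0, pi] to the full period, so the
  modulus may be taken outside the integral. Each coefficient of the product then meets one Fourier
  integral of the cosine polynomial, of size at most 2 pi M whatever the degree
  \<open>n\<close>.\<close>

lemma L1_norm_sign_corrected:
  assumes "\<And>r. r \<le> n \<Longrightarrow> \<bar>c r\<bar> \<le> M" "M \<ge> 0" and Y: "finite Y" and \<sigma>: "\<bar>\<sigma>\<bar> = 1"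
    and pos: "\<And>x. x \<in> {0..pi} \<Longrightarrow> 0 \<le> \<sigma> * (cosine_poly n c x * (\<Prod>y\<in>Y. 2 * cos x - 2 * cos y))"
  shows "integral {0..2*pi} (\<lambda>x. \<bar>cosine_poly n c x * (\<Prod>y\<in>Y. 2 * cos x - 2 * cos y)\<bar>) \<le> 2 * pi * (M * 4 ^ card Y)"
proof -
  let ?f = "cosine_poly n c"
  define T where "T = (\<lambda>x. \<Prod>y\<in>Y. 2 * cos x - 2 * cos y)"
  obtain t :: "nat \<Rightarrow> real" where t: "(\<Sum>i\<le>2 * card Y. \<bar>t i\<bar>) \<le> 4 ^ card Y"
    "\<And>x. cis (real (card Y) * x) * of_real (T x) = (\<Sum>i\<le>2 * card Y. of_real (t i) * cis (real i * x))"
    using cosine_product_coefficients[OF Y] unfolding T_def by blast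
  have Teq: "complex_of_real (T x) = (\<Sum>i\<le>2 * card Y. of_real (t i) * cis (of_int (int i - int (card Y)) * x))" for x
  proof -
    have "complex_of_real (T x) = cis (- (real (card Y) * x)) * (cis (real (card Y) * x) * of_real (T x))"
      by (simp add: cis_mult mult.assoc[symmetric])
    also have "\<dots> = (\<Sum>i\<le>2 * card Y. of_real (t i) * cis (of_int (int i - int (card Y)) * x))"
      unfolding t(2) by (simp add: sum_distrib_left cis_mult algebra_simps)
    finally show ?thesis .
  qed
  have contT: "continuous_on A T" for A unfolding T_def by (intro continuous_intros)
  note ci = integrable_continuous_interval continuous_intros contT
  have abs: "\<bar>?f x * T x\<bar> = \<sigma> * (?f x * T x)" if "x \<in> {0..2*pi}" for x
  proof -
    have "0 \<le> \<sigma> * (?f x * T x)"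
    proof (cases "x \<le> pi")
      case False
      then have "0 \<le> \<sigma> * (?f (2 * pi - x) * T (2 * pi - x))"
        unfolding T_def using that by (intro pos) auto
      then show ?thesis by (simp add: cosine_poly_reflect T_def)
    qed (use that pos in \<open>auto simp: T_def\<close>)
    moreover have "\<sigma> = 1 \<or> \<sigma> = -1" using \<sigma> by linarith
    ultimately show ?thesis by auto
  qed
  have "integral {0..2*pi} (\<lambda>x. \<bar>?f x * T x\<bar>) = integral {0..2*pi} (\<lambda>x. \<sigma> * (?f x * T x))"
    by (rule integral_cong) (rule abs)
  also have "\<dots> \<le> \<bar>\<sigma> * integral {0..2*pi} (\<lambda>x. ?f x * T x)\<bar>" by simp
  also have "\<dots> = norm (complex_of_real (integral {0..2*pi} (\<lambda>x. ?f x * T x)))"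
    by (simp add: abs_mult \<sigma>)
  also have "complex_of_real (integral {0..2*pi} (\<lambda>x. ?f x * T x)) = integral {0..2*pi} (\<lambda>x. complex_of_real (?f x * T x))"
    by (rule integral_unique[symmetric], rule has_integral_of_real, rule integrable_integral) (intro ci)
  also have "\<dots> = integral {0..2*pi} (\<lambda>x. \<Sum>i\<le>2 * card Y. of_real (t i) * (of_real (?f x) * cis (of_int (int i - int (card Y)) * x)))"
    by (rule integral_cong) (simp add: Teq sum_distrib_left mult_ac)
  also have "\<dots> = (\<Sum>i\<le>2 * card Y. of_real (t i) * integral {0..2*pi} (\<lambda>x. of_real (?f x) * cis (of_int (int i - int (card Y)) * x)))"
    by (subst integral_sum) (auto intro!: ci)
  also have "norm \<dots> \<le> (\<Sum>i\<le>2 * card Y. \<bar>t i\<bar> * (2 * pi * M))"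
    by (rule sum_norm_le) (use cosine_poly_coefficient_le[OF assms(1,2)] in \<open>auto simp only: norm_mult norm_of_real intro!: mult_left_mono\<close>)
  also have "\<dots> = (\<Sum>i\<le>2 * card Y. \<bar>t i\<bar>) * (2 * pi * M)" by (simp add: sum_distrib_right)
  also have "\<dots> \<le> 4 ^ card Y * (2 * pi * M)" using t(1) assms(2) by (intro mult_right_mono) auto
  finally show ?thesis by (simp add: T_def mult_ac)
qed

text \<open>2 e^(inx) times the cosine polynomial is a polynomial in e^(ix) that does not vanish at
  1. \<open>Arg2pi\<close> recovers x from e^(ix) on [0, 2 pi); only the end point 2 pi has to be
  added by hand.\<close>

lemma finite_zeros_cosine_poly:
  assumes "cosine_poly n c 0 \<noteq> 0"
  shows "finite {x \<in> {0..2*pi}. cosine_poly n c x = 0}"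
proof -
  define p where "p = (\<Sum>r=0..n. smult (complex_of_real (c r)) (monom 1 (n + r) + monom 1 (n - r)))"
  have p: "poly p (cis x) = 2 * cis (real n * x) * of_real (cosine_poly n c x)" for x
  proof -
    have "cis x ^ (n + r) + cis x ^ (n - r) = 2 * cis (real n * x) * of_real (cos (real r * x))" if "r \<le> n" for r
    proof -
      have "cis x ^ (n + r) = cis (n * x + r * x)" "cis x ^ (n - r) = cis (n * x - r * x)"
        using that by (simp_all add: Complex.DeMoivre of_nat_diff left_diff_distrib distrib_right)
      then have "cis x ^ (n + r) + cis x ^ (n - r) = cis (n * x + r * x) + cis (n * x - r * x)" by simp
      also have "\<dots> = cis (n * x) * (cis (r * x) + cis (- (r * x)))" by (simp add: cis_mult distrib_left)
      also have "cis (r * x) + cis (- (r * x)) = 2 * of_real (cos (real r * x))" by (simp add: complex_eq_iff)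
      finally show ?thesis by simp
    qed
    then show ?thesis
      unfolding p_def poly_sum cosine_poly_def by (simp add: poly_monom sum_distrib_left mult_ac)
  qed
  have "poly p 1 \<noteq> 0" using p[of 0] assms by simp
  then have "finite {z. poly p z = 0}" by (intro poly_roots_finite) auto
  then have fin: "finite (insert (2 * pi) (Arg2pi ` {z. poly p z = 0}))" by simp
  have "{x \<in> {0..2*pi}. cosine_poly n c x = 0} \<subseteq> insert (2 * pi) (Arg2pi ` {z. poly p z = 0})"
  proof
    fix x assume x: "x \<in> {x \<in> {0..2*pi}. cosine_poly n c x = 0}"
    show "x \<in> insert (2 * pi) (Arg2pi ` {z. poly p z = 0})"
    proof (cases "x = 2 * pi")
      case False
      then have "Arg2pi (cis x) = x"
        using x by (intro Arg2pi_unique[of 1]) (auto simp: cis_conv_exp)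
      moreover have "poly p (cis x) = 0" using p[of x] x by simp
      ultimately show ?thesis by (intro insertI2 image_eqI[of _ _ "cis x"]) auto
    qed simp
  qed
  then show ?thesis using fin by (rule finite_subset)
qed

section \<open>Combining sparsity with oscillation\<close>

lemma sum_symmetric_int:
  fixes g :: "int \<Rightarrow> 'a::comm_monoid_add"
  shows "(\<Sum>r\<in>{- int N..int N}. g r) = g 0 + (\<Sum>r=1..N. g (int r) + g (- int r))"
proof (induction N)
  case (Suc N)
  have "{- int (Suc N)..int (Suc N)} = insert (int (Suc N)) (insert (- int (Suc N)) {- int N..int N})"
    by auto
  then show ?case using Suc by (simp add: ac_simps)
qed simp

lemma sum_shift_int:
  fixes g :: "int \<Rightarrow> 'a::semiring_0"
  assumes "\<And>r. \<bar>r\<bar> > int n \<Longrightarrow> g r = 0" "int n + \<bar>k\<bar> \<le> int N"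
  shows "(\<Sum>r\<in>{- int N..int N}. g (r - k) * h r) = (\<Sum>r\<in>{- int n..int n}. g r * h (r + k))"
proof -
  have "(\<Sum>r\<in>{- int N..int N}. g (r - k) * h r) = (\<Sum>r\<in>(\<lambda>r. r + k) ` {- int n..int n}. g (r - k) * h r)"
  proof (rule sum.mono_neutral_right)
    show "\<forall>i\<in>{- int N..int N} - (\<lambda>r. r + k) ` {- int n..int n}. g (i - k) * h i = 0"
    proof
      fix i assume i: "i \<in> {- int N..int N} - (\<lambda>r. r + k) ` {- int n..int n}"
      then have "i - k \<notin> {- int n..int n}" using image_eqI[of i "\<lambda>r. r + k" "i - k" "{- int n..int n}"] by auto
      then have "g (i - k) = 0" by (intro assms(1)) auto
      then show "g (i - k) * h i = 0" by simp
    qed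
  qed (use assms(2) in auto)
  also have "\<dots> = (\<Sum>r\<in>{- int n..int n}. g r * h (r + k))"
    by (subst sum.reindex) (auto simp: inj_on_def)
  finally show ?thesis .
qed

text \<open>\<open>X\<close> and \<open>J\<close> are required to beat the constants of
  \<open>sparse_spectrum\<close> for every d <= 2 k. There are then at most 4^(J + X) sine terms
  with coefficients of modulus at most 4 m, and their product serves as \<open>K\<close> in
  \<open>value_at_zero_bound\<close>.\<close>

lemma cosine_poly_value_bound:
  fixes cz :: "nat \<Rightarrow> int" and n m l k X J :: nat and f :: "real \<Rightarrow> real"
  defines "f \<equiv> cosine_poly n (\<lambda>r. of_int (cz r))"
  assumes l: "prime l" "l > 8 * m" and m: "m \<ge> 1" and cz: "\<And>r. r \<le> n \<Longrightarrow> \<bar>cz r\<bar> \<le> int m"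
    and f0: "f 0 \<noteq> 0" and k: "card {x \<in> {0..2*pi}. f x = 0} \<le> k"
    and X: "2 * k + (l ^ (2 * k) + 8 * m * l ^ (2 * k)) < 4 ^ X"
    and J: "2 * X \<le> J" "sqrt J > 16 * (4 * 4 ^ k * m) * 4 ^ X * (2 * real (16 * k * m + 1) ^ (2 * k))"
  shows "2 * \<bar>f 0\<bar> \<le> (4 * m * 4 ^ (J + X)) *
    ((12 * (4 * m * 4 ^ (J + X)) * (k + 1) + 1)\<^sup>2) ^ (4 ^ (J + X) + 4 ^ (J + X) * 4 ^ (J + X))"
proof -
  have finZ: "finite {x \<in> {0..2*pi}. f x = 0}"
    using finite_zeros_cosine_poly f0 unfolding f_def by blast
  have contf: "continuous_on A f" for A unfolding f_def by (rule continuous_on_cosine_poly)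
  have "finite {x. 0 < x \<and> x < pi \<and> f x = 0}"
    by (rule finite_subset[OF _ finZ]) auto
  then obtain Y \<sigma> where Y: "Y \<subseteq> {x. 0 < x \<and> x < pi \<and> f x = 0}" and \<sigma>: "\<bar>\<sigma>\<bar> = (1::real)"
    and pos: "\<And>x. x \<in> {0..pi} \<Longrightarrow> 0 \<le> \<sigma> * (f x * (\<Prod>y\<in>Y. 2 * cos x - 2 * cos y))"
    using sign_changes_product[OF contf[of "{0..pi}"], of pi] by auto
  have "Y \<subseteq> {x \<in> {0..2*pi}. f x = 0}" using Y by auto
  then have finY: "finite Y" and cardY: "card Y \<le> k"
    using finZ finite_subset card_mono k le_trans by metis+
  define d where "d = 2 * card Y"
  have dk: "d \<le> 2 * k" using cardY by (simp add: d_def)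
  obtain t :: "nat \<Rightarrow> real" where t: "t d = 1"
    "\<And>x. cis (real (card Y) * x) * of_real (\<Prod>y\<in>Y. 2 * cos x - 2 * cos y) = (\<Sum>i\<le>d. of_real (t i) * cis (real i * x))"
    using cosine_product_coefficients[OF finY] unfolding d_def by blast
  define W where "W = l ^ d + 8 * m * l ^ d"
  define \<delta> where "\<delta> = 1 / (2 * real (8 * d * m + 1) ^ d)"
  obtain Q :: nat where Q: "0 < Q" and van:
    "\<And>(a :: int \<Rightarrow> int) x y u. (\<And>r. \<bar>a r\<bar> \<le> 2 * int m) \<Longrightarrow>
      (\<And>r. x \<le> r \<Longrightarrow> r \<le> y \<Longrightarrow>
        \<bar>\<Sum>i\<le>d. t i * of_int (a (r - int i - int Q) - a (r - int i + int Q))\<bar> < \<delta>) \<Longrightarrow>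
      x \<le> u \<Longrightarrow> u + int W \<le> y \<Longrightarrow> a (u - int Q) - a (u + int Q) = 0"
  proof (rule difference_vanishes_on_gaps[of t d l m, OF t(1) l])
    fix Q :: nat
    assume Q: "0 < Q" and "Q \<le> l ^ d" and h: "\<And>(a :: int \<Rightarrow> int) x y u. (\<And>r. \<bar>a r\<bar> \<le> 2 * int m) \<Longrightarrow>
      (\<And>r. x \<le> r \<Longrightarrow> r \<le> y \<Longrightarrow>
        \<bar>\<Sum>i\<le>d. t i * of_int (a (r - int i - int Q) - a (r - int i + int Q))\<bar> < 1 / (2 * real (8 * d * m + 1) ^ d)) \<Longrightarrow>
      x \<le> u \<Longrightarrow> u + int (l ^ d + 8 * m * l ^ d) \<le> y \<Longrightarrow> a (u - int Q) - a (u + int Q) = 0"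
    show thesis
    proof (rule that[OF Q])
      fix a :: "int \<Rightarrow> int" and x y u
      assume "\<And>r. \<bar>a r\<bar> \<le> 2 * int m" and small: "\<And>r. x \<le> r \<Longrightarrow> r \<le> y \<Longrightarrow>
        \<bar>\<Sum>i\<le>d. t i * of_int (a (r - int i - int Q) - a (r - int i + int Q))\<bar> < \<delta>"
        and "x \<le> u" "u + int W \<le> y"
      then show "a (u - int Q) - a (u + int Q) = 0"
        by (intro h[of a x y u, OF _ small[unfolded \<delta>_def]]) (auto simp: W_def)
    qed
  qed
  \<comment> \<open>The symmetric two-sided coefficients of 2 f; the constant one is doubled, hence
    the bound 2 m.\<close>
  define a where "a = (\<lambda>r :: int. if r = 0 then 2 * cz 0 else if \<bar>r\<bar> \<le> int n then cz (nat \<bar>r\<bar>) else 0)"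
  have a_le: "\<bar>a r\<bar> \<le> 2 * int m" for r
  proof (cases "r \<noteq> 0 \<and> \<bar>r\<bar> \<le> int n")
    case True
    then have "\<bar>cz (nat \<bar>r\<bar>)\<bar> \<le> int m" by (intro cz) auto
    then show ?thesis using True by (simp add: a_def)
  qed (use cz[of 0] in \<open>auto simp: a_def\<close>)
  have a0: "a r = 0" if "\<bar>r\<bar> > int n" for r using that by (auto simp: a_def)
  \<comment> \<open>The Fourier coefficients of 4 i f(x) sin (Q x).\<close>
  define D where "D = (\<lambda>r. a (r - int Q) - a (r + int Q))"
  define N where "N = n + Q"
  have D0: "D r = 0" if "\<bar>r\<bar> > int N" for r
  proof -
    have "\<bar>r - int Q\<bar> > int n" "\<bar>r + int Q\<bar> > int n" using that by (auto simp: N_def)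
    then show ?thesis using a0 by (simp add: D_def)
  qed
  have Dle: "\<bar>D r\<bar> \<le> 4 * int m" for r
    using a_le[of "r - int Q"] a_le[of "r + int Q"] by (simp add: D_def)
  have Dminus: "D (- r) = - D r" for r
  proof -
    have "a (- r) = a r" for r by (simp add: a_def)
    from this[of "r + int Q"] this[of "r - int Q"] show ?thesis by (simp add: D_def)
  qed
  have fa: "(\<Sum>r\<in>{- int n..int n}. of_int (a r) * cis (of_int r * x)) = 2 * complex_of_real (f x)" for x
  proof -
    have "(\<Sum>r\<in>{- int n..int n}. of_int (a r) * cis (of_int r * x)) =
      of_int (a 0) + (\<Sum>r=1..n. of_int (a (int r)) * cis (real r * x) + of_int (a (- int r)) * cis (- (real r * x)))"
      unfolding sum_symmetric_int by simp
    also have "(\<Sum>r=1..n. of_int (a (int r)) * cis (real r * x) + of_int (a (- int r)) * cis (- (real r * x))) =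
       (\<Sum>r=1..n. 2 * (of_int (cz r) * complex_of_real (cos (real r * x))))"
      by (rule sum.cong) (auto simp: a_def complex_eq_iff)
    also have "of_int (a 0) + \<dots> = 2 * (\<Sum>r=0..n. of_int (cz r) * complex_of_real (cos (real r * x)))"
      by (subst (2) sum.atLeast_Suc_atMost) (auto simp: a_def sum_distrib_left distrib_left)
    finally show ?thesis by (simp add: f_def cosine_poly_def)
  qed
  have Dsum: "(\<Sum>r\<in>{- int N..int N}. of_int (D r) * cis (of_int r * x)) = 4 * \<i> * of_real (f x * sin (real Q * x))" for x
  proof -
    have "(\<Sum>r\<in>{- int N..int N}. of_int (D r) * cis (of_int r * x)) =
      (\<Sum>r\<in>{- int N..int N}. of_int (a (r - int Q)) * cis (of_int r * x)) -
      (\<Sum>r\<in>{- int N..int N}. of_int (a (r - (- int Q))) * cis (of_int r * x))"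
      by (simp add: D_def left_diff_distrib sum_subtractf)
    also have "(\<Sum>r\<in>{- int N..int N}. of_int (a (r - int Q)) * cis (of_int r * x)) =
       (\<Sum>r\<in>{- int n..int n}. of_int (a r) * cis (of_int (r + int Q) * x))"
      by (rule sum_shift_int[where g = "\<lambda>r. of_int (a r)"]) (auto simp: a0 N_def)
    also have "(\<Sum>r\<in>{- int N..int N}. of_int (a (r - (- int Q))) * cis (of_int r * x)) =
       (\<Sum>r\<in>{- int n..int n}. of_int (a r) * cis (of_int (r + (- int Q)) * x))"
      by (rule sum_shift_int[where g = "\<lambda>r. of_int (a r)"]) (auto simp: a0 N_def)
    also have "(\<Sum>r\<in>{- int n..int n}. of_int (a r) * cis (of_int (r + int Q) * x)) -
       (\<Sum>r\<in>{- int n..int n}. of_int (a r) * cis (of_int (r + (- int Q)) * x)) =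
       (\<Sum>r\<in>{- int n..int n}. of_int (a r) * cis (of_int r * x)) * (cis (real Q * x) - cis (- (real Q * x)))"
      unfolding sum_distrib_right sum_subtractf[symmetric]
      by (rule sum.cong) (auto simp: cis_mult algebra_simps)
    also have "cis (real Q * x) - cis (- (real Q * x)) = 2 * \<i> * of_real (sin (real Q * x))"
      by (simp add: complex_eq_iff)
    finally show ?thesis unfolding fa by simp
  qed
  \<comment> \<open>The coefficients after multiplication by the sign-correcting product, shifted by
    card Y to start at index 0. The shift has modulus 1 and |sin| <= 1, so the L1 bound for
    \<open>f T\<close> carries over with factor 4.\<close>
  define b where "b = (\<lambda>r. \<Sum>i\<le>d. t i * of_int (D (r - int i)))"
  have bsum: "norm (\<Sum>r\<in>{r. b r \<noteq> 0}. of_real (b r) * cis (of_int r * x)) \<le>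
      4 * \<bar>f x * (\<Prod>y\<in>Y. 2 * cos x - 2 * cos y)\<bar>" for x
  proof -
    have b0: "b r = 0" if "\<bar>r\<bar> > int (N + d)" for r
      unfolding b_def by (rule sum.neutral) (use that in \<open>auto intro!: D0\<close>)
    have "(\<Sum>r\<in>{r. b r \<noteq> 0}. of_real (b r) * cis (of_int r * x)) =
      (\<Sum>r\<in>{- int (N + d)..int (N + d)}. of_real (b r) * cis (of_int r * x))"
      by (rule sum.mono_neutral_left) (use b0 in \<open>force+\<close>)
    also have "\<dots> = (\<Sum>i\<le>d. of_real (t i) * (\<Sum>r\<in>{- int (N + d)..int (N + d)}. of_int (D (r - int i)) * cis (of_int r * x)))"
      unfolding b_def by (simp add: sum_distrib_right sum_distrib_left mult.assoc) (rule sum.swap)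
    also have "\<dots> = (\<Sum>i\<le>d. of_real (t i) * (\<Sum>r\<in>{- int N..int N}. of_int (D r) * cis (of_int (r + int i) * x)))"
    proof (rule sum.cong[OF refl], rule arg_cong[where f = "\<lambda>y. of_real (t _) * y"])
      fix i assume "i \<in> {..d}"
      then show "(\<Sum>r\<in>{- int (N + d)..int (N + d)}. of_int (D (r - int i)) * cis (of_int r * x)) =
        (\<Sum>r\<in>{- int N..int N}. of_int (D r) * cis (of_int (r + int i) * x))"
        by (intro sum_shift_int[where g = "\<lambda>r. of_int (D r)"]) (auto simp: D0)
    qed
    also have "\<dots> = (\<Sum>i\<le>d. of_real (t i) * cis (real i * x)) * (\<Sum>r\<in>{- int N..int N}. of_int (D r) * cis (of_int r * x))"
      unfolding sum_distrib_right
      by (rule sum.cong) (auto simp: sum_distrib_left cis_mult algebra_simps)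
    also have "\<dots> = cis (real (card Y) * x) * of_real (\<Prod>y\<in>Y. 2 * cos x - 2 * cos y) * (4 * \<i> * of_real (f x * sin (real Q * x)))"
      unfolding t(2)[symmetric] Dsum ..
    also have "norm \<dots> = 4 * \<bar>f x * (\<Prod>y\<in>Y. 2 * cos x - 2 * cos y)\<bar> * \<bar>sin (real Q * x)\<bar>"
      by (simp add: norm_mult abs_mult mult_ac del: of_real_mult of_real_prod)
    also have "\<dots> \<le> 4 * \<bar>f x * (\<Prod>y\<in>Y. 2 * cos x - 2 * cos y)\<bar> * 1"
      by (intro mult_left_mono abs_sin_le_one) auto
    finally show ?thesis by simp
  qed
  define V where "V = 4 * 4 ^ card Y * real m"
  have finD: "finite {r. D r \<noteq> 0}"
    by (rule finite_subset[of _ "{- int N..int N}"]) (use D0 in force)+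
  have finb: "finite {r. b r \<noteq> 0}"
  proof (rule finite_subset)
    show "{r. b r \<noteq> 0} \<subseteq> {- int (N + d)..int (N + d)}"
    proof
      fix r assume "r \<in> {r. b r \<noteq> 0}"
      then obtain i where "i \<le> d" "D (r - int i) \<noteq> 0"
        unfolding b_def by (metis (mono_tags, lifting) atMost_iff mem_Collect_eq mult_zero_right of_int_0 sum.neutral)
      then show "r \<in> {- int (N + d)..int (N + d)}" using D0[of "r - int i"] by force
    qed
  qed simp
  have card_D: "card {r. D r \<noteq> 0} \<le> 4 ^ (J + X)"
  proof (rule sparse_spectrum[where D = D and \<delta> = \<delta> and d = d and t = t and W = W and V = V and X = X and J = J])
    have "real (8 * d * m + 1) > 0" unfolding of_nat_0_less_iff by simp
    then have "real (8 * d * m + 1) ^ d > 0" by (rule zero_less_power)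
    then show "\<delta> > 0" unfolding \<delta>_def by simp
    show "D u = 0" if "\<And>r. x \<le> r \<Longrightarrow> r \<le> y \<Longrightarrow> \<bar>\<Sum>i\<le>d. t i * of_int (D (r - int i))\<bar> < \<delta>"
        "x \<le> u" "u + int W \<le> y" for x y u
      using van[of a x y u, OF a_le _ that(2,3)] that(1) unfolding D_def by blast
    have "integral {0..2*pi} (\<lambda>x. norm (\<Sum>r\<in>{r. b r \<noteq> 0}. of_real (b r) * cis (of_int r * x))) \<le>
       integral {0..2*pi} (\<lambda>x. 4 * \<bar>f x * (\<Prod>y\<in>Y. 2 * cos x - 2 * cos y)\<bar>)"
      by (rule integral_le[OF _ _ bsum])
         (auto intro!: integrable_continuous_interval continuous_intros contf)
    also have "\<dots> = 4 * integral {0..2*pi} (\<lambda>x. \<bar>f x * (\<Prod>y\<in>Y. 2 * cos x - 2 * cos y)\<bar>)" by simp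
    also have "\<dots> \<le> 4 * (2 * pi * (real m * 4 ^ card Y))"
    proof (intro mult_left_mono)
      show "integral {0..2*pi} (\<lambda>x. \<bar>f x * (\<Prod>y\<in>Y. 2 * cos x - 2 * cos y)\<bar>) \<le> 2 * pi * (real m * 4 ^ card Y)"
        unfolding f_def
      proof (rule L1_norm_sign_corrected[OF _ _ finY \<sigma>])
        show "\<bar>real_of_int (cz r)\<bar> \<le> real m" if "r \<le> n" for r using cz[OF that] by linarith
      qed (use pos in \<open>auto simp: f_def\<close>)
    qed simp
    finally show "integral {0..2*pi} (\<lambda>x. norm (\<Sum>r\<in>{r. (\<Sum>i\<le>d. t i * of_int (D (r - int i))) \<noteq> 0}.
        of_real (\<Sum>i\<le>d. t i * of_int (D (r - int i))) * cis (of_int r * x))) \<le> 2 * pi * V"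
      unfolding b_def V_def by (simp add: mult_ac)
    have l1: "l \<ge> 1" using l(1) prime_ge_1_nat by blast
    have ld: "l ^ d \<le> l ^ (2 * k)" by (rule power_increasing[OF dk l1])
    have "d + W \<le> 2 * k + (l ^ (2 * k) + 8 * m * l ^ (2 * k))"
      unfolding W_def by (intro add_mono dk ld mult_left_mono) auto
    then show "d + W < 4 ^ X" using X by linarith
    have V0: "0 \<le> V" by (simp add: V_def)
    have "V \<le> 4 * 4 ^ k * real m" unfolding V_def
      by (intro mult_right_mono mult_left_mono power_increasing cardY) auto
    then have "V \<le> real (4 * 4 ^ k * m)" by simp
    moreover have "real (8 * d * m + 1) ^ d \<le> real (16 * k * m + 1) ^ (2 * k)"
    proof -
      have "8 * d * m + 1 \<le> 16 * k * m + 1" using dk by simp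
      then have "real (8 * d * m + 1) ^ d \<le> real (16 * k * m + 1) ^ d"
        by (intro power_mono) (simp_all only: of_nat_le_iff of_nat_0_le_iff)
      also have "\<dots> \<le> real (16 * k * m + 1) ^ (2 * k)" by (rule power_increasing[OF dk]) simp
      finally show ?thesis .
    qed
    moreover have step: "16 * v * p * (2 * u) \<le> 16 * v' * p * (2 * u')"
      if "v \<le> v'" "u \<le> u'" "0 \<le> v" "0 \<le> p" "0 \<le> u" for v v' p u u' :: real
      by (intro mult_mono mult_nonneg_nonneg) (use that in auto)
    ultimately have "16 * V * 4 ^ X * (2 * real (8 * d * m + 1) ^ d) \<le>
        16 * real (4 * 4 ^ k * m) * 4 ^ X * (2 * real (16 * k * m + 1) ^ (2 * k))"
      by (intro step zero_le_power of_nat_0_le_iff zero_le_numeral V0)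
    moreover have "16 * V * 4 ^ X / \<delta> = 16 * V * 4 ^ X * (2 * real (8 * d * m + 1) ^ d)"
      unfolding \<delta>_def by simp
    moreover have "real (16 * (4 * 4 ^ k * m) * 4 ^ X) = 16 * real (4 * 4 ^ k * m) * 4 ^ X" by simp
    ultimately show "16 * V * 4 ^ X / \<delta> < sqrt J"
      using J(2) by (simp only:)
    show "V \<ge> 0" by (rule V0)
  qed (use finD J(1) in auto)
  \<comment> \<open>\<open>D\<close> is odd, so its positive half determines a sine sum with integer
    coefficients.\<close>
  define P where "P = {r :: nat. 1 \<le> r \<and> r \<le> N \<and> D (int r) \<noteq> 0}"
  have finP: "finite P" unfolding P_def by (rule finite_subset[of _ "{..N}"]) auto
  have sineP: "(\<Sum>r\<in>P. of_int (D (int r)) * g r) = (\<Sum>r=1..N. of_int (D (int r)) * g r)" for g :: "nat \<Rightarrow> real"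
    by (rule sum.mono_neutral_left) (auto simp: P_def)
  have sine: "2 * f x * sin (real Q * x) = (\<Sum>r\<in>P. of_int (D (int r)) * sin (real r * x))" for x
  proof -
    have "4 * (f x * sin (real Q * x)) = Im (\<Sum>r\<in>{- int N..int N}. of_int (D r) * cis (of_int r * x))"
      unfolding Dsum by simp
    also have "\<dots> = (\<Sum>r\<in>{- int N..int N}. of_int (D r) * sin (of_int r * x))" by simp
    also have "\<dots> = 2 * (\<Sum>r=1..N. of_int (D (int r)) * sin (real r * x))"
      unfolding sum_symmetric_int by (simp add: Dminus sum_distrib_left)
    finally show ?thesis unfolding sineP by simp
  qed
  have "card P \<le> card {r. D r \<noteq> 0}"
    by (rule card_inj_on_le[of int]) (use finD in \<open>auto simp: P_def inj_on_def\<close>)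
  then have cardP: "card P \<le> 4 ^ (J + X)" using card_D by linarith
  have KP: "(\<Sum>r\<in>P. \<bar>real_of_int (D (int r))\<bar>) \<le> 4 * m * 4 ^ (J + X)"
  proof -
    have "(\<Sum>r\<in>P. \<bar>real_of_int (D (int r))\<bar>) \<le> (\<Sum>r\<in>P. 4 * real m)"
    proof (rule sum_mono)
      show "\<bar>real_of_int (D (int r))\<bar> \<le> 4 * real m" for r using Dle[of "int r"] by linarith
    qed
    also have "\<dots> = real (card P) * (4 * real m)" by simp
    also have "\<dots> \<le> real (4 ^ (J + X)) * (4 * real m)"
      using of_nat_mono[OF cardP, where 'a = real] by (intro mult_right_mono) auto
    finally show ?thesis by (simp add: mult_ac)
  qed
  \<comment> \<open>Both sides of \<open>sine\<close> are differentiated at 0, where the derivative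
    of sin (Q x) contributes Q.\<close>
  have slope: "(\<Sum>r\<in>P. of_int (D (int r)) * real r) = 2 * f 0 * real Q"
  proof -
    have "f field_differentiable (at 0)"
      unfolding f_def cosine_poly_def[abs_def]
      by (auto simp: field_differentiable_def intro!: exI derivative_eq_intros)
    then obtain f' where f': "(f has_real_derivative f') (at 0)" by (auto simp: field_differentiable_def)
    have "((\<lambda>x. 2 * f x * sin (real Q * x)) has_real_derivative 2 * f 0 * real Q) (at 0)"
      by (rule derivative_eq_intros f' refl)+ simp
    moreover have "((\<lambda>x. \<Sum>r\<in>P. of_int (D (int r)) * sin (real r * x)) has_real_derivative
       (\<Sum>r\<in>P. of_int (D (int r)) * real r)) (at 0)"
      by (rule derivative_eq_intros refl | simp add: mult.commute)+
    ultimately show ?thesis unfolding sine[symmetric] using DERIV_unique by blast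
  qed
  have "1 * 1 \<le> 4 * m * 4 ^ (J + X)" using m by (intro mult_le_mono) auto
  then have "1 \<le> 4 * m * 4 ^ (J + X)" by (simp only: mult_1)
  from of_nat_mono[OF this, where 'a = real] have K1: "1 \<le> real (4 * m * 4 ^ (J + X))"
    by (simp only: of_nat_1)
  have F: "\<bar>\<Sum>r\<in>P. of_int (D (int r)) * real r\<bar> = 2 * \<bar>f 0\<bar> * real Q"
    unfolding slope by (simp add: abs_mult)
  show ?thesis
    using value_at_zero_bound[OF contf Q finP cardP KP K1 sine F finZ k]
    by (simp only: of_nat_mult of_nat_power of_nat_add of_nat_1 of_nat_numeral)
qed

section \<open>Existence of one zero for coefficients in {-1, 0, 1}\<close>

lemma sum_cos_roots_of_unity:
  assumes "0 < r" "r < p"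
  shows "(\<Sum>j<p. cos (real r * (x + 2 * pi * real j / real p))) = 0"
proof -
  \<comment> \<open>A \<open>p\<close>-th root of unity, different from 1 because 0 < r < p; its
    geometric sum therefore vanishes.\<close>
  define w where "w = cis (2 * pi * real r / real p)"
  have "cis (2 * pi * real r / real p) \<noteq> 1"
  proof
    assume "cis (2 * pi * real r / real p) = 1"
    then have "cos (2 * pi * real r / real p) = 1" by (simp add: complex_eq_iff)
    then obtain i :: int where "2 * pi * real r / real p = of_int i * 2 * pi"
      unfolding cos_one_2pi_int by blast
    then have "real r = of_int i * real p" using assms by (simp add: field_simps)
    then have "int r = i * int p" by (metis of_int_eq_iff of_int_mult of_int_of_nat_eq)
    then have "int p dvd int r" by simp
    then show False using assms by (auto dest: dvd_imp_le)
  qed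
  moreover have "w ^ p = 1"
  proof -
    have "w ^ p = cis (2 * pi * real r)" using assms by (simp add: w_def Complex.DeMoivre)
    then show ?thesis using cos_2npi[of r] sin_2npi[of r] by (simp add: complex_eq_iff mult_ac)
  qed
  ultimately have "(\<Sum>j<p. w ^ j) = 0" by (simp add: sum_gp_strict w_def)
  then have "Re (cis (real r * x) * (\<Sum>j<p. w ^ j)) = 0" by simp
  moreover have "cis (real r * x) * (\<Sum>j<p. w ^ j) = (\<Sum>j<p. cis (real r * (x + 2 * pi * real j / real p)))"
    unfolding sum_distrib_left
    by (rule sum.cong) (auto simp: w_def Complex.DeMoivre cis_mult algebra_simps)
  ultimately show ?thesis by simp
qed

text \<open>Averaging over a coset of the \<open>p\<close>-th roots of unity, \<open>p\<close> the degree, leaves \<open>c 0 \<plusminus> 1\<close>.\<close>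

lemma cosine_poly_has_zero:
  assumes c: "\<And>r. r \<le> n \<Longrightarrow> c r \<in> {-1, 0, 1 :: real}" and f0: "\<bar>cosine_poly n c 0\<bar> > 1"
  shows "\<exists>x\<in>{0..2*pi}. cosine_poly n c x = 0"
proof (rule ccontr)
  define f where "f = cosine_poly n c"
  assume "\<not> ?thesis"
  then have nz: "f x \<noteq> 0" if "x \<in> {0..2*pi}" for x using that by (auto simp: f_def)
  have "(\<forall>x\<in>{0..2*pi}. f x \<ge> 0) \<or> (\<forall>x\<in>{0..2*pi}. f x \<le> 0)"
    by (rule constant_sign_between_zeros) (use nz in \<open>auto simp: f_def intro!: continuous_intros\<close>)
  then obtain \<sigma> :: real where \<sigma>: "\<sigma> = 1 \<or> \<sigma> = -1" and pos: "\<And>x. x \<in> {0..2*pi} \<Longrightarrow> \<sigma> * f x > 0"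
  proof (elim disjE)
    assume "\<forall>x\<in>{0..2*pi}. f x \<ge> 0"
    then show thesis using that[of 1] nz by (simp add: order_less_le)
  next
    assume "\<forall>x\<in>{0..2*pi}. f x \<le> 0"
    then show thesis using that[of "-1"] nz by (simp add: order_less_le)
  qed
  define A where "A = {r. 1 \<le> r \<and> r \<le> n \<and> c r \<noteq> 0}"
  have finA: "finite A" unfolding A_def by (rule finite_subset[of _ "{..n}"]) auto
  have "A \<noteq> {}"
  proof
    assume "A = {}"
    then have "cosine_poly n c 0 = (\<Sum>r\<in>{0}. c r)"
      unfolding cosine_poly_def by (subst sum.mono_neutral_right[of _ "{0}"]) (auto simp: A_def)
    then show False using f0 c[of 0] by auto
  qed
  \<comment> \<open>The effective degree. Averaging over the shifts by 2 pi j / p kills all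
    frequencies strictly between 0 and \<open>p\<close>, and higher ones have coefficient 0.\<close>
  define p where "p = Max A"
  have "p \<in> A" unfolding p_def using finA \<open>A \<noteq> {}\<close> by (rule Max_in)
  then have p: "1 \<le> p" "p \<le> n" "c p \<noteq> 0" by (auto simp: A_def)
  have above: "c r = 0" if "p < r" "r \<le> n" for r
  proof (rule ccontr)
    assume "c r \<noteq> 0"
    then have "r \<in> A" using that by (auto simp: A_def)
    then have "r \<le> p" unfolding p_def using finA by simp
    then show False using that by simp
  qed
  \<comment> \<open>The base point makes the top term contribute -1, against the sign of f, so the
    average is \<sigma> * c 0 - 1 <= 0 although every summand is positive. The bound pi / p keeps
    all shifted points in [0, 2 pi].\<close>
  obtain x where x: "0 \<le> x" "x \<le> pi / p" "\<sigma> * c p * cos (real p * x) = -1"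
  proof (cases "\<sigma> * c p = -1")
    case True
    then show thesis using that[of 0] by simp
  next
    case False
    then have "\<sigma> * c p = 1" using c[OF p(2)] p(3) \<sigma> by auto
    then show thesis using that[of "pi / p"] p(1) by simp
  qed
  have "0 < (\<Sum>j<p. \<sigma> * f (x + 2 * pi * real j / real p))"
  proof (rule sum_pos)
    fix j assume "j \<in> {..<p}"
    then have "2 * real j + 1 \<le> 2 * real p" by auto
    then have "pi * (2 * real j + 1) \<le> pi * (2 * real p)" by (intro mult_left_mono) auto
    then have "pi / p + 2 * pi * real j / p \<le> 2 * pi" using p(1) by (simp add: field_simps)
    then show "0 < \<sigma> * f (x + 2 * pi * real j / real p)" using x by (intro pos) auto
  qed (use p in \<open>auto simp: lessThan_empty_iff\<close>)
  also have "(\<Sum>j<p. \<sigma> * f (x + 2 * pi * real j / real p)) =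
      (\<Sum>r=0..n. \<sigma> * c r * (\<Sum>j<p. cos (real r * (x + 2 * pi * real j / real p))))"
    unfolding f_def cosine_poly_def sum_distrib_left by (subst sum.swap) (simp add: mult_ac)
  also have "\<dots> = (\<Sum>r\<in>{0, p}. \<sigma> * c r * (\<Sum>j<p. cos (real r * (x + 2 * pi * real j / real p))))"
  proof (rule sum.mono_neutral_right)
    show "\<forall>r\<in>{0..n} - {0, p}. \<sigma> * c r * (\<Sum>j<p. cos (real r * (x + 2 * pi * real j / real p))) = 0"
    proof
      fix r assume r: "r \<in> {0..n} - {0, p}"
      then consider "0 < r" "r < p" | "p < r" "r \<le> n" by force
      then show "\<sigma> * c r * (\<Sum>j<p. cos (real r * (x + 2 * pi * real j / real p))) = 0"
      proof cases
        case 1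
        then show ?thesis unfolding sum_cos_roots_of_unity[OF 1] by simp
      qed (simp add: above)
    qed
  qed (use p in auto)
  also have "\<dots> = \<sigma> * c 0 * real p + \<sigma> * c p * (\<Sum>j<p. cos (real p * x))"
  proof -
    have "cos (real p * (x + 2 * pi * real j / real p)) = cos (real p * x)" for j
    proof -
      have "cos (real p * (x + 2 * pi * real j / real p)) = cos (real p * x + 2 * real j * pi)"
        using p(1) by (simp add: distrib_left mult_ac)
      also have "\<dots> = cos (real p * x)" unfolding cos_add cos_2npi sin_2npi by simp
      finally show ?thesis .
    qed
    then show ?thesis using p(1) by simp
  qed
  also have "\<dots> = real p * (\<sigma> * c 0 + \<sigma> * c p * cos (real p * x))" by (simp add: algebra_simps)
  also have "\<dots> \<le> 0"
    unfolding x(3) using c[of 0] \<sigma> by (intro mult_nonneg_nonpos) auto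
  finally show False by simp
qed

section \<open>Iterated logarithms and the choice of parameters\<close>

lemma iter_log2_3: "iter_log2 3 x = log 2 (log 2 (log 2 x))"
  by (simp add: iter_log2_def numeral_3_eq_3)

lemma iter_log2_5: "iter_log2 5 x = log 2 (log 2 (log 2 (log 2 (log 2 x))))"
  by (simp add: iter_log2_def eval_nat_numeral)

lemma iter_log2_3_le:
  assumes "2 ^ 2 < F" "F \<le> 2 ^ (2 ^ e)" "e \<le> 2 ^ g"
  shows "iter_log2 3 F \<le> real g"
proof -
  have l1: "log 2 F > 2" using less_log_of_power[of 2 2 F] assms(1) by simp
  have "log 2 F \<le> log 2 (2 ^ (2 ^ e))" using assms(1,2) by (intro log_mono) auto
  then have u1: "log 2 F \<le> 2 ^ e" by (simp add: log_nat_power)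
  have l2: "log 2 (log 2 F) > 1" using less_log_of_power[of 2 1 "log 2 F"] l1 by simp
  have "log 2 (log 2 F) \<le> log 2 (2 ^ e)" using l1 u1 by (intro log_mono) auto
  then have "log 2 (log 2 F) \<le> real e" by (simp add: log_nat_power)
  also have "\<dots> \<le> real (2 ^ g)" using assms(3) by (rule of_nat_mono)
  finally have u2: "log 2 (log 2 F) \<le> 2 ^ g" by simp
  have "log 2 (log 2 (log 2 F)) \<le> log 2 (2 ^ g)" using l2 u2 by (intro log_mono) auto
  then show ?thesis by (simp add: iter_log2_3 log_nat_power)
qed

text \<open>All quantities are bounded by powers of 2. The outcome is |f 0| <= 2^(2^(9 J)) with J =
  2^(22 q) and q = b (k + 1)^2, which three logarithms reduce to 4 + 22 q <= 23 q.\<close>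

lemma cosine_poly_iter_log2_bound:
  fixes cz :: "nat \<Rightarrow> int" and n m l k b :: nat and f :: "real \<Rightarrow> real"
  defines "f \<equiv> cosine_poly n (\<lambda>r. of_int (cz r))"
  assumes l: "prime l" "l > 8 * m" and m: "m \<ge> 1" and cz: "\<And>r. r \<le> n \<Longrightarrow> \<bar>cz r\<bar> \<le> int m"
    and b: "l \<le> 2 ^ b" "b \<ge> 4" and f0: "\<bar>f 0\<bar> > 2 ^ 2" and k: "card {x \<in> {0..2*pi}. f x = 0} \<le> k"
  shows "iter_log2 3 \<bar>f 0\<bar> \<le> 23 * real b * (real k + 1)\<^sup>2"
proof -
  \<comment> \<open>Using k + 1 keeps the parameters positive and the estimates uniform when there
    are no zeros.\<close>
  define \<kappa> where "\<kappa> = k + 1"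
  define q where "q = b * \<kappa>\<^sup>2"
  define X where "X = 2 * b * \<kappa>"
  \<comment> \<open>The lower bound required of sqrt J is a product whose binary exponent stays
    below 11 q; J is the square of 2^(11 q).\<close>
  define J where "J = (2::nat) ^ (22 * q)"
  have \<kappa>2: "\<kappa> \<le> \<kappa>\<^sup>2" "1 \<le> \<kappa>\<^sup>2" by (auto simp: \<kappa>_def power2_eq_square)
  have q: "b \<le> q" "b * \<kappa> \<le> q" "4 * \<kappa> \<le> q" "4 * \<kappa>\<^sup>2 \<le> q" "4 \<le> q"
  proof -
    show q2: "b * \<kappa> \<le> q" "4 * \<kappa>\<^sup>2 \<le> q" unfolding q_def using \<kappa>2 b by (auto intro: mult_le_mono)
    then show "4 * \<kappa> \<le> q" using mult_le_mono2[OF \<kappa>2(1), of 4] by linarith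
    show "b \<le> q" using mult_le_mono2[OF \<kappa>2(2), of b] unfolding q_def by (simp only: mult_1_right)
    then show "4 \<le> q" using b(2) by linarith
  qed
  have J22: "22 * q < J" unfolding J_def by (rule less_exp)
  have XJ: "2 * X \<le> J" using q J22 by (simp add: X_def)
  have m2b: "m \<le> 2 ^ b" using l b by simp
  have k2: "2 * k + 1 \<le> 2 ^ (2 * k)" using Suc_leI[OF less_exp[of "2 * k"]] by (simp only: Suc_eq_plus1)
  have Xc: "2 * k + (l ^ (2 * k) + 8 * m * l ^ (2 * k)) < 4 ^ X"
  proof -
    have "l ^ (2 * k) + 8 * m * l ^ (2 * k) = (1 + 8 * m) * l ^ (2 * k)" by (simp add: algebra_simps)
    also have "\<dots> \<le> l * l ^ (2 * k)" by (rule mult_le_mono1) (use l in simp)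
    also have "\<dots> = l ^ (2 * k + 1)" by simp
    also have "\<dots> \<le> (2 ^ b) ^ (2 * k + 1)" by (rule power_mono) (use b in auto)
    also have "\<dots> \<le> 2 ^ (2 * b * \<kappa>)"
      unfolding power_mult[symmetric] by (rule power_increasing) (auto simp: \<kappa>_def algebra_simps)
    finally have "l ^ (2 * k) + 8 * m * l ^ (2 * k) \<le> 2 ^ (2 * b * \<kappa>)" .
    moreover have "2 * k < 2 ^ (2 * b * \<kappa>)"
    proof -
      have "1 * \<kappa> \<le> b * \<kappa>" by (rule mult_le_mono1) (use b in simp)
      then have "2 * k \<le> 2 * b * \<kappa>" by (simp add: \<kappa>_def)
      also have "\<dots> < 2 ^ (2 * b * \<kappa>)" by (rule less_exp)
      finally show ?thesis .
    qed
    moreover have "(2::nat) * 2 ^ (2 * b * \<kappa>) \<le> 2 ^ (2 * X)"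
    proof -
      have "Suc (2 * b * \<kappa>) \<le> 2 * X" using b by (simp add: X_def \<kappa>_def)
      then have "(2::nat) ^ Suc (2 * b * \<kappa>) \<le> 2 ^ (2 * X)" by (rule power_increasing) simp
      then show ?thesis by simp
    qed
    ultimately have "2 * k + (l ^ (2 * k) + 8 * m * l ^ (2 * k)) < 2 ^ (2 * X)" by linarith
    then show ?thesis by (simp add: power_mult)
  qed
  have Jc: "sqrt J > 16 * (4 * 4 ^ k * m) * 4 ^ X * (2 * real (16 * k * m + 1) ^ (2 * k))"
  proof -
    have "2 * k * (8 * m) \<le> 2 * k * l" by (rule mult_le_mono2) (use l in simp)
    moreover have "16 * k * m = 2 * k * (8 * m)" by simp
    ultimately have "16 * k * m + 1 \<le> 2 * k * l + l" using l(2) by linarith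
    also have "\<dots> = (2 * k + 1) * l" by simp
    also have "\<dots> \<le> 2 ^ (2 * k) * 2 ^ b" by (rule mult_le_mono[OF k2 b(1)])
    also have "\<dots> \<le> 2 ^ (2 * \<kappa> + b)" by (simp add: power_add \<kappa>_def)
    finally have "(16 * k * m + 1) ^ (2 * k) \<le> (2 ^ (2 * \<kappa> + b)) ^ (2 * k)" by (rule power_mono) simp
    also have "\<dots> \<le> 2 ^ ((2 * \<kappa> + b) * (2 * \<kappa>))"
      unfolding power_mult[symmetric] by (rule power_increasing) (auto simp: \<kappa>_def intro: mult_le_mono)
    finally have p1: "(16 * k * m + 1) ^ (2 * k) \<le> 2 ^ ((2 * \<kappa> + b) * (2 * \<kappa>))" .
    have "16 * (4 * 4 ^ k * m) * 4 ^ X * (2 * (16 * k * m + 1) ^ (2 * k)) \<le>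
       16 * (4 * 4 ^ k * 2 ^ b) * 4 ^ X * (2 * 2 ^ ((2 * \<kappa> + b) * (2 * \<kappa>)))"
      by (intro mult_le_mono m2b p1 order_refl)
    also have "\<dots> = 2 ^ (4 + 2 * \<kappa> + b + 2 * X + 1 + (2 * \<kappa> + b) * (2 * \<kappa>))"
    proof -
      have "(4::nat) * 4 ^ k = 2 ^ (2 * \<kappa>)" "(4::nat) ^ X = 2 ^ (2 * X)" "(16::nat) = 2 ^ 4"
        by (simp_all add: \<kappa>_def power_mult)
      then show ?thesis by (simp only: power_add power_one_right mult_ac)
    qed
    also have "\<dots> < 2 ^ (11 * q)"
    proof (rule power_strict_increasing)
      have "(2 * \<kappa> + b) * (2 * \<kappa>) = 4 * \<kappa>\<^sup>2 + 2 * (b * \<kappa>)" by (simp add: power2_eq_square algebra_simps)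
      moreover have "2 * X = 4 * (b * \<kappa>)" by (simp add: X_def)
      ultimately show "4 + 2 * \<kappa> + b + 2 * X + 1 + (2 * \<kappa> + b) * (2 * \<kappa>) < 11 * q" using q by linarith
    qed simp
    finally have "real (16 * (4 * 4 ^ k * m) * 4 ^ X * (2 * (16 * k * m + 1) ^ (2 * k))) < real (2 ^ (11 * q))"
      by (simp only: of_nat_less_iff)
    also have "real (2 ^ (11 * q)) = sqrt J"
    proof -
      have "real J = (2 ^ (11 * q))\<^sup>2" by (simp add: J_def power_mult[symmetric])
      then show ?thesis by simp
    qed
    finally show ?thesis by simp
  qed
  have "f 0 \<noteq> 0" using f0 by auto
  from cosine_poly_value_bound[OF l m cz this[unfolded f_def] k[unfolded f_def] Xc XJ Jc]
  have main: "2 * \<bar>f 0\<bar> \<le> (4 * m * 4 ^ (J + X)) *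
    ((12 * (4 * m * 4 ^ (J + X)) * (k + 1) + 1)\<^sup>2) ^ (4 ^ (J + X) + 4 ^ (J + X) * 4 ^ (J + X))"
    unfolding f_def by simp
  define G where "G = 4 * m * 4 ^ (J + X)"
  define N1 where "N1 = (4::nat) ^ (J + X)"
  have N1: "N1 \<le> 2 ^ (3 * J)" "1 \<le> N1"
  proof -
    have "N1 = 2 ^ (2 * (J + X))" by (simp only: N1_def power_mult) simp
    also have "\<dots> \<le> 2 ^ (3 * J)" by (rule power_increasing) (use XJ in auto)
    finally show "N1 \<le> 2 ^ (3 * J)" .
  qed (simp add: N1_def)
  have G: "G \<le> 2 ^ (4 * J)" "1 \<le> G"
  proof -
    have "G \<le> (2 ^ 2 * 2 ^ b) * 2 ^ (3 * J)"
      unfolding G_def N1_def[symmetric] using m2b N1 by (intro mult_le_mono) auto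
    also have "\<dots> = 2 ^ (2 + b + 3 * J)" by (simp only: power_add)
    also have "\<dots> \<le> 2 ^ (4 * J)" by (rule power_increasing) (use q J22 in auto)
    finally show "G \<le> 2 ^ (4 * J)" .
    have "1 * 1 \<le> (4 * m) * N1" using m N1 by (intro mult_le_mono) auto
    then show "1 \<le> G" by (simp add: G_def N1_def)
  qed
  have s: "12 * G * \<kappa> + 1 \<le> 2 ^ (5 * J)"
  proof -
    have "12 * G * \<kappa> + 1 \<le> 16 * G * \<kappa>" using mult_le_mono[OF G(2), of 1 \<kappa>] by (simp add: \<kappa>_def)
    also have "\<dots> \<le> 2 ^ 4 * 2 ^ (4 * J) * 2 ^ \<kappa>"
      by (intro mult_le_mono G) (auto simp: less_imp_le[OF less_exp])
    also have "\<dots> = 2 ^ (4 + 4 * J + \<kappa>)" by (simp only: power_add)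
    also have "\<dots> \<le> 2 ^ (5 * J)" by (rule power_increasing) (use q J22 in auto)
    finally show ?thesis .
  qed
  have e: "N1 + N1 * N1 \<le> 2 ^ (7 * J)"
  proof -
    have "N1 + N1 * N1 \<le> 2 ^ 1 * (N1 * N1)" using N1(2) by simp
    also have "\<dots> \<le> 2 ^ 1 * (2 ^ (3 * J) * 2 ^ (3 * J))" by (intro mult_le_mono N1 order_refl)
    also have "\<dots> = 2 ^ (1 + 3 * J + 3 * J)" by (simp only: power_add mult_ac)
    also have "\<dots> \<le> 2 ^ (7 * J)" by (rule power_increasing) (use q J22 in auto)
    finally show ?thesis .
  qed
  have "G * ((12 * G * \<kappa> + 1)\<^sup>2) ^ (N1 + N1 * N1) \<le> 2 ^ (4 * J) * ((2 ^ (5 * J))\<^sup>2) ^ (2 ^ (7 * J))"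
  proof (rule mult_le_mono[OF G(1)])
    have "((12 * G * \<kappa> + 1)\<^sup>2) ^ (N1 + N1 * N1) \<le> ((2 ^ (5 * J))\<^sup>2) ^ (N1 + N1 * N1)"
      by (intro power_mono s) auto
    also have "\<dots> \<le> ((2 ^ (5 * J))\<^sup>2) ^ (2 ^ (7 * J))" by (rule power_increasing[OF e]) simp
    finally show "((12 * G * \<kappa> + 1)\<^sup>2) ^ (N1 + N1 * N1) \<le> ((2 ^ (5 * J))\<^sup>2) ^ (2 ^ (7 * J))" .
  qed
  also have "\<dots> = 2 ^ (4 * J + 10 * J * 2 ^ (7 * J))"
    by (simp only: power_add power_mult[symmetric]) (simp add: mult_ac)
  also have "\<dots> \<le> 2 ^ (2 ^ (9 * J))"
  proof (rule power_increasing)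
    have "J * 1 \<le> J * 2 ^ (7 * J)" by (rule mult_le_mono2) simp
    then have "4 * J + 10 * J * 2 ^ (7 * J) \<le> 16 * J * 2 ^ (7 * J)" unfolding mult.assoc by linarith
    also have "\<dots> \<le> 2 ^ 4 * 2 ^ J * 2 ^ (7 * J)"
      by (intro mult_le_mono) (auto simp: less_imp_le[OF less_exp])
    also have "\<dots> = 2 ^ (4 + J + 7 * J)" by (simp only: power_add)
    also have "\<dots> \<le> 2 ^ (9 * J)" by (rule power_increasing) (use q J22 in auto)
    finally show "4 * J + 10 * J * 2 ^ (7 * J) \<le> 2 ^ (9 * J)" .
  qed simp
  finally have "real (G * ((12 * G * \<kappa> + 1)\<^sup>2) ^ (N1 + N1 * N1)) \<le> real (2 ^ (2 ^ (9 * J)))"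
    by (rule of_nat_mono)
  moreover have "2 * \<bar>f 0\<bar> \<le> real (G * ((12 * G * \<kappa> + 1)\<^sup>2) ^ (N1 + N1 * N1))"
    using main by (simp add: G_def N1_def \<kappa>_def)
  ultimately have F: "\<bar>f 0\<bar> \<le> 2 ^ (2 ^ (9 * J))" by simp
  have "9 * J \<le> 2 ^ (4 + 22 * q)" by (simp add: J_def power_add)
  from iter_log2_3_le[OF f0 F this] have "iter_log2 3 \<bar>f 0\<bar> \<le> real (4 + 22 * q)" .
  also have "\<dots> \<le> real (23 * q)" using q by simp
  also have "\<dots> = 23 * real b * (real k + 1)\<^sup>2" by (simp add: q_def \<kappa>_def)
  finally show ?thesis .
qed

theorem theorem2:
  fixes R :: "real set"
  assumes "finite R" and "R \<noteq> {}" and "R \<subseteq> \<int>"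
  shows "\<exists>C C\<^sub>R :: real. C > 0 \<and> C\<^sub>R > 0 \<and>
    (\<forall>(n::nat) (c :: nat \<Rightarrow> real).
       n \<ge> 1 \<longrightarrow>
       (\<forall>r\<in>{0..n}. c r \<in> R) \<longrightarrow>
       \<bar>cosine_poly n c 0\<bar> \<ge> C * (log 2 (max_abs R))\<^sup>2 \<longrightarrow>
       \<bar>cosine_poly n c 0\<bar> > 2 ^ 16 \<longrightarrow>
       real (card (zeros_in_period (cosine_poly n c))) \<ge>
         C\<^sub>R * sqrt (iter_log2 3 \<bar>cosine_poly n c 0\<bar> / iter_log2 5 \<bar>cosine_poly n c 0\<bar>))"
proof -
  \<comment> \<open>The summand 1 guarantees m >= 1 even when R = {0}.\<close>
  define m where "m = nat \<lceil>max_abs R\<rceil> + 1"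
  have absR: "\<bar>x\<bar> \<le> max_abs R" if "x \<in> R" for x
    unfolding max_abs_def using assms(1) that by simp
  have absRm: "\<bar>x\<bar> \<le> real m" if "x \<in> R" for x
    using absR[OF that] unfolding m_def by linarith
  obtain l where l: "prime l" "l > 8 * m" using bigger_prime by blast
  define b where "b = l + 4"
  have "b < 2 ^ b" by (rule less_exp)
  moreover have "l \<le> b" "b \<ge> 4" by (simp_all add: b_def)
  ultimately have b: "l \<le> 2 ^ b" "b \<ge> 4" by linarith+
  define A where "A = 23 * real b"
  have A: "A > 0" using b by (simp add: A_def)
  have bound: "iter_log2 3 \<bar>cosine_poly n c 0\<bar> \<le> A * (real (card (zeros_in_period (cosine_poly n c))) + 1)\<^sup>2"
    if c: "\<forall>r\<in>{0..n}. c r \<in> R" and f0: "\<bar>cosine_poly n c 0\<bar> > 2 ^ 16" for n c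
  proof -
    define cz where "cz = (\<lambda>r. \<lfloor>c r\<rfloor>)"
    have cz: "of_int (cz r) = c r" if "r \<le> n" for r
    proof -
      have "c r \<in> \<int>" using c assms(3) that by auto
      then show ?thesis unfolding cz_def by (auto elim: Ints_cases)
    qed
    have eq: "cosine_poly n (\<lambda>r. of_int (cz r)) = cosine_poly n c"
      unfolding cosine_poly_def by (intro ext sum.cong) (auto simp: cz)
    have "\<bar>cz r\<bar> \<le> int m" if r: "r \<le> n" for r
    proof -
      have "\<bar>real_of_int (cz r)\<bar> \<le> real m" unfolding cz[OF r] using c r absRm by simp
      then show ?thesis by linarith
    qed
    moreover have "m \<ge> 1" by (simp add: m_def)
    moreover have "\<bar>cosine_poly n (\<lambda>r. of_int (cz r)) 0\<bar> > 2 ^ 2" using f0 unfolding eq by simp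
    ultimately have "iter_log2 3 \<bar>cosine_poly n (\<lambda>r. of_int (cz r)) 0\<bar> \<le>
        23 * real b * (real (card {x \<in> {0..2*pi}. cosine_poly n (\<lambda>r. of_int (cz r)) x = 0}) + 1)\<^sup>2"
      using l b by (intro cosine_poly_iter_log2_bound) auto
    then show ?thesis unfolding eq A_def zeros_in_period_def .
  qed
  \<comment> \<open>Beyond \<open>F1\<close> the third logarithm is at least A + 1, which rules out
    k = 0, and at least 4, which makes the fifth logarithm at least 1.\<close>
  define Z where "Z = max (A + 1) (2 powr 2)"
  define F1 where "F1 = 2 powr (2 powr (2 powr Z))"
  have log_ge: "y \<le> log 2 x" if "2 powr y \<le> x" for x y :: real
  proof -
    have "0 < 2 powr y" by simp
    then have "0 < x" using that by linarith
    then show ?thesis using that by (simp add: le_log_iff)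
  qed
  have large: "A + 1 \<le> iter_log2 3 F" "1 \<le> iter_log2 5 F" if "F1 \<le> F" for F
  proof -
    have *: "Z \<le> log 2 (log 2 (log 2 F))"
      using that unfolding F1_def by (intro log_ge)
    then show "A + 1 \<le> iter_log2 3 F" by (simp add: iter_log2_3 Z_def)
    have "2 powr (2 powr 1) \<le> log 2 (log 2 (log 2 F))" using * by (simp add: Z_def)
    then show "1 \<le> iter_log2 5 F" unfolding iter_log2_5 by (rule log_ge[OF log_ge])
  qed
  have mono: "iter_log2 3 x \<le> iter_log2 3 y" "iter_log2 5 x \<le> iter_log2 5 y" "0 < iter_log2 5 x" "0 < iter_log2 3 x"
    if "2 ^ 16 < x" "x \<le> y" for x y
  proof -
    have x1: "log 2 x > 2 ^ 4" using less_log_of_power[of 2 16 x] that by simp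
    have x2: "log 2 (log 2 x) > 2 ^ 2" using less_log_of_power[of 2 4 "log 2 x"] x1 by simp
    have x3: "log 2 (log 2 (log 2 x)) > 2" using less_log_of_power[of 2 2 "log 2 (log 2 x)"] x2 by simp
    have x4: "log 2 (log 2 (log 2 (log 2 x))) > 1" using less_log_of_power[of 2 1 "log 2 (log 2 (log 2 x))"] x3 by simp
    have x5: "log 2 (log 2 (log 2 (log 2 (log 2 x)))) > 0"
      using x4 by (subst zero_less_log_cancel_iff) auto
    have p1: "0 < log 2 x" using x1 by simp
    have p2: "0 < log 2 (log 2 x)" using x2 by simp
    have p3: "0 < log 2 (log 2 (log 2 x))" using x3 by simp
    have p4: "0 < log 2 (log 2 (log 2 (log 2 x)))" using x4 by simp
    have "0 < x" using that by (meson less_trans zero_less_numeral zero_less_power)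
    then have m1: "log 2 x \<le> log 2 y" using that(2) by (intro log_mono) auto
    have m2: "log 2 (log 2 x) \<le> log 2 (log 2 y)" by (rule log_mono[OF _ p1 m1]) simp
    have m3: "log 2 (log 2 (log 2 x)) \<le> log 2 (log 2 (log 2 y))" by (rule log_mono[OF _ p2 m2]) simp
    have m4: "log 2 (log 2 (log 2 (log 2 x))) \<le> log 2 (log 2 (log 2 (log 2 y)))" by (rule log_mono[OF _ p3 m3]) simp
    have m5: "log 2 (log 2 (log 2 (log 2 (log 2 x)))) \<le> log 2 (log 2 (log 2 (log 2 (log 2 y))))" by (rule log_mono[OF _ p4 m4]) simp
    show "iter_log2 3 x \<le> iter_log2 3 y" "iter_log2 5 x \<le> iter_log2 5 y" "0 < iter_log2 5 x" "0 < iter_log2 3 x"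
      unfolding iter_log2_3 iter_log2_5 using m3 m5 x5 x3 by auto
  qed
  \<comment> \<open>\<open>log_(5)\<close> vanishes at 2^16, so the hypothesis alone gives no
    positive lower bound for the denominator. An integer value above 2^16 is at least 2^16 + 1,
    which does.\<close>
  define e0 where "e0 = iter_log2 5 (2 ^ 16 + 1)"
  have e0: "e0 > 0" unfolding e0_def by (rule mono(3)[OF _ order_refl]) simp
  define B where "B = max (4 * A) (iter_log2 3 F1 / e0)"
  have B: "B > 0" using A by (simp add: B_def)
  have conclude: "1 / sqrt B * sqrt (iter_log2 3 F / iter_log2 5 F) \<le> real k"
    if "iter_log2 3 F / iter_log2 5 F \<le> B * (real k)\<^sup>2" for F k
  proof -
    have "sqrt (iter_log2 3 F / iter_log2 5 F) \<le> sqrt (B * (real k)\<^sup>2)" using that by simp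
    also have "\<dots> = sqrt B * real k" by (simp add: real_sqrt_mult)
    finally show ?thesis using B by (simp add: field_simps)
  qed
  show ?thesis
  \<comment> \<open>With C = \<open>F1\<close>, a value below \<open>F1\<close> is compatible with
    the growth hypothesis only if M(R) < 2; this leaves the coefficients -1, 0, 1 for the bounded
    range.\<close>
  proof (rule exI[of _ F1], rule exI[of _ "1 / sqrt B"], intro conjI allI impI)
    show "F1 > 0" by (simp add: F1_def)
    show "1 / sqrt B > 0" using B by simp
    fix n c
    define F where "F = \<bar>cosine_poly n c 0\<bar>"
    define k where "k = card (zeros_in_period (cosine_poly n c))"
    assume c: "\<forall>r\<in>{0..n}. c r \<in> R" and big: "F1 * (log 2 (max_abs R))\<^sup>2 \<le> \<bar>cosine_poly n c 0\<bar>"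
      and F16: "2 ^ 16 < \<bar>cosine_poly n c 0\<bar>"
    have b3: "iter_log2 3 F \<le> A * (real k + 1)\<^sup>2"
      using bound[OF c F16] by (simp add: F_def k_def)
    have "iter_log2 3 F / iter_log2 5 F \<le> B * (real k)\<^sup>2"
    proof (cases "F1 \<le> F")
      case True
      note lg = large[OF True]
      \<comment> \<open>For k = 0 the bound \<open>b3\<close> would say that the third logarithm is
        at most \<open>A\<close>. Once k >= 1, replacing k + 1 by 2 k costs the factor 4 in
        \<open>B\<close>.\<close>
      have "k \<noteq> 0"
      proof
        assume "k = 0"
        then show False using b3 lg(1) by simp
      qed
      then have "(real k + 1)\<^sup>2 \<le> (2 * real k)\<^sup>2" by (intro power_mono) auto
      then have "A * (real k + 1)\<^sup>2 \<le> A * (4 * (real k)\<^sup>2)" using A by (intro mult_left_mono) auto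
      also have "\<dots> \<le> B * (real k)\<^sup>2"
        using mult_right_mono[of "4 * A" B "(real k)\<^sup>2"] by (simp add: B_def mult_ac)
      finally have "iter_log2 3 F \<le> B * (real k)\<^sup>2" using b3 by linarith
      moreover have "iter_log2 3 F / iter_log2 5 F \<le> iter_log2 3 F / 1"
        using lg A by (intro divide_left_mono) auto
      ultimately show ?thesis by simp
    next
      case False
      have "max_abs R < 2"
      proof (rule ccontr)
        assume "\<not> max_abs R < 2"
        then have "1 \<le> log 2 (max_abs R)" by (simp add: le_log_iff)
        then have "F1 * 1 \<le> F1 * (log 2 (max_abs R))\<^sup>2"
          by (intro mult_left_mono) (auto simp: F1_def)
        then show False using False big by (simp add: F_def)
      qed
      have cint: "c r \<in> \<int>" if "r \<le> n" for r using c assms(3) that by auto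
      have c1: "c r \<in> {-1, 0, 1}" if r: "r \<le> n" for r
      proof -
        obtain z where z: "c r = of_int z" using cint[OF r] by (auto elim: Ints_cases)
        have "\<bar>c r\<bar> < 2" using absR[of "c r"] c r \<open>max_abs R < 2\<close> by fastforce
        then have "\<bar>z\<bar> < 2" unfolding z by linarith
        then have "z \<in> {-1, 0, 1}" by auto
        then show ?thesis by (auto simp: z)
      qed
      have "F > 1" using F16 unfolding F_def by simp
      then have "zeros_in_period (cosine_poly n c) \<noteq> {}"
        using cosine_poly_has_zero[of n c, OF c1] unfolding zeros_in_period_def F_def by auto
      moreover have "finite (zeros_in_period (cosine_poly n c))"
        unfolding zeros_in_period_def by (rule finite_zeros_cosine_poly) (use F16 in auto)
      ultimately have "k \<ge> 1" unfolding k_def by (simp add: Suc_leI card_gt_0_iff)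
      have "cosine_poly n c 0 \<in> \<int>"
        unfolding cosine_poly_def by (intro Ints_sum Ints_mult) (auto simp: cint)
      then obtain z where z: "cosine_poly n c 0 = of_int z" by (auto elim: Ints_cases)
      have "65536 < real_of_int \<bar>z\<bar>" using F16 unfolding z by simp
      then have "real_of_int 65536 < real_of_int \<bar>z\<bar>" by simp
      then have "65537 \<le> \<bar>z\<bar>" unfolding of_int_less_iff by linarith
      then have "real_of_int 65537 \<le> real_of_int \<bar>z\<bar>" by (simp only: of_int_le_iff)
      then have "2 ^ 16 + 1 \<le> F" by (simp add: F_def z)
      then have "e0 \<le> iter_log2 5 F" unfolding e0_def by (intro mono(2)) auto
      moreover have "iter_log2 3 F \<le> iter_log2 3 F1" "0 < iter_log2 3 F"
        using mono(1,4)[of F F1] F16 False by (auto simp: F_def)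
      ultimately have "iter_log2 3 F / iter_log2 5 F \<le> iter_log2 3 F1 / e0"
        using e0 by (intro frac_le) auto
      also have "\<dots> \<le> B * 1" by (simp add: B_def)
      also have "\<dots> \<le> B * (real k)\<^sup>2" using B \<open>k \<ge> 1\<close> by (intro mult_left_mono) auto
      finally show ?thesis .
    qed
    from conclude[OF this] show "1 / sqrt B * sqrt (iter_log2 3 \<bar>cosine_poly n c 0\<bar> / iter_log2 5 \<bar>cosine_poly n c 0\<bar>) \<le>
        real (card (zeros_in_period (cosine_poly n c)))"
      unfolding F_def k_def .
  qed
qed

end
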